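(* Let $\mathcal L$ be a language, and let $\varphi(x,y)$ be an affine $\mathcal L$-formula. Let $(\Omega,\mathcal B,\mu)$ be a probability space, and $(M_\Omega,e_I)$ a measurable field of $\mathcal L$-structures based on it. If $\varphi$ is stable in $M_\omega$ for almost every $\omega\in\Omega$, then $\varphi$ is stable in the direct integral $M_{\Omega,I}=\int^\oplus_\Omega M_\omega\,d\mu(\omega)$.
   Context: Logic. Languages $\mathcal L$ and structures are those of continuous (metric) first-order logic: languages may be many-sorted; each sort of a structure is a non-empty bounded complete metric space with distance symbol $d$; predicate symbols are bounded and real-valued; bounds and (concave) moduli of uniform continuity of all symbols are prescribed by $\mathcal L$. Affine formulas are built from atomic formulas (including $d(t,t')$) using only affine connectives (real constants, sums, multiplication by real scalars) and the quantifiers $\sup$, $\inf$. For a sublanguage $\mathcal L_0\subseteq\mathcal L$, $M\preceq^{\mathrm{aff}}_{\mathcal L_0}N$ means that $M$ is an $\mathcal L_0$-substructure of $N$ and $\psi^M(a)=\psi^N(a)$ for every affine $\mathcal L_0$-formula $\psi$ and tuple $a$ in $M$. Stability. $\varphi(x,y)$ is stable in a structure $M$ if for all sequences $(a_n)\subseteq M^x$ and $(b_n)\subseteq M^y$, $\lim_n\lim_m\varphi(a_n,b_m)=\lim_m\lim_n\varphi(a_n,b_m)$ whenever all the limits exist. Measurable fields. A measurable field of $\mathcal L$-structures based on $(\Omega,\mathcal B,\mu)$ is a family $M_\Omega=(M_\omega:\omega\in\Omega)$ of $\mathcal L$-structures together with a tuple $e_I=(e_i:i\in I)$ of sections $e_i\colon\Omega\to\coprod_{\omega}M_\omega$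 ($e_i(\omega)\in M_\omega$, each $e_i$ of a fixed sort) such that: (a) $\{e_i(\omega):i\in I\}$ is dense in $M_\omega$ for every $\omega$; (b) for every predicate symbol $P$ (including $d$), function symbol $F$, $i\in I$, and finite subtuple $\bar e$ of $e_I$ of the appropriate sort, the functions $\omega\mapsto P^{M_\omega}(\bar e(\omega))$ and $\omega\mapsto d(F^{M_\omega}(\bar e(\omega)),e_i(\omega))$ are $\mathcal B$-measurable; (c) for $I_0\subseteq I$ put $M_{\omega,I_0}=\overline{\{e_i(\omega):i\in I_0\}}\subseteq M_\omega$; then for every finite (equivalently, countable) sublanguage $\mathcal L_0\subseteq\mathcal L$, the collection of countable $I_0\subseteq I$ such that $M_{\omega,I_0}\preceq^{\mathrm{aff}}_{\mathcal L_0}M_\omega$ for $\mu$-almost every $\omega$ is cofinal (under inclusion) in the collection of countable subsets of $I$. Direct integral. A simple section is one of the form $\omega\mapsto e_{k(\omega)}(\omega)$ with $k\colon\Omega\to I$ measurable of finite range (the $e_i$, $i$ in the range of $k$, being of the same sort). A measurable section is an almost sure pointwise limit of a sequence of simple sections. The direct integral $M_{\Omega,I}=\int^\oplus_\Omega M_\omega\,d\mu(\omega)$ is the set of measurable sections up to almost everywhere equality, with metric $d(f,g)=\int_\Omega d(f(\omega),g(\omega))\,d\mu$, function symbols interpreted pointwise, and predicates by $P(f)=\int_\Omega P^{M_\omega}(f(\omega))\,d\mu$; it is an $\mathcal L$-structure. *)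

theory Defs
  imports "HOL-Probability.Probability"
begin

section \<open>Many-sorted continuous languages and structures\<close>

record ('s, 'p, 'f) lang =
  sorts :: "'s set"
  preds :: "'p set"
  funs :: "'f set"
  sbound :: "'s \<Rightarrow> real"
  pdom :: "'p \<Rightarrow> 's list"
  pbound :: "'p \<Rightarrow> real"
  pmod :: "'p \<Rightarrow> real \<Rightarrow> real"
  fdom :: "'f \<Rightarrow> 's list"
  fcod :: "'f \<Rightarrow> 's"
  fmod :: "'f \<Rightarrow> real \<Rightarrow> real"

definition modulus :: "(real \<Rightarrow> real) \<Rightarrow> bool" where
  "modulus \<Delta> \<longleftrightarrow> \<Delta> 0 = 0 \<and> continuous_on {0..} \<Delta> \<and> mono_on {0..} \<Delta> \<and> concave_on {0..} \<Delta>"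

text \<open>The distance symbols are not listed among the predicate symbols: there is one for every
  sort, bounded by \<open>sbound\<close>. Constants are function symbols with empty domain.\<close>

definition language :: "('s, 'p, 'f) lang \<Rightarrow> bool" where
  "language L \<longleftrightarrow>
     (\<forall>P\<in>preds L. set (pdom L P) \<subseteq> sorts L \<and> modulus (pmod L P)) \<and>
     (\<forall>F\<in>funs L. set (fdom L F) \<subseteq> sorts L \<and> fcod L F \<in> sorts L \<and> modulus (fmod L F))"

definition sublanguage :: "('s, 'p, 'f) lang \<Rightarrow> ('s, 'p, 'f) lang \<Rightarrow> bool" where
  "sublanguage L0 L \<longleftrightarrow> language L0 \<and>
     (\<exists>S Ps Fs. S \<subseteq> sorts L \<and> Ps \<subseteq> preds L \<and> Fs \<subseteq> funs L \<and>
        L0 = L\<lparr>sorts := S, preds := Ps, funs := Fs\<rparr>)"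

definition finite_language :: "('s, 'p, 'f) lang \<Rightarrow> bool" where
  "finite_language L \<longleftrightarrow> finite (sorts L) \<and> finite (preds L) \<and> finite (funs L)"

text \<open>All sorts of a structure live in a single type \<open>'a\<close>; only the values of the components on
  tuples from the universes of the appropriate sorts are meaningful. (The locale \<open>Metric_space\<close> also
  asks for nonnegativity and symmetry of the junk values of \<open>dst\<close>, which is no restriction.)\<close>

record ('s, 'p, 'f, 'a) aff_struct =
  univ :: "'s \<Rightarrow> 'a set"
  dst :: "'s \<Rightarrow> 'a \<Rightarrow> 'a \<Rightarrow> real"
  prd :: "'p \<Rightarrow> 'a list \<Rightarrow> real"
  fn :: "'f \<Rightarrow> 'a list \<Rightarrow> 'a"

definition tuples :: "('s, 'p, 'f, 'a) aff_struct \<Rightarrow> 's list \<Rightarrow> 'a list set" where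
  "tuples M ss = {as. list_all2 (\<lambda>a s. a \<in> univ M s) as ss}"

definition tdist :: "('s, 'p, 'f, 'a) aff_struct \<Rightarrow> 's list \<Rightarrow> 'a list \<Rightarrow> 'a list \<Rightarrow> real" where
  "tdist M ss as bs = (\<Sum>k<length ss. dst M (ss ! k) (as ! k) (bs ! k))"

definition is_structure :: "('s, 'p, 'f) lang \<Rightarrow> ('s, 'p, 'f, 'a) aff_struct \<Rightarrow> bool" where
  "is_structure L M \<longleftrightarrow>
     (\<forall>s\<in>sorts L. univ M s \<noteq> {} \<and> Metric_space (univ M s) (dst M s) \<and>
        Metric_space.mcomplete (univ M s) (dst M s) \<and>
        (\<forall>a\<in>univ M s. \<forall>b\<in>univ M s. dst M s a b \<le> sbound L s)) \<and>
     (\<forall>P\<in>preds L. \<forall>as\<in>tuples M (pdom L P).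
        \<bar>prd M P as\<bar> \<le> pbound L P \<and>
        (\<forall>bs\<in>tuples M (pdom L P).
           \<bar>prd M P as - prd M P bs\<bar> \<le> pmod L P (tdist M (pdom L P) as bs))) \<and>
     (\<forall>F\<in>funs L. \<forall>as\<in>tuples M (fdom L F).
        fn M F as \<in> univ M (fcod L F) \<and>
        (\<forall>bs\<in>tuples M (fdom L F).
           dst M (fcod L F) (fn M F as) (fn M F bs) \<le> fmod L F (tdist M (fdom L F) as bs)))"


section \<open>Affine formulas\<close>

type_synonym 's var = "'s \<times> nat"

datatype ('s, 'f) trm = Var "'s var" | App 'f "('s, 'f) trm list"

primrec trm_sort :: "('s, 'p, 'f) lang \<Rightarrow> ('s, 'f) trm \<Rightarrow> 's" where
  "trm_sort L (Var x) = fst x"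
| "trm_sort L (App F ts) = fcod L F"

primrec wf_trm :: "('s, 'p, 'f) lang \<Rightarrow> ('s, 'f) trm \<Rightarrow> bool" where
  "wf_trm L (Var x) \<longleftrightarrow> fst x \<in> sorts L"
| "wf_trm L (App F ts) \<longleftrightarrow>
     F \<in> funs L \<and> map (trm_sort L) ts = fdom L F \<and> list_all id (map (wf_trm L) ts)"

primrec trm_vars :: "('s, 'f) trm \<Rightarrow> 's var set" where
  "trm_vars (Var x) = {x}"
| "trm_vars (App F ts) = \<Union> (set (map trm_vars ts))"

primrec trm_val :: "('s, 'p, 'f, 'a) aff_struct \<Rightarrow> ('s var \<Rightarrow> 'a) \<Rightarrow> ('s, 'f) trm \<Rightarrow> 'a" where
  "trm_val M v (Var x) = v x"
| "trm_val M v (App F ts) = fn M F (map (trm_val M v) ts)"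

datatype ('s, 'p, 'f) fml =
    Dist 's "('s, 'f) trm" "('s, 'f) trm"
  | Pred 'p "('s, 'f) trm list"
  | Const real
  | Plus "('s, 'p, 'f) fml" "('s, 'p, 'f) fml"
  | Scale real "('s, 'p, 'f) fml"
  | QSup "'s var" "('s, 'p, 'f) fml"
  | QInf "'s var" "('s, 'p, 'f) fml"

primrec affine_formula :: "('s, 'p, 'f) lang \<Rightarrow> ('s, 'p, 'f) fml \<Rightarrow> bool" where
  "affine_formula L (Dist s t u) \<longleftrightarrow>
     s \<in> sorts L \<and> wf_trm L t \<and> wf_trm L u \<and> trm_sort L t = s \<and> trm_sort L u = s"
| "affine_formula L (Pred P ts) \<longleftrightarrow>
     P \<in> preds L \<and> map (trm_sort L) ts = pdom L P \<and> (\<forall>t\<in>set ts. wf_trm L t)"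
| "affine_formula L (Const r) \<longleftrightarrow> True"
| "affine_formula L (Plus \<phi> \<psi>) \<longleftrightarrow> affine_formula L \<phi> \<and> affine_formula L \<psi>"
| "affine_formula L (Scale r \<phi>) \<longleftrightarrow> affine_formula L \<phi>"
| "affine_formula L (QSup x \<phi>) \<longleftrightarrow> fst x \<in> sorts L \<and> affine_formula L \<phi>"
| "affine_formula L (QInf x \<phi>) \<longleftrightarrow> fst x \<in> sorts L \<and> affine_formula L \<phi>"

primrec free_vars :: "('s, 'p, 'f) fml \<Rightarrow> 's var set" where
  "free_vars (Dist s t u) = trm_vars t \<union> trm_vars u"
| "free_vars (Pred P ts) = (\<Union>t\<in>set ts. trm_vars t)"
| "free_vars (Const r) = {}"
| "free_vars (Plus \<phi> \<psi>) = free_vars \<phi> \<union> free_vars \<psi>"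
| "free_vars (Scale r \<phi>) = free_vars \<phi>"
| "free_vars (QSup x \<phi>) = free_vars \<phi> - {x}"
| "free_vars (QInf x \<phi>) = free_vars \<phi> - {x}"

primrec val :: "('s, 'p, 'f, 'a) aff_struct \<Rightarrow> ('s, 'p, 'f) fml \<Rightarrow> ('s var \<Rightarrow> 'a) \<Rightarrow> real" where
  "val M (Dist s t u) v = dst M s (trm_val M v t) (trm_val M v u)"
| "val M (Pred P ts) v = prd M P (map (trm_val M v) ts)"
| "val M (Const r) v = r"
| "val M (Plus \<phi> \<psi>) v = val M \<phi> v + val M \<psi> v"
| "val M (Scale r \<phi>) v = r * val M \<phi> v"
| "val M (QSup x \<phi>) v = (SUP a\<in>univ M (fst x). val M \<phi> (v(x := a)))"
| "val M (QInf x \<phi>) v = (INF a\<in>univ M (fst x). val M \<phi> (v(x := a)))"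

text \<open>A tuple of variables is a set \<open>X\<close> of sorted variables; \<open>tuples_on M X\<close> is \<open>M\<^sup>X\<close>.\<close>

definition tuples_on :: "('s, 'p, 'f, 'a) aff_struct \<Rightarrow> 's var set \<Rightarrow> ('s var \<Rightarrow> 'a) set" where
  "tuples_on M X = (\<Pi>\<^sub>E x\<in>X. univ M (fst x))"

definition substructure ::
  "('s, 'p, 'f) lang \<Rightarrow> ('s, 'p, 'f, 'a) aff_struct \<Rightarrow> ('s, 'p, 'f, 'a) aff_struct \<Rightarrow> bool" where
  "substructure L M N \<longleftrightarrow> is_structure L M \<and> is_structure L N \<and>
     (\<forall>s\<in>sorts L. univ M s \<subseteq> univ N s \<and>
        (\<forall>a\<in>univ M s. \<forall>b\<in>univ M s. dst M s a b = dst N s a b)) \<and>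
     (\<forall>P\<in>preds L. \<forall>as\<in>tuples M (pdom L P). prd M P as = prd N P as) \<and>
     (\<forall>F\<in>funs L. \<forall>as\<in>tuples M (fdom L F). fn M F as = fn N F as)"

definition affine_substructure ::
  "('s, 'p, 'f) lang \<Rightarrow> ('s, 'p, 'f, 'a) aff_struct \<Rightarrow> ('s, 'p, 'f, 'a) aff_struct \<Rightarrow> bool" where
  "affine_substructure L M N \<longleftrightarrow> substructure L M N \<and>
     (\<forall>\<psi>. affine_formula L \<psi> \<longrightarrow>
        (\<forall>v\<in>tuples_on M (free_vars \<psi>). val M \<psi> v = val N \<psi> v))"


section \<open>Stability\<close>

text \<open>The value \<open>\<phi>\<^sup>M(a, b)\<close> for \<open>a \<in> M\<^sup>X\<close> and \<open>b \<in> M\<^sup>Y\<close>, where \<open>X\<close> and \<open>Y\<close> are disjoint and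
  cover the free variables of \<open>\<phi>\<close>.\<close>

definition val2 :: "('s, 'p, 'f, 'a) aff_struct \<Rightarrow> 's var set \<Rightarrow> ('s, 'p, 'f) fml \<Rightarrow>
    ('s var \<Rightarrow> 'a) \<Rightarrow> ('s var \<Rightarrow> 'a) \<Rightarrow> real" where
  "val2 M X \<phi> a b = val M \<phi> (\<lambda>x. if x \<in> X then a x else b x)"

definition stable_formula :: "('s, 'p, 'f, 'a) aff_struct \<Rightarrow> 's var set \<Rightarrow> 's var set \<Rightarrow>
    ('s, 'p, 'f) fml \<Rightarrow> bool" where
  "stable_formula M X Y \<phi> \<longleftrightarrow>
     (\<forall>(a :: nat \<Rightarrow> 's var \<Rightarrow> 'a) (b :: nat \<Rightarrow> 's var \<Rightarrow> 'a).
        range a \<subseteq> tuples_on M X \<longrightarrow> range b \<subseteq> tuples_on M Y \<longrightarrow>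
        (\<forall>n. convergent (\<lambda>m. val2 M X \<phi> (a n) (b m))) \<longrightarrow>
        (\<forall>m. convergent (\<lambda>n. val2 M X \<phi> (a n) (b m))) \<longrightarrow>
        convergent (\<lambda>n. lim (\<lambda>m. val2 M X \<phi> (a n) (b m))) \<longrightarrow>
        convergent (\<lambda>m. lim (\<lambda>n. val2 M X \<phi> (a n) (b m))) \<longrightarrow>
        lim (\<lambda>n. lim (\<lambda>m. val2 M X \<phi> (a n) (b m))) =
        lim (\<lambda>m. lim (\<lambda>n. val2 M X \<phi> (a n) (b m))))"


section \<open>Measurable fields and direct integrals\<close>

text \<open>\<open>generated_sub M \<sigma> e I0 \<omega>\<close> is the closure of \<open>{e\<^sub>i(\<omega>) : i \<in> I0}\<close> in \<open>M\<^sub>\<omega>\<close>, sort by sort,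
  with the distances, predicates and functions of \<open>M\<^sub>\<omega>\<close>.\<close>

definition generated_sub :: "('w \<Rightarrow> ('s, 'p, 'f, 'a) aff_struct) \<Rightarrow> ('i \<Rightarrow> 's) \<Rightarrow> ('i \<Rightarrow> 'w \<Rightarrow> 'a) \<Rightarrow>
    'i set \<Rightarrow> 'w \<Rightarrow> ('s, 'p, 'f, 'a) aff_struct" where
  "generated_sub M \<sigma> e I0 \<omega> = (M \<omega>)\<lparr>univ := (\<lambda>s.
     Metric_space.mtopology (univ (M \<omega>) s) (dst (M \<omega>) s) closure_of {e i \<omega> | i. i \<in> I0 \<and> \<sigma> i = s})\<rparr>"

text \<open>\<open>I\<close> is the index set of the distinguished sections \<open>e\<close>, and \<open>\<sigma> i\<close> is the sort of \<open>e i\<close>.\<close>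

definition measurable_field :: "('s, 'p, 'f) lang \<Rightarrow> 'w measure \<Rightarrow>
    ('w \<Rightarrow> ('s, 'p, 'f, 'a) aff_struct) \<Rightarrow> 'i set \<Rightarrow> ('i \<Rightarrow> 's) \<Rightarrow> ('i \<Rightarrow> 'w \<Rightarrow> 'a) \<Rightarrow> bool" where
  "measurable_field L \<mu> M I \<sigma> e \<longleftrightarrow>
     (\<forall>\<omega>\<in>space \<mu>. is_structure L (M \<omega>)) \<and>
     (\<forall>i\<in>I. \<sigma> i \<in> sorts L \<and> (\<forall>\<omega>\<in>space \<mu>. e i \<omega> \<in> univ (M \<omega>) (\<sigma> i))) \<and>
     (\<forall>\<omega>\<in>space \<mu>. \<forall>s\<in>sorts L.
        Metric_space.mtopology (univ (M \<omega>) s) (dst (M \<omega>) s) closure_of {e i \<omega> | i. i \<in> I \<and> \<sigma> i = s}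
          = univ (M \<omega>) s) \<and>
     (\<forall>i\<in>I. \<forall>j\<in>I. \<sigma> i = \<sigma> j \<longrightarrow> (\<lambda>\<omega>. dst (M \<omega>) (\<sigma> i) (e i \<omega>) (e j \<omega>)) \<in> borel_measurable \<mu>) \<and>
     (\<forall>P\<in>preds L. \<forall>js. set js \<subseteq> I \<and> map \<sigma> js = pdom L P \<longrightarrow>
        (\<lambda>\<omega>. prd (M \<omega>) P (map (\<lambda>j. e j \<omega>) js)) \<in> borel_measurable \<mu>) \<and>
     (\<forall>F\<in>funs L. \<forall>js. \<forall>i\<in>I. set js \<subseteq> I \<and> map \<sigma> js = fdom L F \<and> \<sigma> i = fcod L F \<longrightarrow>
        (\<lambda>\<omega>. dst (M \<omega>) (fcod L F) (fn (M \<omega>) F (map (\<lambda>j. e j \<omega>) js)) (e i \<omega>))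
          \<in> borel_measurable \<mu>) \<and>
     (\<forall>L0. sublanguage L0 L \<and> finite_language L0 \<longrightarrow>
        (\<forall>J. countable J \<and> J \<subseteq> I \<longrightarrow>
           (\<exists>I0. countable I0 \<and> J \<subseteq> I0 \<and> I0 \<subseteq> I \<and>
              (AE \<omega> in \<mu>. affine_substructure L0 (generated_sub M \<sigma> e I0 \<omega>) (M \<omega>)))))"

definition simple_section :: "'w measure \<Rightarrow> 'i set \<Rightarrow> ('i \<Rightarrow> 's) \<Rightarrow> ('i \<Rightarrow> 'w \<Rightarrow> 'a) \<Rightarrow>
    's \<Rightarrow> ('w \<Rightarrow> 'a) \<Rightarrow> bool" where
  "simple_section \<mu> I \<sigma> e s f \<longleftrightarrow>
     (\<exists>k. simple_function \<mu> k \<and> k ` space \<mu> \<subseteq> {i \<in> I. \<sigma> i = s} \<and>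
        (\<forall>\<omega>\<in>space \<mu>. f \<omega> = e (k \<omega>) \<omega>))"

definition measurable_section :: "'w measure \<Rightarrow> ('w \<Rightarrow> ('s, 'p, 'f, 'a) aff_struct) \<Rightarrow> 'i set \<Rightarrow>
    ('i \<Rightarrow> 's) \<Rightarrow> ('i \<Rightarrow> 'w \<Rightarrow> 'a) \<Rightarrow> 's \<Rightarrow> ('w \<Rightarrow> 'a) \<Rightarrow> bool" where
  "measurable_section \<mu> M I \<sigma> e s f \<longleftrightarrow>
     (\<forall>\<omega>\<in>space \<mu>. f \<omega> \<in> univ (M \<omega>) s) \<and>
     (\<exists>g :: nat \<Rightarrow> 'w \<Rightarrow> 'a. (\<forall>n. simple_section \<mu> I \<sigma> e s (g n)) \<and>
        (AE \<omega> in \<mu>. (\<lambda>n. dst (M \<omega>) s (g n \<omega>) (f \<omega>)) \<longlonglongrightarrow> 0))"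

definition ae_eq :: "'w measure \<Rightarrow> ('w \<Rightarrow> ('s, 'p, 'f, 'a) aff_struct) \<Rightarrow> 'i set \<Rightarrow> ('i \<Rightarrow> 's) \<Rightarrow>
    ('i \<Rightarrow> 'w \<Rightarrow> 'a) \<Rightarrow> 's \<Rightarrow> (('w \<Rightarrow> 'a) \<times> ('w \<Rightarrow> 'a)) set" where
  "ae_eq \<mu> M I \<sigma> e s = {(f, g). measurable_section \<mu> M I \<sigma> e s f \<and>
     measurable_section \<mu> M I \<sigma> e s g \<and> (AE \<omega> in \<mu>. f \<omega> = g \<omega>)}"

definition rep :: "('w \<Rightarrow> 'a) set \<Rightarrow> 'w \<Rightarrow> 'a" where
  "rep f = (SOME h. h \<in> f)"

text \<open>Elements are classes of measurable sections modulo almost everywhere equality; the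
  interpretations do not depend on the chosen representatives. As \<open>\<mu>\<close> need not be complete, a
  measurable section is only measurable up to a null set. Hence the integrals are taken with
  respect to the completion of \<open>\<mu>\<close>; over \<open>\<mu>\<close> itself the Bochner integral of a function that
  is merely almost everywhere equal to a measurable one could be the default value 0.\<close>

definition direct_integral :: "('s, 'p, 'f) lang \<Rightarrow> 'w measure \<Rightarrow>
    ('w \<Rightarrow> ('s, 'p, 'f, 'a) aff_struct) \<Rightarrow> 'i set \<Rightarrow> ('i \<Rightarrow> 's) \<Rightarrow> ('i \<Rightarrow> 'w \<Rightarrow> 'a) \<Rightarrow>
    ('s, 'p, 'f, ('w \<Rightarrow> 'a) set) aff_struct" where
  "direct_integral L \<mu> M I \<sigma> e = \<lparr>
     univ = (\<lambda>s. {f. measurable_section \<mu> M I \<sigma> e s f} // ae_eq \<mu> M I \<sigma> e s),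
     dst = (\<lambda>s f g. \<integral>\<omega>. dst (M \<omega>) s (rep f \<omega>) (rep g \<omega>) \<partial>completion \<mu>),
     prd = (\<lambda>P fs. \<integral>\<omega>. prd (M \<omega>) P (map (\<lambda>f. rep f \<omega>) fs) \<partial>completion \<mu>),
     fn = (\<lambda>F fs. ae_eq \<mu> M I \<sigma> e (fcod L F) `` {\<lambda>\<omega>. fn (M \<omega>) F (map (\<lambda>f. rep f \<omega>) fs)})\<rparr>"

end

theory Submission
  imports Defs "HOL-Complex_Analysis.Great_Picard"
begin

text \<open>
  The proof has an analytic half, about arrays of real numbers, and a model-theoretic half.

  Fix sequences of tuples \<open>a\<^sub>n\<close> and \<open>b\<^sub>m\<close> of measurable sections and put
  \<open>F\<^sub>n\<^sub>m(\<omega>) = \<phi>(a\<^sub>n(\<omega>), b\<^sub>m(\<omega>))\<close>. For almost every \<open>\<omega>\<close> the array \<open>F(\<omega>)\<close> satisfies the double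
  limit condition along all sequences of rows and of columns (\<open>stable_array\<close>), and the claim is
  that the two iterated limits of \<open>\<integral> F\<^sub>n\<^sub>m\<close> agree. The subsequences along which \<open>F(\<omega>)\<close> converges
  depend on \<open>\<omega>\<close>, so no common choice of them is possible. Convex combinations replace them. Among
  the averages of the tails of a bounded sequence of functions, those of nearly minimal
  \<open>L\<^sup>2\<close>-norm form a Cauchy sequence, by the parallelogram identity, and a subsequence of them converges
  almost everywhere (\<open>forward_averages_AE_convergent\<close>). Averaging first the rows and then the columns
  of \<open>F\<close> in this way changes neither of the two iterated limits of \<open>\<integral> F\<^sub>n\<^sub>m\<close>, and afterwards
  all rows and all columns converge at almost every \<open>\<omega>\<close>. If the averaged array is still stable at
  \<open>\<omega>\<close>, then its iterated limits agree there, and dominated convergence finishes the argument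
  (\<open>integral_of_stable_arrays\<close>).

  What remains is that averages of the rows of a stable array form a stable array
  (\<open>stable_array_average_rows\<close>), the double limit form of Krein's theorem on convex hulls of weakly
  compact sets. Suppose that every row converges along a sequence of columns, and view the differences
  between these columns and their limit as bounded functions of the row. By stability, whenever all these
  differences converge along some sequence of rows, their limits tend to zero. Simons' construction turns
  this into convex combinations of the differences that are uniformly small
  (\<open>zero_in_closure_convex_hull\<close>). A uniformly small function has a small average for any weights,
  which lets the two limits be exchanged.

  The model-theoretic half is the identity
  \<open>\<phi>(f) = \<integral> \<phi>(f(\<omega>)) d\<mu>\<close> for affine formulas in the direct integral (\<open>val_direct_integral\<close>). Sums
  and scalar multiples are harmless because integration is linear. The work is in the quantifiers and in
  the function symbols: one needs measurable choices. The elementarity condition on a measurable field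
  provides, for a given formula and given sections, a countable set of distinguished sections
  over which the supremum of the formula may be taken, at almost every \<open>\<omega>\<close>, without changing its value
  (\<open>QSup_countable\<close>). Hence the supremum is measurable, and a simple section, switching
  between finitely many distinguished ones, nearly realises it outside a set of small measure
  (\<open>simple_selection_completion\<close>).
\<close>

section \<open>Convex combinations close to zero\<close>

lemma near_minimiser_exists:
  fixes F :: "'a \<Rightarrow> real"
  assumes "D \<noteq> {}" and "\<And>x. x \<in> D \<Longrightarrow> 0 \<le> F x" and "\<epsilon> > 0"
  shows "\<exists>x\<in>D. \<forall>y\<in>D. F x \<le> F y + \<epsilon>"
proof -
  have bdd: "bdd_below (F ` D)" by (rule bdd_belowI[of _ 0]) (use assms(2) in auto)
  have "\<exists>z\<in>F ` D. z < Inf (F ` D) + \<epsilon>"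
    using assms(1,3) cInf_lessD[of "F ` D" "Inf (F ` D) + \<epsilon>"] by auto
  then obtain x where x: "x \<in> D" "F x < Inf (F ` D) + \<epsilon>" by auto
  moreover have "Inf (F ` D) \<le> F y" if "y \<in> D" for y using cInf_lower[OF _ bdd] that by auto
  ultimately show ?thesis by (intro bexI[of _ x]) force+
qed

lemma halving_series:
  fixes g :: "nat \<Rightarrow> 'a::banach"
  assumes "\<And>i. norm (g i) \<le> C"
  shows "summable (\<lambda>i. (1/2) ^ Suc i *\<^sub>R g i)"
    and "\<And>D. (\<And>i. g i \<in> D) \<Longrightarrow> convex D \<Longrightarrow> (\<Sum>i. (1/2) ^ Suc i *\<^sub>R g i) \<in> closure D"
proof -
  show S: "summable (\<lambda>i. (1/2) ^ Suc i *\<^sub>R g i)"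
  proof (rule summable_comparison_test)
    show "\<exists>N. \<forall>n\<ge>N. norm ((1/2) ^ Suc n *\<^sub>R g n) \<le> C * (1/2) ^ Suc n"
      using assms by (auto intro!: exI[of _ 0] simp: mult_left_mono field_simps)
    show "summable (\<lambda>n. C * (1/2::real) ^ Suc n)"
      by (intro summable_mult) (simp add: summable_geometric)
  qed
  fix D assume D: "\<And>i. g i \<in> D" and cv: "convex D"
  define p where "p n = (\<Sum>i<n. (1/2) ^ Suc i *\<^sub>R g i) + (1/2)^n *\<^sub>R g 0" for n
  have "(\<Sum>i<n. (1/2) ^ Suc i *\<^sub>R g i) + (1/2)^n *\<^sub>R x \<in> D" if "x \<in> D" for n x
    using that
  proof (induction n arbitrary: x)
    case (Suc n)
    have "(1/2) *\<^sub>R g n + (1/2) *\<^sub>R x \<in> D" using cv D Suc.prems by (intro convexD) auto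
    from Suc.IH[OF this] show ?case by (simp add: algebra_simps)
  qed simp
  then have pD: "p n \<in> D" for n using D by (simp add: p_def)
  have "p \<longlonglongrightarrow> (\<Sum>i. (1/2) ^ Suc i *\<^sub>R g i) + 0 *\<^sub>R g 0"
    unfolding p_def using summable_LIMSEQ[OF S]
    by (intro tendsto_intros) (auto intro!: LIMSEQ_power_zero)
  then show "(\<Sum>i. (1/2) ^ Suc i *\<^sub>R g i) \<in> closure D"
    using pD by (auto simp: closure_sequential)
qed

text \<open>
  Simons' argument. Suppose that all convex combinations of the \<open>f\<^sub>l\<close> have norm at least \<open>m > 0\<close>. Choose
  \<open>g\<^sub>j\<close> in the convex hull of \<open>{f\<^sub>l : l \<ge> j}\<close> one after the other such that
  \<open>h\<^sub>j + 2\<^sup>-\<^sup>j g\<^sub>j\<close> has nearly minimal norm, where \<open>h\<^sub>j = g\<^sub>0/2 + \<dots> + g\<^sub>j\<^sub>-\<^sub>1/2\<^sup>j\<close>, and let \<open>H\<close> be the limit of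
  the \<open>h\<^sub>j\<close>. The tail \<open>2\<^sup>j (H - h\<^sub>j)\<close> lies in the closed hull of \<open>{f\<^sub>l : l \<ge> j}\<close> and so competes with
  \<open>g\<^sub>j\<close>; hence \<open>\<parallel>2 h\<^sub>j\<^sub>+\<^sub>1 - h\<^sub>j\<parallel> \<le> \<parallel>H\<parallel> + \<epsilon>\<^sub>j\<close>. For a functional \<open>\<tau>\<close> of norm at most 1 with \<open>\<tau> H\<close> close to
  \<open>\<parallel>H\<parallel>\<close> this says that \<open>2\<^sup>j \<tau>(H - h\<^sub>j)\<close> hardly decreases in \<open>j\<close>, so that it stays near \<open>\<parallel>H\<parallel> \<ge> m\<close>. But it
  is an average of values of \<open>\<tau>\<close> on late \<open>f\<^sub>l\<close>, which are small. A sequence of functionals takes the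
  place of a single \<open>\<tau>\<close>, so that no extension of the limit functional to the whole space has to be
  constructed.
\<close>

lemma zero_in_closure_convex_hull:
  fixes f :: "nat \<Rightarrow> 'a::banach"
  assumes bdd: "\<And>l. norm (f l) \<le> C"
    and norming: "\<And>h. \<exists>\<tau> t. (\<forall>i::nat. linear (\<tau> i) \<and> (\<forall>x. \<bar>\<tau> i x\<bar> \<le> norm x)) \<and>
        (\<lambda>i. \<tau> i h) \<longlonglongrightarrow> norm h \<and> (\<forall>l. (\<lambda>i. \<tau> i (f l)) \<longlonglongrightarrow> t l) \<and> t \<longlonglongrightarrow> (0::real)"
  shows "0 \<in> closure (convex hull (range f))"
proof (rule ccontr)
  assume "0 \<notin> closure (convex hull (range f))"
  then obtain m where m: "m > 0" and far: "\<And>x. x \<in> convex hull (range f) \<Longrightarrow> m \<le> norm x"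
    unfolding closure_approachable by (force simp: not_less)
  define D where "D j = convex hull (f ` {j..})" for j
  have DD: "D i \<subseteq> D j" if "j \<le> i" for i j
    unfolding D_def using that by (intro hull_mono) auto
  have cvD: "convex (D j)" for j by (simp add: D_def)
  have fD: "f l \<in> D j" if "j \<le> l" for l j using that by (auto simp: D_def intro!: hull_inc)
  have Dbd: "norm x \<le> C" if "x \<in> D j" for x j
  proof -
    have "D j \<subseteq> cball 0 C" unfolding D_def using bdd by (intro hull_minimal) auto
    then show ?thesis using that by auto
  qed
  \<comment> \<open>One factor \<open>(1/2)^j\<close> cancels the \<open>2^j\<close> of the final telescoping, the other makes the sum converge.\<close>
  define \<epsilon> where "\<epsilon> j = m / 8 * (1/2)^j * (1/2)^j" for j :: nat
  have \<epsilon>: "\<epsilon> j > 0" for j using m by (simp add: \<epsilon>_def)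
  have "\<exists>G. \<forall>j x. G j x \<in> D j \<and> (\<forall>y\<in>D j. norm (x + (1/2)^j *\<^sub>R G j x) \<le> norm (x + (1/2)^j *\<^sub>R y) + \<epsilon> j)"
  proof -
    have "\<exists>g. g \<in> D j \<and> (\<forall>y\<in>D j. norm (x + (1/2)^j *\<^sub>R g) \<le> norm (x + (1/2)^j *\<^sub>R y) + \<epsilon> j)" for j x
      using near_minimiser_exists[of "D j" "\<lambda>y. norm (x + (1/2)^j *\<^sub>R y)" "\<epsilon> j"] fD[of j j] \<epsilon> by auto
    then show ?thesis by metis
  qed
  then obtain G where GD: "\<And>j x. G j x \<in> D j"
    and Gmin: "\<And>j x y. y \<in> D j \<Longrightarrow> norm (x + (1/2)^j *\<^sub>R G j x) \<le> norm (x + (1/2)^j *\<^sub>R y) + \<epsilon> j"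
    by blast
  define h where "h = rec_nat 0 (\<lambda>j x. x + (1/2)^Suc j *\<^sub>R G j x)"
  define g where "g j = G j (h j)" for j
  have h0: "h 0 = 0" and hS: "h (Suc j) = h j + (1/2)^Suc j *\<^sub>R g j" for j
    by (simp_all add: h_def g_def)
  have gD: "g j \<in> D j" for j by (simp add: g_def GD)
  have gbd: "norm (g j) \<le> C" for j using Dbd gD by blast
  \<comment> \<open>\<open>y j\<close> is the rescaled tail \<open>2^j (H - h j)\<close>.\<close>
  define y where "y j = (\<Sum>i. (1/2) ^ Suc i *\<^sub>R g (i + j))" for j
  define H where "H = y 0"
  have hsum: "h j = (\<Sum>i<j. (1/2) ^ Suc i *\<^sub>R g i)" for j
    by (induction j) (auto simp: h0 hS)
  have y_closure: "y j \<in> closure (D j)" for j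
    unfolding y_def using gbd cvD subsetD[OF DD[of j "_ + j"] gD]
    by (intro halving_series(2)[where C = C]) auto
  have H: "H = h j + (1/2)^j *\<^sub>R y j" for j
  proof -
    have "H = (\<Sum>i. (1/2) ^ Suc (i + j) *\<^sub>R g (i + j)) + (\<Sum>i<j. (1/2) ^ Suc i *\<^sub>R g i)"
      unfolding H_def y_def using suminf_split_initial_segment[OF halving_series(1)[of g, OF gbd], of j]
      by simp
    also have "(\<Sum>i. (1/2) ^ Suc (i + j) *\<^sub>R g (i + j)) = (\<Sum>i. (1/2)^j *\<^sub>R (1/2) ^ Suc i *\<^sub>R g (i + j))"
      by (simp add: power_add mult_ac)
    also have "\<dots> = (1/2)^j *\<^sub>R y j"
      unfolding y_def by (rule suminf_scaleR_right[symmetric]) (rule halving_series(1)[OF gbd])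
    finally show ?thesis by (simp add: hsum add.commute)
  qed
  have closure_min: "norm (h j + (1/2)^j *\<^sub>R g j) \<le> norm (h j + (1/2)^j *\<^sub>R z) + \<epsilon> j" if "z \<in> closure (D j)" for j z
  proof -
    have "closed {z. norm (h j + (1/2)^j *\<^sub>R g j) \<le> norm (h j + (1/2)^j *\<^sub>R z) + \<epsilon> j}"
      by (intro closed_Collect_le continuous_intros)
    then show ?thesis using that Gmin[of _ j "h j"]
      closure_minimal[of "D j" "{z. norm (h j + (1/2)^j *\<^sub>R g j) \<le> norm (h j + (1/2)^j *\<^sub>R z) + \<epsilon> j}"]
      by (auto simp: g_def)
  qed
  have step: "norm (2 *\<^sub>R h (Suc j) - h j) \<le> norm H + \<epsilon> j" for j
  proof -
    have "2 *\<^sub>R h (Suc j) - h j = h j + (1/2)^j *\<^sub>R g j"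
      by (simp add: hS algebra_simps flip: scaleR_2)
    then show ?thesis using closure_min[OF y_closure, of j] H[of j] by simp
  qed
  have mH: "m \<le> norm H"
  proof -
    have "closed {x::'a. m \<le> norm x}" by (intro closed_Collect_le continuous_intros)
    moreover have "D 0 \<subseteq> {x. m \<le> norm x}" using far by (auto simp: D_def)
    ultimately show ?thesis using y_closure[of 0] closure_minimal unfolding H_def by blast
  qed
  obtain \<tau> t where lin: "\<And>i. linear (\<tau> i)" and le: "\<And>i x. \<bar>\<tau> i x\<bar> \<le> norm x"
    and \<tau>H: "(\<lambda>i. \<tau> i H) \<longlonglongrightarrow> norm H" and \<tau>f: "\<And>l. (\<lambda>i. \<tau> i (f l)) \<longlonglongrightarrow> t l"
    and t0: "t \<longlonglongrightarrow> (0::real)" using norming[of H] by blast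
  obtain J where J: "\<And>l. l \<ge> J \<Longrightarrow> \<bar>t l\<bar> < m / 8"
    using LIMSEQ_D[OF t0, of "m/8"] m by auto
  have small: "\<forall>\<^sub>F i in sequentially. \<bar>\<tau> i x\<bar> < m / 8" if "x \<in> D J" for x
  proof -
    have cv: "convex {x. \<forall>\<^sub>F i in sequentially. \<bar>\<tau> i x\<bar> < m / 8}"
    proof (rule convexI, clarsimp)
      fix x y and u v :: real
      assume uv: "0 \<le> u" "0 \<le> v" "u + v = 1"
        and xy: "\<forall>\<^sub>F i in sequentially. \<bar>\<tau> i x\<bar> * 8 < m" "\<forall>\<^sub>F i in sequentially. \<bar>\<tau> i y\<bar> * 8 < m"
      from xy show "\<forall>\<^sub>F i in sequentially. \<bar>\<tau> i (u *\<^sub>R x + v *\<^sub>R y)\<bar> * 8 < m"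
      proof eventually_elim
        case (elim i)
        have "\<bar>\<tau> i (u *\<^sub>R x + v *\<^sub>R y)\<bar> = \<bar>u * \<tau> i x + v * \<tau> i y\<bar>"
          using lin[of i] by (simp add: linear_add linear_scale)
        also have "\<dots> \<le> u * \<bar>\<tau> i x\<bar> + v * \<bar>\<tau> i y\<bar>"
          using uv by (intro order.trans[OF abs_triangle_ineq]) (simp add: abs_mult)
        also have "\<dots> < m / 8" using uv elim by (intro convex_bound_lt) auto
        finally show ?case by simp
      qed
    qed
    have "f l \<in> {x. \<forall>\<^sub>F i in sequentially. \<bar>\<tau> i x\<bar> < m / 8}" if "l \<ge> J" for l
      using order_tendstoD(2)[OF tendsto_rabs[OF \<tau>f[of l]] J[OF that]] by simp
    then have "D J \<subseteq> {x. \<forall>\<^sub>F i in sequentially. \<bar>\<tau> i x\<bar> < m / 8}"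
      unfolding D_def using cv by (intro hull_minimal) auto
    then show ?thesis using that by auto
  qed
  obtain z where z: "z \<in> D J" "norm (z - y J) < m / 8"
    using y_closure[of J] m unfolding closure_approachable dist_norm by (meson divide_pos_pos zero_less_numeral)
  \<comment> \<open>The defect \<open>norm H - \<tau> i H\<close> enters the telescoping \<open>J\<close> times, with weights up to \<open>2^(J-1)\<close>.\<close>
  define \<delta> where "\<delta> = m / 8 / 2^J"
  have "\<forall>\<^sub>F i in sequentially. \<tau> i H > norm H - \<delta>"
    using order_tendstoD(1)[OF \<tau>H, of "norm H - \<delta>"] m by (simp add: \<delta>_def)
  with small[OF z(1)] have "\<forall>\<^sub>F i in sequentially. \<bar>\<tau> i z\<bar> < m / 8 \<and> \<tau> i H > norm H - \<delta>"
    by (rule eventually_conj)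
  then obtain i where i: "\<bar>\<tau> i z\<bar> < m / 8" "\<tau> i H > norm H - \<delta>"
    by (auto simp: eventually_sequentially)
  have recur: "2^j * \<tau> i (H - h j) \<ge> \<tau> i H - (\<Sum>k<j. 2^k * (\<epsilon> k + \<delta>))" for j
  proof (induction j)
    case (Suc j)
    have "2 * \<tau> i (h (Suc j)) - \<tau> i (h j) = \<tau> i (2 *\<^sub>R h (Suc j) - h j)"
      using lin[of i] by (simp add: linear_diff linear_scale)
    also have "\<dots> \<le> norm H + \<epsilon> j" using le[of i] step[of j] by (meson abs_le_D1 order.trans)
    also have "\<dots> \<le> \<tau> i H + \<delta> + \<epsilon> j" using i by simp
    finally have "2 * \<tau> i (H - h (Suc j)) \<ge> \<tau> i (H - h j) - (\<epsilon> j + \<delta>)"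
      using lin[of i] by (simp add: linear_diff)
    then have "2^j * (2 * \<tau> i (H - h (Suc j))) \<ge> 2^j * (\<tau> i (H - h j) - (\<epsilon> j + \<delta>))"
      by (intro mult_left_mono) auto
    with Suc show ?case by (simp add: algebra_simps)
  qed (simp add: h0)
  have s1: "(\<Sum>k<J. 2^k * \<epsilon> k) \<le> m / 4"
  proof -
    have "(\<Sum>k<J. 2^k * \<epsilon> k) = m / 8 * (\<Sum>k<J. (1/2)^k)"
      unfolding sum_distrib_left by (rule sum.cong) (auto simp: \<epsilon>_def power_divide)
    also have "(\<Sum>k<J. (1/2::real)^k) \<le> (\<Sum>k. (1/2)^k)"
      by (intro sum_le_suminf summable_geometric) auto
    finally show ?thesis using m by (simp add: suminf_geometric mult_left_mono)
  qed
  have s2: "(\<Sum>k<J. 2^k * \<delta>) \<le> m / 8"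
  proof -
    have "(\<Sum>k<J. 2^k * \<delta>) = (2^J - 1) * \<delta>"
      by (simp add: sum_distrib_right[symmetric] sum_gp_strict)
    also have "\<dots> \<le> 2^J * \<delta>" using m by (intro mult_right_mono) (auto simp: \<delta>_def)
    finally show ?thesis by (simp add: \<delta>_def)
  qed
  have "2^J * \<tau> i (H - h J) = \<tau> i (y J)"
    using H[of J] lin[of i] by (simp add: linear_scale power_divide)
  also have "\<dots> \<le> \<tau> i z + norm (z - y J)"
    using le[of i "z - y J"] lin[of i] by (simp add: linear_diff)
  also have "\<dots> < m / 4" using z i by simp
  finally have "\<tau> i H - (\<Sum>k<J. 2^k * (\<epsilon> k + \<delta>)) < m / 4" using recur[of J] by simp
  moreover have "(\<Sum>k<J. 2^k * (\<epsilon> k + \<delta>)) = (\<Sum>k<J. 2^k * \<epsilon> k) + (\<Sum>k<J. 2^k * \<delta>)"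
    by (simp add: distrib_left sum.distrib)
  moreover have "\<delta> \<le> m / 8" using m by (simp add: \<delta>_def divide_le_eq)
  ultimately show False using s1 s2 i mH m by linarith
qed

section \<open>Stable arrays and averages of their rows\<close>

text \<open>
  By compactness, a bounded real sequence converges as soon as its convergent subsequences share their
  limit. In this way the double limit condition, which speaks about convergent sequences only, yields
  convergence statements.
\<close>

lemma tendsto_if_unique_cluster_point:
  fixes x :: "nat \<Rightarrow> real"
  assumes bd: "\<And>n. \<bar>x n\<bar> \<le> C"
    and uniq: "\<And>r l. strict_mono r \<Longrightarrow> (\<lambda>n. x (r n)) \<longlonglongrightarrow> l \<Longrightarrow> l = L"
  shows "x \<longlonglongrightarrow> L"
proof (rule ccontr)
  assume "\<not> x \<longlonglongrightarrow> L"
  then obtain e where e: "e > 0" and "\<exists>\<^sub>\<infinity> n. e \<le> dist (x n) L"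
    unfolding tendsto_iff frequently_def cofinite_eq_sequentially by (auto simp: not_less not_le)
  then obtain r :: "nat \<Rightarrow> nat" where r: "strict_mono r" "\<And>n. e \<le> dist (x (r n)) L"
    using infinite_enumerate[of "{n. e \<le> dist (x n) L}"] unfolding frequently_cofinite by auto
  have "\<forall>n. x (r n) \<in> cball 0 C" using bd by simp
  then obtain l q where q: "strict_mono q" "(\<lambda>n. x (r (q n))) \<longlonglongrightarrow> l"
    using compact_cball[of "0::real" C, unfolded compact_def, rule_format, of "\<lambda>n. x (r n)"]
    by (auto simp: o_def)
  have "l = L"
    using uniq[of "r \<circ> q" l] strict_mono_o[OF r(1) q(1)] q(2) by (simp add: o_def)
  then have "\<forall>\<^sub>F n in sequentially. dist (x (r (q n))) L < e"
    using q(2) e unfolding tendsto_iff by blast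
  then obtain n where "dist (x (r (q n))) L < e" by (auto simp: eventually_sequentially)
  then show False using r(2)[of "q n"] by simp
qed

text \<open>
  The bounded functions of a row index form the Banach space in which the columns of an array are
  compared. The discrete topology makes every function continuous.
\<close>

instance bcontfun :: (metric_space, banach) banach ..

text \<open>
  Grothendieck's double limit condition. The sequences of rows and columns are arbitrary, so repetitions
  are allowed, and the condition passes to all subsequences.
\<close>

definition stable_array :: "('i \<Rightarrow> 'j \<Rightarrow> real) \<Rightarrow> bool" where
  "stable_array A \<longleftrightarrow> (\<forall>(r :: nat \<Rightarrow> 'i) (s :: nat \<Rightarrow> 'j) c g \<alpha> \<beta>.
     (\<forall>n. (\<lambda>m. A (r n) (s m)) \<longlonglongrightarrow> c n) \<longrightarrow> (\<forall>m. (\<lambda>n. A (r n) (s m)) \<longlonglongrightarrow> g m) \<longrightarrow>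
     c \<longlonglongrightarrow> \<alpha> \<longrightarrow> g \<longlonglongrightarrow> \<beta> \<longrightarrow> \<alpha> = \<beta>)"

lemma stable_arrayD:
  assumes "stable_array A" "\<And>n. (\<lambda>m. A (r n) (s m)) \<longlonglongrightarrow> c n" "\<And>m. (\<lambda>n. A (r n) (s m)) \<longlonglongrightarrow> g m"
    "c \<longlonglongrightarrow> \<alpha>" "g \<longlonglongrightarrow> \<beta>"
  shows "\<alpha> = \<beta>"
  using assms unfolding stable_array_def by blast

lemma stable_array_transpose: "stable_array A \<Longrightarrow> stable_array (\<lambda>j i. A i j)"
  unfolding stable_array_def by metis

text \<open>
  Coefficients of a convex combination of the terms with index in \<open>{k..<N}\<close>. The lower bound \<open>k\<close> lets
  the combinations move forward along a sequence, the upper bound \<open>N\<close> keeps the sums finite.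
\<close>

definition weights :: "nat \<Rightarrow> nat \<Rightarrow> (nat \<Rightarrow> real) \<Rightarrow> bool" where
  "weights k N w \<longleftrightarrow> (\<forall>n. 0 \<le> w n) \<and> (\<forall>n. n < k \<or> N \<le> n \<longrightarrow> w n = 0) \<and> (\<Sum>n<N. w n) = 1"

lemma weights_average_bound:
  assumes "weights k N w" and "\<And>n. k \<le> n \<Longrightarrow> \<bar>x n - a\<bar> \<le> C"
  shows "\<bar>(\<Sum>n<N. w n * x n) - a\<bar> \<le> C"
proof -
  have "(\<Sum>n<N. w n * x n) - a = (\<Sum>n<N. w n * (x n - a))"
    using assms(1) by (simp add: right_diff_distrib sum_subtractf sum_distrib_right[symmetric] weights_def)
  also have "\<bar>\<dots>\<bar> \<le> (\<Sum>n<N. w n * C)"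
  proof (intro order.trans[OF sum_abs] sum_mono)
    fix n
    show "\<bar>w n * (x n - a)\<bar> \<le> w n * C"
      using assms(1) assms(2)[of n] by (cases "n < k") (auto simp: weights_def abs_mult intro: mult_left_mono)
  qed
  also have "\<dots> = C" using assms(1) by (simp add: sum_distrib_right[symmetric] weights_def)
  finally show ?thesis .
qed

lemma weights_average_tendsto:
  assumes "\<And>k. weights k (N k) (w k)" and "x \<longlonglongrightarrow> a"
  shows "(\<lambda>k. \<Sum>n<N k. w k n * x n) \<longlonglongrightarrow> a"
proof (rule LIMSEQ_I)
  fix e :: real assume "e > 0"
  then obtain K where K: "\<And>n. n \<ge> K \<Longrightarrow> \<bar>x n - a\<bar> < e / 2"
    using LIMSEQ_D[OF assms(2), of "e/2"] by auto
  have "\<bar>(\<Sum>n<N k. w k n * x n) - a\<bar> \<le> e / 2" if "k \<ge> K" for k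
    using K that by (intro weights_average_bound[OF assms(1)] less_imp_le) auto
  with \<open>e > 0\<close> show "\<exists>K. \<forall>k\<ge>K. norm ((\<Sum>n<N k. w k n * x n) - a) < e"
    by (intro exI[of _ K]) force
qed

lemma bcontfun_norming_sequence:
  fixes h :: "nat discrete \<Rightarrow>\<^sub>C real"
  obtains \<nu> :: "nat \<Rightarrow> nat" where "(\<lambda>i. \<bar>h (discrete (\<nu> i))\<bar>) \<longlonglongrightarrow> norm h"
proof -
  have "\<exists>n. norm h - 1 / real (Suc i) < \<bar>h (discrete n)\<bar>" for i
  proof (rule ccontr)
    assume "\<not> ?thesis"
    then have "norm h \<le> norm h - 1 / real (Suc i)" by (intro norm_bound) (metis discrete_cases not_less real_norm_def)
    then show False by (simp add: field_simps)
  qed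
  then obtain \<nu> where \<nu>: "\<And>i. norm h - 1 / real (Suc i) < \<bar>h (discrete (\<nu> i))\<bar>" by metis
  have "(\<lambda>i. norm h - 1 / real (Suc i)) \<longlonglongrightarrow> norm h - 0"
    by (intro tendsto_intros LIMSEQ_Suc[OF lim_1_over_n])
  then have lower: "(\<lambda>i. norm h - 1 / real (Suc i)) \<longlonglongrightarrow> norm h" by simp
  have "(\<lambda>i. \<bar>h (discrete (\<nu> i))\<bar>) \<longlonglongrightarrow> norm h"
  proof (rule real_tendsto_sandwich[OF _ _ lower tendsto_const])
    show "\<forall>\<^sub>F i in sequentially. norm h - 1 / real (Suc i) \<le> \<bar>h (discrete (\<nu> i))\<bar>"
      using \<nu> by (intro always_eventually allI less_imp_le)
    show "\<forall>\<^sub>F i in sequentially. \<bar>h (discrete (\<nu> i))\<bar> \<le> norm h"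
      using norm_bounded[of h] by (intro always_eventually allI) simp
  qed
  then show thesis by (rule that)
qed

text \<open>
  Here \<open>f\<^sub>l\<close> is the difference of the \<open>l\<close>th column and the pointwise limit of the columns. A given \<open>h\<close>
  is normed by evaluations at suitable rows. By a diagonal argument the rows can be thinned out until
  all the \<open>f\<^sub>l\<close> converge along them, to \<open>t\<^sub>l\<close> say; the double limit condition, applied to these rows
  and to any convergent subsequence of the columns, forces \<open>t\<^sub>l\<close> to tend to zero.
\<close>

lemma stable_array_rows_weakly_null:
  fixes A :: "nat \<Rightarrow> 'j \<Rightarrow> real" and f :: "nat \<Rightarrow> nat discrete \<Rightarrow>\<^sub>C real"
  assumes st: "stable_array A" and bd: "\<And>n m. \<bar>A n m\<bar> \<le> C"
    and c: "\<And>n. (\<lambda>l. A n (s l)) \<longlonglongrightarrow> c n"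
    and f: "\<And>l n. f l (discrete n) = A n (s l) - c n"
  shows "0 \<in> closure (convex hull (range f))"
proof (rule zero_in_closure_convex_hull)
  have cbd: "\<bar>c n\<bar> \<le> C" for n
    using bd by (intro LIMSEQ_le_const2[OF tendsto_rabs[OF c]]) auto
  show "norm (f l) \<le> 2 * C" for l
  proof (rule norm_bound)
    fix x :: "nat discrete"
    obtain n where "x = discrete n" by (cases x)
    then show "norm (f l x) \<le> 2 * C" using bd[of n "s l"] cbd[of n] by (simp add: f)
  qed
  fix h :: "nat discrete \<Rightarrow>\<^sub>C real"
  obtain \<nu> where \<nu>: "(\<lambda>i. \<bar>h (discrete (\<nu> i))\<bar>) \<longlonglongrightarrow> norm h" by (rule bcontfun_norming_sequence)
  \<comment> \<open>One family indexed by the natural numbers collects everything that has to converge: \<open>h\<close>, \<open>c\<close> and all columns.\<close>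
  define F where "F i x = (case x of 0 \<Rightarrow> h (discrete (\<nu> i)) | Suc 0 \<Rightarrow> c (\<nu> i) | Suc (Suc l) \<Rightarrow> A (\<nu> i) (s l))"
    for i and x :: nat
  have "norm (F i x) \<le> C + norm h" for i x
    using norm_bounded[of h "discrete (\<nu> i)"] cbd[of "\<nu> i"] bd[of "\<nu> i"]
    by (auto simp: F_def intro: add_increasing add_increasing2 order.trans[OF abs_ge_zero bd] split: nat.split)
  then obtain \<kappa> :: "nat \<Rightarrow> nat" where \<kappa>: "strict_mono \<kappa>" "\<And>x. \<exists>l. (\<lambda>i. F (\<kappa> i) x) \<longlonglongrightarrow> l"
    using function_convergent_subsequence[of UNIV F "C + norm h"] by (metis UNIV_I countableI_type)
  obtain \<eta> where \<eta>: "(\<lambda>i. h (discrete (\<nu> (\<kappa> i)))) \<longlonglongrightarrow> \<eta>" using \<kappa>(2)[of 0] by (auto simp: F_def)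
  obtain \<gamma> where \<gamma>: "(\<lambda>i. c (\<nu> (\<kappa> i))) \<longlonglongrightarrow> \<gamma>" using \<kappa>(2)[of 1] by (auto simp: F_def)
  have "\<exists>l'. (\<lambda>i. A (\<nu> (\<kappa> i)) (s l)) \<longlonglongrightarrow> l'" for l using \<kappa>(2)[of "Suc (Suc l)"] by (simp add: F_def)
  then obtain a where a: "\<And>l. (\<lambda>i. A (\<nu> (\<kappa> i)) (s l)) \<longlonglongrightarrow> a l" by metis
  have "\<bar>\<eta>\<bar> = norm h"
    using LIMSEQ_unique[OF tendsto_rabs[OF \<eta>]] LIMSEQ_subseq_LIMSEQ[OF \<nu> \<kappa>(1)] by (simp add: o_def)
  define sg where "sg = (if \<eta> \<ge> 0 then 1 else -1 :: real)"
  have "sg * \<eta> = norm h" using \<open>\<bar>\<eta>\<bar> = norm h\<close> by (auto simp: sg_def)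
  have "a \<longlonglongrightarrow> \<gamma>"
  proof (rule tendsto_if_unique_cluster_point)
    show "\<bar>a n\<bar> \<le> C" for n using bd by (intro LIMSEQ_le_const2[OF tendsto_rabs[OF a]]) auto
    fix \<rho> l assume \<rho>: "strict_mono \<rho>" "(\<lambda>n. a (\<rho> n)) \<longlonglongrightarrow> l"
    have "(\<lambda>m. A (\<nu> (\<kappa> i)) (s (\<rho> m))) \<longlonglongrightarrow> c (\<nu> (\<kappa> i))" for i
      using LIMSEQ_subseq_LIMSEQ[OF c \<rho>(1)] by (simp add: o_def)
    from stable_arrayD[OF st this a \<gamma> \<rho>(2)] show "l = \<gamma>" by simp
  qed
  define \<tau> where "\<tau> i z = sg * apply_bcontfun z (discrete (\<nu> (\<kappa> i)))" for i and z :: "nat discrete \<Rightarrow>\<^sub>C real"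
  show "\<exists>\<tau> t. (\<forall>i::nat. linear (\<tau> i) \<and> (\<forall>x. \<bar>\<tau> i x\<bar> \<le> norm x)) \<and>
      (\<lambda>i. \<tau> i h) \<longlonglongrightarrow> norm h \<and> (\<forall>l. (\<lambda>i. \<tau> i (f l)) \<longlonglongrightarrow> t l) \<and> t \<longlonglongrightarrow> (0::real)"
  proof (intro exI conjI allI)
    show "linear (\<tau> i)" for i by (rule linearI) (auto simp: \<tau>_def algebra_simps)
    show "\<bar>\<tau> i x\<bar> \<le> norm x" for i x
      using norm_bounded[of x "discrete (\<nu> (\<kappa> i))"] by (auto simp: \<tau>_def sg_def)
    show "(\<lambda>i. \<tau> i h) \<longlonglongrightarrow> norm h"
      using tendsto_mult_left[OF \<eta>, of sg] \<open>sg * \<eta> = norm h\<close> by (simp add: \<tau>_def)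
    show "(\<lambda>i. \<tau> i (f l)) \<longlonglongrightarrow> sg * (a l - \<gamma>)" for l
      unfolding \<tau>_def f by (intro tendsto_intros a \<gamma>)
    have "(\<lambda>l. sg * (a l - \<gamma>)) \<longlonglongrightarrow> sg * (\<gamma> - \<gamma>)" by (intro tendsto_intros \<open>a \<longlonglongrightarrow> \<gamma>\<close>)
    then show "(\<lambda>l. sg * (a l - \<gamma>)) \<longlonglongrightarrow> 0" by simp
  qed
qed

lemma continuous_on_discrete_domain: "continuous_on UNIV (h :: 'a discrete \<Rightarrow> 'b::topological_space)"
  by (simp add: continuous_on_open_vimage open_discrete)

text \<open>
  Take a small convex combination \<open>z\<close> of late column differences. Averaging is a contraction for the supremum
  norm, so all the averages \<open>\<Lambda>\<^sub>k z\<close> are small. On the other hand the averages of a single late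
  difference tend, in \<open>k\<close>, to nearly \<open>\<beta> - \<alpha>\<close>; this property is convex and so is inherited by \<open>z\<close>.
\<close>

lemma stable_array_average_rows:
  fixes A :: "nat \<Rightarrow> 'j \<Rightarrow> real" and w :: "'k \<Rightarrow> nat \<Rightarrow> real"
  assumes st: "stable_array A" and bd: "\<And>n m. \<bar>A n m\<bar> \<le> C"
    and w: "\<And>k. weights 0 (N k) (w k)"
  shows "stable_array (\<lambda>k m. \<Sum>n<N k. w k n * A n m)"
  unfolding stable_array_def
proof (intro allI impI)
  fix r :: "nat \<Rightarrow> 'k" and s :: "nat \<Rightarrow> 'j" and b g \<alpha> \<beta>
  assume rows: "\<forall>k. (\<lambda>m. \<Sum>n<N (r k). w (r k) n * A n (s m)) \<longlonglongrightarrow> b k"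
    and cols: "\<forall>m. (\<lambda>k. \<Sum>n<N (r k). w (r k) n * A n (s m)) \<longlonglongrightarrow> g m"
    and b: "b \<longlonglongrightarrow> \<alpha>" and g: "g \<longlonglongrightarrow> \<beta>"
  obtain \<rho> :: "nat \<Rightarrow> nat" where \<rho>: "strict_mono \<rho>" "\<And>n. \<exists>l. (\<lambda>i. A n (s (\<rho> i))) \<longlonglongrightarrow> l"
    using function_convergent_subsequence[of UNIV "\<lambda>i n. A n (s i)" C] bd
    by (metis UNIV_I countableI_type real_norm_def)
  obtain c where c: "\<And>n. (\<lambda>i. A n (s (\<rho> i))) \<longlonglongrightarrow> c n" using \<rho>(2) by metis
  have cbd: "\<bar>c n\<bar> \<le> C" for n
    using bd by (intro LIMSEQ_le_const2[OF tendsto_rabs[OF c]]) auto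
  have beq: "b k = (\<Sum>n<N (r k). w (r k) n * c n)" for k
  proof (rule LIMSEQ_unique)
    show "(\<lambda>i. \<Sum>n<N (r k). w (r k) n * A n (s (\<rho> i))) \<longlonglongrightarrow> b k"
      using LIMSEQ_subseq_LIMSEQ[OF rows[rule_format] \<rho>(1)] by (simp add: o_def)
  qed (intro tendsto_intros c)
  define \<Lambda> where "\<Lambda> k z = (\<Sum>n<N (r k). w (r k) n * apply_bcontfun z (discrete n))" for k and z :: "nat discrete \<Rightarrow>\<^sub>C real"
  have \<Lambda>_le: "\<bar>\<Lambda> k z\<bar> \<le> norm z" for k z
    using weights_average_bound[OF w, of "\<lambda>n. apply_bcontfun z (discrete n)" 0 "norm z" "r k"] norm_bounded[of z] by (simp add: \<Lambda>_def)
  have \<Lambda>_lin: "\<Lambda> k (u *\<^sub>R x + v *\<^sub>R y) = u * \<Lambda> k x + v * \<Lambda> k y" for k u v x y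
    by (simp add: \<Lambda>_def distrib_left sum.distrib sum_distrib_left mult_ac)
  have "\<bar>\<beta> - \<alpha>\<bar> \<le> 3 * \<epsilon>" if "\<epsilon> > 0" for \<epsilon>
  proof -
    have "(\<lambda>l. g (\<rho> l)) \<longlonglongrightarrow> \<beta>" using LIMSEQ_subseq_LIMSEQ[OF g \<rho>(1)] by (simp add: o_def)
    then obtain L where L: "\<And>l. l \<ge> L \<Longrightarrow> \<bar>g (\<rho> l) - \<beta>\<bar> < \<epsilon>" using LIMSEQ_D[of "\<lambda>l. g (\<rho> l)" \<beta> \<epsilon>] \<open>\<epsilon> > 0\<close> unfolding real_norm_def by blast
    define f where "f l = Bcontfun (\<lambda>x. A (of_discrete x) (s (\<rho> (l + L))) - c (of_discrete x))" for l
    have f: "f l (discrete n) = A n (s (\<rho> (l + L))) - c n" for l n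
    proof -
      have "bounded (range (\<lambda>x. A (of_discrete x) (s (\<rho> (l + L))) - c (of_discrete x)))"
        using bd cbd by (intro boundedI[of _ "2 * C"]) (auto intro: order.trans[OF abs_triangle_ineq4 add_mono[of _ C _ C, simplified]])
      then show ?thesis unfolding f_def by (subst Bcontfun_inverse) (auto simp: bcontfun_def discrete_inverse intro: continuous_on_discrete_domain)
    qed
    have "0 \<in> closure (convex hull (range f))"
      using LIMSEQ_ignore_initial_segment[OF c, of _ L]
      by (intro stable_array_rows_weakly_null[OF st bd _ f])
    then obtain z where z: "z \<in> convex hull (range f)" "norm z < \<epsilon>"
      using \<open>\<epsilon> > 0\<close> unfolding closure_approachable dist_norm diff_zero by blast
    have "convex {z. \<forall>\<^sub>F k in sequentially. \<bar>\<Lambda> k z - (\<beta> - \<alpha>)\<bar> < 2 * \<epsilon>}"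
    proof (rule convexI, clarsimp)
      fix x y and u v :: real
      assume uv: "0 \<le> u" "0 \<le> v" "u + v = 1"
        and xy: "\<forall>\<^sub>F k in sequentially. \<bar>\<Lambda> k x - (\<beta> - \<alpha>)\<bar> < 2 * \<epsilon>"
          "\<forall>\<^sub>F k in sequentially. \<bar>\<Lambda> k y - (\<beta> - \<alpha>)\<bar> < 2 * \<epsilon>"
      from xy show "\<forall>\<^sub>F k in sequentially. \<bar>\<Lambda> k (u *\<^sub>R x + v *\<^sub>R y) - (\<beta> - \<alpha>)\<bar> < 2 * \<epsilon>"
      proof eventually_elim
        case (elim k)
        have "\<Lambda> k (u *\<^sub>R x + v *\<^sub>R y) - (\<beta> - \<alpha>) = u * (\<Lambda> k x - (\<beta> - \<alpha>)) + v * (\<Lambda> k y - (\<beta> - \<alpha>))"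
          unfolding \<Lambda>_lin using uv(3) by algebra
        also have "\<bar>\<dots>\<bar> \<le> u * \<bar>\<Lambda> k x - (\<beta> - \<alpha>)\<bar> + v * \<bar>\<Lambda> k y - (\<beta> - \<alpha>)\<bar>"
          using uv by (intro order.trans[OF abs_triangle_ineq]) (simp add: abs_mult)
        also have "\<dots> < 2 * \<epsilon>" using uv elim by (intro convex_bound_lt) auto
        finally show ?case .
      qed
    qed
    moreover have "f l \<in> {z. \<forall>\<^sub>F k in sequentially. \<bar>\<Lambda> k z - (\<beta> - \<alpha>)\<bar> < 2 * \<epsilon>}" for l
    proof -
      have "\<Lambda> k (f l) = (\<Sum>n<N (r k). w (r k) n * A n (s (\<rho> (l + L)))) - b k" for k
        by (simp add: \<Lambda>_def f beq right_diff_distrib sum_subtractf)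
      then have "(\<lambda>k. \<Lambda> k (f l) - (\<beta> - \<alpha>)) \<longlonglongrightarrow> g (\<rho> (l + L)) - \<alpha> - (\<beta> - \<alpha>)"
        using cols b by (intro tendsto_diff tendsto_const) (auto intro!: tendsto_diff)
      then have "(\<lambda>k. \<bar>\<Lambda> k (f l) - (\<beta> - \<alpha>)\<bar>) \<longlonglongrightarrow> \<bar>g (\<rho> (l + L)) - \<beta>\<bar>"
        by (auto dest: tendsto_rabs)
      moreover have "\<bar>g (\<rho> (l + L)) - \<beta>\<bar> < 2 * \<epsilon>" using L[of "l + L"] that by simp
      ultimately show ?thesis using order_tendstoD(2) by fastforce
    qed
    ultimately have "convex hull (range f) \<subseteq> {z. \<forall>\<^sub>F k in sequentially. \<bar>\<Lambda> k z - (\<beta> - \<alpha>)\<bar> < 2 * \<epsilon>}"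
      by (intro hull_minimal) auto
    then have "\<forall>\<^sub>F k in sequentially. \<bar>\<Lambda> k z - (\<beta> - \<alpha>)\<bar> < 2 * \<epsilon>" using z by blast
    then obtain k where "\<bar>\<Lambda> k z - (\<beta> - \<alpha>)\<bar> < 2 * \<epsilon>" by (auto simp: eventually_sequentially)
    then show ?thesis using \<Lambda>_le[of k z] z(2) by linarith
  qed
  from this[of "\<bar>\<beta> - \<alpha>\<bar> / 6"] show "\<alpha> = \<beta>" by fastforce
qed

section \<open>Forward averages that converge almost everywhere\<close>

text \<open>
  A Komlos-type lemma with an elementary Hilbert space proof. The infima of the \<open>L\<^sup>2\<close>-norms of the averages
  over \<open>{k..}\<close> increase with \<open>k\<close> to a finite limit, and the midpoint of two such averages is again one,
  so the parallelogram identity makes near-minimisers a Cauchy sequence in \<open>L\<^sup>2\<close>, hence in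
  \<open>L\<^sup>1\<close>. Some subsequence converges almost everywhere, and a subsequence of forward averages consists of
  forward averages.
\<close>

lemma forward_averages_AE_convergent:
  fixes f :: "nat \<Rightarrow> 'a \<Rightarrow> real"
  assumes "prob_space P" and meas[measurable]: "\<And>n. f n \<in> borel_measurable P"
    and bd: "\<And>n x. x \<in> space P \<Longrightarrow> \<bar>f n x\<bar> \<le> C"
  shows "\<exists>N w. (\<forall>k. weights k (N k) (w k)) \<and>
    (AE x in P. convergent (\<lambda>k. \<Sum>n<N k. w k n * f n x))"
proof -
  interpret prob_space P by fact
  define avg where "avg p x = (\<Sum>n<fst p. snd p n * f n x)" for p :: "nat \<times> (nat \<Rightarrow> real)" and x
  define W where "W k = {p. weights k (fst p) (snd p)}" for k
  define Q where "Q p = (\<integral>x. (avg p x)\<^sup>2 \<partial>P)" for p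
  have avg_meas[measurable]: "avg p \<in> borel_measurable P" for p unfolding avg_def by measurable
  have avg_bd: "\<bar>avg p x\<bar> \<le> C" if "p \<in> W k" "x \<in> space P" for p k x
    using weights_average_bound[of k "fst p" "snd p" "\<lambda>n. f n x" 0 C] bd that by (simp add: W_def avg_def)
  have sq_bd: "(avg p x)\<^sup>2 \<le> C\<^sup>2" if "p \<in> W k" "x \<in> space P" for p k x
    using avg_bd[OF that] by (metis abs_le_square_iff abs_of_nonneg abs_ge_zero order.trans)
  have int_sq: "integrable P (\<lambda>x. (avg p x)\<^sup>2)" if "p \<in> W k" for p k
    using sq_bd[OF that] by (intro integrable_const_bound[where B = "C\<^sup>2"]) auto
  have Q_bd: "0 \<le> Q p" "Q p \<le> C\<^sup>2" if "p \<in> W k" for p k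
    using sq_bd[OF that] int_sq[OF that] prob_space
    by (auto simp: Q_def intro!: integral_le_const)
  have W_mono: "W l \<subseteq> W k" if "k \<le> l" for k l using that by (auto simp: W_def weights_def)
  have W_ne: "(Suc k, \<lambda>n. if n = k then 1 else 0) \<in> W k" for k
    by (auto simp: W_def weights_def)
  define d where "d k = (INF p\<in>W k. Q p)" for k
  have bdd: "bdd_below (Q ` W k)" for k using Q_bd by (intro bdd_belowI[of _ 0]) auto
  have d_le: "d k \<le> Q p" if "p \<in> W k" for k p
    unfolding d_def using that by (intro cINF_lower bdd)
  have "\<exists>p\<in>W k. \<forall>q\<in>W k. Q p \<le> Q q + 1 / real (Suc k)" for k
    using W_ne[of k] Q_bd(1) by (intro near_minimiser_exists) (blast, blast, simp)
  then have "\<exists>p. \<forall>k. p k \<in> W k \<and> (\<forall>q\<in>W k. Q (p k) \<le> Q q + 1 / real (Suc k))"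
    unfolding Bex_def by (rule choice[OF allI])
  then obtain p where pW: "\<And>k. p k \<in> W k" and pmin: "\<And>k q. q \<in> W k \<Longrightarrow> Q (p k) \<le> Q q + 1 / real (Suc k)"
    by blast
  have "incseq d"
    unfolding d_def incseq_def using W_mono W_ne by (intro allI impI cINF_superset_mono bdd) blast+
  moreover have "\<forall>k. d k \<le> C\<^sup>2" using order.trans[OF d_le[OF pW] Q_bd(2)[OF pW]] by blast
  ultimately obtain D where D: "d \<longlonglongrightarrow> D" by (rule incseq_convergent)
  have QD: "(\<lambda>k. Q (p k)) \<longlonglongrightarrow> D"
  proof (rule real_tendsto_sandwich[OF _ _ D])
    have "(\<lambda>k. d k + 1 / real (Suc k)) \<longlonglongrightarrow> D + 0"
      by (intro tendsto_intros D LIMSEQ_Suc[OF lim_1_over_n])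
    then show "(\<lambda>k. d k + 1 / real (Suc k)) \<longlonglongrightarrow> D" by simp
    have "Q (p k) - 1 / real (Suc k) \<le> d k" for k
      unfolding d_def using pmin[of _ k] W_ne[of k] by (intro cINF_greatest) (auto simp: algebra_simps)
    then show "\<forall>\<^sub>F k in sequentially. Q (p k) \<le> d k + 1 / real (Suc k)"
      by (intro always_eventually allI) (simp add: algebra_simps)
  qed (use d_le[OF pW] in auto)
  define g where "g k = avg (p k)" for k
  have g_int: "integrable P (g k)" for k
    unfolding g_def using avg_bd[OF pW[of k]] by (intro integrable_const_bound[where B = C]) auto
  have dist_int: "integrable P (\<lambda>x. (g k x - g l x)\<^sup>2)"
    and dist_le: "(\<integral>x. (g k x - g l x)\<^sup>2 \<partial>P) \<le> 2 * Q (p l) - 2 * Q (p k) + 4 / real (Suc k)" if "k \<le> l" for k l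
  proof -
    define q where "q = (max (fst (p k)) (fst (p l)), \<lambda>n. (snd (p k) n + snd (p l) n) / 2)"
    have ext: "(\<Sum>n<max (fst (p i)) m. snd (p i) n * h n) = (\<Sum>n<fst (p i). snd (p i) n * h n)" for i m h
      using pW[of i] by (intro sum.mono_neutral_right) (auto simp: W_def weights_def)
    have plW: "p l \<in> W k" using pW W_mono[OF that] by blast
    have "avg q x = (\<Sum>n<max (fst (p k)) (fst (p l)). snd (p k) n * f n x) / 2 +
        (\<Sum>n<max (fst (p l)) (fst (p k)). snd (p l) n * f n x) / 2" for x
      unfolding avg_def q_def by (simp add: sum.distrib[symmetric] sum_divide_distrib max.commute field_simps)
    then have avg_q: "avg q x = (g k x + g l x) / 2" for x
      unfolding ext by (simp add: g_def avg_def add_divide_distrib)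
    have qW: "q \<in> W k"
    proof -
      have "(\<Sum>n<max (fst (p k)) (fst (p l)). snd (p k) n) = 1"
        using ext[of k "\<lambda>_. 1" "fst (p l)"] pW[of k] by (simp add: W_def weights_def)
      moreover have "(\<Sum>n<max (fst (p k)) (fst (p l)). snd (p l) n) = 1"
        using ext[of l "\<lambda>_. 1" "fst (p k)"] plW by (simp add: W_def weights_def max.commute)
      ultimately show ?thesis using pW[of k] plW
        by (auto simp: W_def weights_def q_def sum.distrib sum_divide_distrib[symmetric])
    qed
    have eq: "(g k x - g l x)\<^sup>2 = 2 * (avg (p k) x)\<^sup>2 + 2 * (avg (p l) x)\<^sup>2 - 4 * (avg q x)\<^sup>2" for x
      unfolding avg_q g_def by (simp add: power2_eq_square field_simps)
    note ints = int_sq[OF pW[of k]] int_sq[OF plW] int_sq[OF qW]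
    show "integrable P (\<lambda>x. (g k x - g l x)\<^sup>2)" unfolding eq using ints by simp
    have "(\<integral>x. (g k x - g l x)\<^sup>2 \<partial>P) = 2 * Q (p k) + 2 * Q (p l) - 4 * Q q"
      unfolding eq Q_def using ints by simp
    then show "(\<integral>x. (g k x - g l x)\<^sup>2 \<partial>P) \<le> 2 * Q (p l) - 2 * Q (p k) + 4 / real (Suc k)"
      using pmin[OF qW] by simp
  qed
  \<comment> \<open>Comparison of the \<open>L\<^sup>1\<close>- and \<open>L\<^sup>2\<close>-norms on a probability space, in a form that only uses \<open>0 \<le> (\<bar>y\<bar> - \<delta>)\<^sup>2\<close>.\<close>
  have scalar: "norm y \<le> \<delta> / 2 + y\<^sup>2 / (2 * \<delta>)" if "\<delta> > 0" for y \<delta> :: real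
  proof -
    have "0 \<le> (\<bar>y\<bar> - \<delta>)\<^sup>2" by simp
    then have "2 * \<delta> * \<bar>y\<bar> \<le> \<delta>\<^sup>2 + y\<^sup>2" by (simp add: power2_diff mult_ac)
    then show ?thesis using that by (simp add: field_simps power2_eq_square)
  qed
  have L1: "(\<integral>x. norm (g k x - g l x) \<partial>P) \<le> \<delta> / 2 + (\<integral>x. (g k x - g l x)\<^sup>2 \<partial>P) / (2 * \<delta>)"
    if "\<delta> > 0" "k \<le> l" for \<delta> k l
  proof -
    have "(\<integral>x. norm (g k x - g l x) \<partial>P) \<le> (\<integral>x. \<delta> / 2 + (g k x - g l x)\<^sup>2 / (2 * \<delta>) \<partial>P)"
    proof (intro integral_mono)
      show "integrable P (\<lambda>x. norm (g k x - g l x))" using g_int by simp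
      show "integrable P (\<lambda>x. \<delta> / 2 + (g k x - g l x)\<^sup>2 / (2 * \<delta>))"
        by (intro Bochner_Integration.integrable_add integrable_const integrable_divide dist_int that)
      show "norm (g k x - g l x) \<le> \<delta> / 2 + (g k x - g l x)\<^sup>2 / (2 * \<delta>)" for x
        using that(1) by (rule scalar)
    qed
    also have "\<dots> = \<delta> / 2 + (\<integral>x. (g k x - g l x)\<^sup>2 \<partial>P) / (2 * \<delta>)"
      using prob_space
      by (subst Bochner_Integration.integral_add)
         (use dist_int[OF that(2)] in \<open>auto intro!: integrable_divide simp del: power2_diff\<close>)
    finally show ?thesis .
  qed
  have cauchy: "\<exists>K. \<forall>k\<ge>K. \<forall>l\<ge>K. (\<integral>x. norm (g k x - g l x) \<partial>P) < e" if "e > 0" for e :: real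
  proof -
    define \<eta> :: real where "\<eta> = e\<^sup>2 / 10"
    have \<eta>: "\<eta> > 0" using that by (simp add: \<eta>_def)
    obtain K1 where K1: "\<And>k. k \<ge> K1 \<Longrightarrow> \<bar>Q (p k) - D\<bar> < \<eta>"
      using LIMSEQ_D[OF QD \<eta>] by auto
    obtain K2 where K2: "\<And>k. k \<ge> K2 \<Longrightarrow> 1 / real (Suc k) < \<eta>"
      using order_tendstoD(2)[OF LIMSEQ_Suc[OF lim_1_over_n] \<eta>] by (auto simp: eventually_sequentially)
    have *: "(\<integral>x. norm (g k x - g l x) \<partial>P) < e" if kl: "k \<ge> max K1 K2" "k \<le> l" for k l
    proof -
      have "(\<integral>x. (g k x - g l x)\<^sup>2 \<partial>P) < 8 * \<eta>"
        using dist_le[OF kl(2)] K1[of k] K1[of l] K2[of k] kl by (simp add: abs_if split: if_splits)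
      moreover have "J / (2 * e) < e / 2" if "J < 8 * \<eta>" for J
      proof -
        have "J < e * e"
          using that mult_pos_pos[OF \<open>e > 0\<close> \<open>e > 0\<close>] by (simp add: \<eta>_def power2_eq_square)
        then show ?thesis using \<open>e > 0\<close> by (simp add: field_simps)
      qed
      ultimately have "(\<integral>x. (g k x - g l x)\<^sup>2 \<partial>P) / (2 * e) < e / 2" by blast
      then show ?thesis using L1[OF \<open>e > 0\<close> kl(2)] by simp
    qed
    show ?thesis
    proof (intro exI[of _ "max K1 K2"] allI impI)
      fix k l assume "max K1 K2 \<le> k" "max K1 K2 \<le> l"
      then show "(\<integral>x. norm (g k x - g l x) \<partial>P) < e"
        using *[of k l] *[of l k] by (cases "k \<le> l") (auto simp: abs_minus_commute)
    qed
  qed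
  obtain r :: "nat \<Rightarrow> nat" where r: "strict_mono r" "AE x in P. Cauchy (\<lambda>i. g (r i) x)"
    using cauchy_L1_AE_cauchy_subseq[OF g_int cauchy] by blast
  have "p (r k) \<in> W k" for k using pW[of "r k"] W_mono[OF seq_suble[OF r(1)]] by blast
  then show ?thesis using r(2)
    by (intro exI[of _ "\<lambda>k. fst (p (r k))"] exI[of _ "\<lambda>k. snd (p (r k))"])
       (simp add: W_def g_def avg_def Cauchy_convergent_iff)
qed

text \<open>
  Countably many sequences are handled with the same weights by viewing them as one sequence of functions
  on the product with a probability measure that charges every natural number.
\<close>

lemma forward_averages_AE_convergent_countable:
  fixes f :: "nat \<Rightarrow> nat \<Rightarrow> 'a \<Rightarrow> real"
  assumes "prob_space P" and meas[measurable]: "\<And>n i. f n i \<in> borel_measurable P"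
    and bd: "\<And>n i x. x \<in> space P \<Longrightarrow> \<bar>f n i x\<bar> \<le> C"
  shows "\<exists>N w. (\<forall>k. weights k (N k) (w k)) \<and>
    (AE x in P. \<forall>i. convergent (\<lambda>k. \<Sum>n<N k. w k n * f n i x))"
proof -
  interpret prob_space P by fact
  define \<nu> where "\<nu> = measure_pmf (geometric_pmf (1/2))"
  interpret \<nu>: prob_space \<nu> unfolding \<nu>_def by unfold_locales
  interpret pair_prob_space P \<nu> ..
  define h where "h n z = f n (snd z) (fst z)" for n and z :: "'a \<times> nat"
  have hm: "h n \<in> borel_measurable (P \<Otimes>\<^sub>M \<nu>)" for n
  proof -
    have "h n \<in> borel_measurable (P \<Otimes>\<^sub>M count_space UNIV)"
      unfolding h_def by (rule measurable_compose_countable) auto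
    then show ?thesis
      by (subst measurable_cong_sets[of _ "P \<Otimes>\<^sub>M count_space UNIV" borel borel])
         (auto simp: \<nu>_def intro!: sets_pair_measure_cong)
  qed
  have hb: "\<bar>h n z\<bar> \<le> C" if "z \<in> space (P \<Otimes>\<^sub>M \<nu>)" for n z
    using that bd by (auto simp: h_def space_pair_measure)
  obtain N w where w: "\<forall>k. weights k (N k) (w k)"
    and conv: "AE z in P \<Otimes>\<^sub>M \<nu>. convergent (\<lambda>k. \<Sum>n<N k. w k n * h n z)"
    using forward_averages_AE_convergent[where f = h, OF P.prob_space_axioms hm hb] by blast
  have AE_\<nu>: "(AE i in \<nu>. R i) \<longleftrightarrow> (\<forall>i. R i)" for R
    unfolding \<nu>_def by (simp add: AE_measure_pmf_iff set_pmf_geometric)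
  from conv have "AE x in P. AE i in \<nu>. convergent (\<lambda>k. \<Sum>n<N k. w k n * h n (x, i))"
    by (intro AE_pair) 
  then have "AE x in P. \<forall>i. convergent (\<lambda>k. \<Sum>n<N k. w k n * f n i x)"
    by (simp only: AE_\<nu> h_def fst_conv snd_conv)
  then show ?thesis using w by blast
qed

section \<open>Integrals of stable arrays\<close>

text \<open>
  Rows and columns are thinned out by the same subsequence, so that one sequence of indices serves both
  limits.
\<close>

lemma stable_array_convergent_limits_agree:
  fixes A :: "nat \<Rightarrow> nat \<Rightarrow> real"
  assumes st: "stable_array A" and bd: "\<And>n m. \<bar>A n m\<bar> \<le> C"
    and c: "\<And>n. (\<lambda>m. A n m) \<longlonglongrightarrow> c n" and g: "\<And>m. (\<lambda>n. A n m) \<longlonglongrightarrow> g m"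
  shows "(\<lambda>n. c n - g n) \<longlonglongrightarrow> 0"
proof (rule tendsto_if_unique_cluster_point[where C = "2 * C"])
  have cbd: "\<bar>c n\<bar> \<le> C" and gbd: "\<bar>g n\<bar> \<le> C" for n
    using bd by (intro LIMSEQ_le_const2[OF tendsto_rabs[OF c]] LIMSEQ_le_const2[OF tendsto_rabs[OF g]]; auto)+
  show "\<bar>c n - g n\<bar> \<le> 2 * C" for n using cbd[of n] gbd[of n] by (auto simp: abs_le_iff)
  fix r l assume r: "strict_mono r" and l: "(\<lambda>n. c (r n) - g (r n)) \<longlonglongrightarrow> l"
  obtain \<gamma> q where q: "strict_mono q" "(\<lambda>n. c (r (q n))) \<longlonglongrightarrow> \<gamma>"
    using compact_cball[of "0::real" C, unfolded compact_def, rule_format, of "\<lambda>n. c (r n)"] cbd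
    by (auto simp: o_def)
  have l': "(\<lambda>n. c (r (q n)) - g (r (q n))) \<longlonglongrightarrow> l"
    using LIMSEQ_subseq_LIMSEQ[OF l q(1)] by (simp add: o_def)
  have "(\<lambda>n. c (r (q n)) - (c (r (q n)) - g (r (q n)))) \<longlonglongrightarrow> \<gamma> - l"
    by (rule tendsto_diff[OF q(2) l'])
  then have g': "(\<lambda>n. g (r (q n))) \<longlonglongrightarrow> \<gamma> - l" by simp
  have rq: "strict_mono (\<lambda>n. r (q n))" using strict_mono_o[OF r q(1)] by (simp add: o_def)
  have "\<gamma> = \<gamma> - l"
  proof (rule stable_arrayD[OF st _ _ q(2) g'])
    show "(\<lambda>m. A (r (q n)) (r (q m))) \<longlonglongrightarrow> c (r (q n))" for n
      using LIMSEQ_subseq_LIMSEQ[OF c rq] by (simp add: o_def)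
    show "(\<lambda>n. A (r (q n)) (r (q m))) \<longlonglongrightarrow> g (r (q m))" for m
      using LIMSEQ_subseq_LIMSEQ[OF g rq] by (simp add: o_def)
  qed
  then show "l = 0" by linarith
qed

text \<open>
  \<open>G\<close> averages the rows and \<open>H\<close> in addition the columns of \<open>F\<close>. Forward averages of a convergent
  sequence have the same limit, so the integrals of the row limits of \<open>H\<close> still tend to \<open>\<alpha>\<close> and those of
  the column limits to \<open>\<beta>\<close>, while the difference of the two limit functions tends to zero almost everywhere.
\<close>

lemma integral_of_stable_arrays:
  fixes F :: "nat \<Rightarrow> nat \<Rightarrow> 'a \<Rightarrow> real"
  assumes "prob_space P" and meas[measurable]: "\<And>n m. F n m \<in> borel_measurable P"
    and bd: "\<And>n m x. x \<in> space P \<Longrightarrow> \<bar>F n m x\<bar> \<le> C"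
    and st: "AE x in P. stable_array (\<lambda>n m. F n m x)"
    and c: "\<And>n. (\<lambda>m. \<integral>x. F n m x \<partial>P) \<longlonglongrightarrow> c n" and g: "\<And>m. (\<lambda>n. \<integral>x. F n m x \<partial>P) \<longlonglongrightarrow> g m"
    and \<alpha>: "c \<longlonglongrightarrow> \<alpha>" and \<beta>: "g \<longlonglongrightarrow> \<beta>"
  shows "\<alpha> = \<beta>"
proof -
  interpret prob_space P by fact
  have "\<exists>N w. (\<forall>k. weights k (N k) (w k)) \<and> (AE x in P. \<forall>m. convergent (\<lambda>k. \<Sum>n<N k. w k n * F n m x))"
    by (rule forward_averages_AE_convergent_countable[where f = F, OF \<open>prob_space P\<close> meas bd])
  then obtain N w where w: "weights k (N k) (w k)"
    and convF: "AE x in P. \<forall>m. convergent (\<lambda>k. \<Sum>n<N k. w k n * F n m x)" for k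
    by blast
  define G where "G k m x = (\<Sum>n<N k. w k n * F n m x)" for k m x
  have [measurable]: "G k m \<in> borel_measurable P" for k m unfolding G_def by measurable
  have G_bd: "\<bar>G k m x\<bar> \<le> C" if "x \<in> space P" for k m x
    using weights_average_bound[OF w, of k "\<lambda>n. F n m x" 0 C] bd that by (simp add: G_def)
  have "\<exists>N w. (\<forall>l. weights l (N l) (w l)) \<and> (AE x in P. \<forall>k. convergent (\<lambda>l. \<Sum>m<N l. w l m * G k m x))"
    by (rule forward_averages_AE_convergent_countable[where f = "\<lambda>m k. G k m" and C = C])
       (use \<open>prob_space P\<close> G_bd in auto)
  then obtain N' w' where w': "weights l (N' l) (w' l)"
    and convG: "AE x in P. \<forall>k. convergent (\<lambda>l. \<Sum>m<N' l. w' l m * G k m x)" for l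
    by blast
  define H where "H k l x = (\<Sum>m<N' l. w' l m * G k m x)" for k l x
  have Hm[measurable]: "H k l \<in> borel_measurable P" for k l unfolding H_def by measurable
  have H_bd: "\<bar>H k l x\<bar> \<le> C" if "x \<in> space P" for k l x
    using weights_average_bound[OF w', of l "\<lambda>m. G k m x" 0 C] G_bd that by (simp add: H_def)
  have w0: "weights 0 (N k) (w k)" "weights 0 (N' k) (w' k)" for k
    using w[of k] w'[of k] by (auto simp: weights_def)
  define Rw where "Rw k x = lim (\<lambda>l. H k l x)" for k x
  define Cl where "Cl l x = lim (\<lambda>k. H k l x)" for l x
  have [measurable]: "Rw k \<in> borel_measurable P" "Cl k \<in> borel_measurable P" for k
    unfolding Rw_def Cl_def by measurable
  have AE_H: "AE x in P. (\<forall>k. (\<lambda>l. H k l x) \<longlonglongrightarrow> Rw k x) \<and> (\<forall>l. (\<lambda>k. H k l x) \<longlonglongrightarrow> Cl l x) \<and>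
      (\<lambda>k. Rw k x - Cl k x) \<longlonglongrightarrow> 0"
    using convF convG st AE_space
  proof eventually_elim
    case (elim x)
    have rows: "(\<lambda>l. H k l x) \<longlonglongrightarrow> Rw k x" for k
      using elim(2) by (simp add: Rw_def H_def convergent_LIMSEQ_iff)
    have cols: "(\<lambda>k. H k l x) \<longlonglongrightarrow> Cl l x" for l
    proof -
      have "convergent (\<lambda>k. H k l x)" unfolding H_def
        by (rule convergent_sum) (use elim(1) in \<open>auto simp: G_def intro: convergent_mult convergent_const\<close>)
      then show ?thesis by (simp add: Cl_def convergent_LIMSEQ_iff)
    qed
    have "stable_array (\<lambda>k m. G k m x)"
      unfolding G_def by (rule stable_array_average_rows[OF elim(3) bd[OF elim(4)] w0(1)])
    then have "stable_array (\<lambda>m k. G k m x)" by (rule stable_array_transpose)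
    from stable_array_average_rows[OF this G_bd[OF elim(4)] w0(2)]
    have "stable_array (\<lambda>l k. H k l x)" by (simp only: H_def)
    from stable_array_convergent_limits_agree[OF stable_array_transpose[OF this] H_bd[OF elim(4)] rows cols]
    show ?case using rows cols by blast
  qed
  define b where "b k l = (\<integral>x. H k l x \<partial>P)" for k l
  have int_F: "integrable P (F n m)" for n m
    using bd by (intro integrable_const_bound[where B = C]) auto
  have int_G: "integrable P (G n m)" for n m
    using G_bd by (intro integrable_const_bound[where B = C]) auto
  have b: "b k l = (\<Sum>m<N' l. w' l m * (\<Sum>n<N k. w k n * (\<integral>x. F n m x \<partial>P)))" for k l
    using int_F int_G unfolding b_def H_def by (simp add: G_def)
  have row_int: "(\<integral>x. Rw k x \<partial>P) = (\<Sum>n<N k. w k n * c n)" for k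
  proof (rule LIMSEQ_unique)
    show "(\<lambda>l. b k l) \<longlonglongrightarrow> (\<integral>x. Rw k x \<partial>P)" unfolding b_def
      by (rule integral_dominated_convergence[where w = "\<lambda>_. C"]) (use AE_H H_bd in auto)
    have "(\<lambda>m. \<Sum>n<N k. w k n * (\<integral>x. F n m x \<partial>P)) \<longlonglongrightarrow> (\<Sum>n<N k. w k n * c n)"
      by (intro tendsto_intros c)
    then show "(\<lambda>l. b k l) \<longlonglongrightarrow> (\<Sum>n<N k. w k n * c n)"
      unfolding b by (rule weights_average_tendsto[OF w'])
  qed
  have col_int: "(\<integral>x. Cl l x \<partial>P) = (\<Sum>m<N' l. w' l m * g m)" for l
  proof (rule LIMSEQ_unique)
    show "(\<lambda>k. b k l) \<longlonglongrightarrow> (\<integral>x. Cl l x \<partial>P)" unfolding b_def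
      by (rule integral_dominated_convergence[where w = "\<lambda>_. C"]) (use AE_H H_bd in auto)
    have "(\<lambda>k. \<Sum>n<N k. w k n * (\<integral>x. F n m x \<partial>P)) \<longlonglongrightarrow> g m" for m
      by (rule weights_average_tendsto[OF w g])
    then show "(\<lambda>k. b k l) \<longlonglongrightarrow> (\<Sum>m<N' l. w' l m * g m)"
      unfolding b by (intro tendsto_intros)
  qed
  have lim_bd: "AE x in P. \<bar>Rw k x\<bar> \<le> C" "AE x in P. \<bar>Cl k x\<bar> \<le> C" for k
  proof -
    show "AE x in P. \<bar>Rw k x\<bar> \<le> C" using AE_H AE_space
    proof eventually_elim
      case (elim x)
      then have "(\<lambda>l. \<bar>H k l x\<bar>) \<longlonglongrightarrow> \<bar>Rw k x\<bar>" by (intro tendsto_rabs) blast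
      then show ?case by (rule LIMSEQ_le_const2) (use H_bd[OF elim(2)] in auto)
    qed
    show "AE x in P. \<bar>Cl k x\<bar> \<le> C" using AE_H AE_space
    proof eventually_elim
      case (elim x)
      then have "(\<lambda>l. \<bar>H l k x\<bar>) \<longlonglongrightarrow> \<bar>Cl k x\<bar>" by (intro tendsto_rabs) blast
      then show ?case by (rule LIMSEQ_le_const2) (use H_bd[OF elim(2)] in auto)
    qed
  qed
  have int_row: "integrable P (Rw k)" and int_col: "integrable P (Cl k)" for k
    using lim_bd by (intro integrable_const_bound[where B = C]; auto)+
  have "(\<lambda>k. \<integral>x. Rw k x - Cl k x \<partial>P) \<longlonglongrightarrow> (\<integral>x. 0 \<partial>P)"
  proof (rule integral_dominated_convergence[where w = "\<lambda>_. 2 * C"])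
    show "AE x in P. (\<lambda>k. Rw k x - Cl k x) \<longlonglongrightarrow> 0" using AE_H by auto
    show "AE x in P. norm (Rw k x - Cl k x) \<le> 2 * C" for k
      using lim_bd(1)[of k] lim_bd(2)[of k] by eventually_elim auto
  qed auto
  moreover have "(\<lambda>k. \<integral>x. Rw k x - Cl k x \<partial>P) \<longlonglongrightarrow> \<alpha> - \<beta>"
    using int_row int_col weights_average_tendsto[OF w \<alpha>] weights_average_tendsto[OF w' \<beta>]
    by (simp add: row_int col_int tendsto_diff)
  ultimately show ?thesis using LIMSEQ_unique by fastforce
qed

section \<open>Formulas in a structure\<close>

text \<open>
  Variables are pairs of a sort and an index, but below they only ever occur as indivisible objects.
  Quantifiers over variables are therefore kept in one piece by the simplifier.
\<close>

declare split_paired_All [simp del] split_paired_Ex [simp del]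

text \<open>
  Assignments respect the sorts of all variables rather than only those of the free variables of some
  formula. This makes the notion independent of the formula and stable under updates; a
  tuple is extended to an assignment by arbitrary values of the right sorts.
\<close>

definition assignment :: "('s, 'p, 'f) lang \<Rightarrow> ('s, 'p, 'f, 'a) aff_struct \<Rightarrow> ('s var \<Rightarrow> 'a) \<Rightarrow> bool" where
  "assignment L M v \<longleftrightarrow> (\<forall>x. fst x \<in> sorts L \<longrightarrow> v x \<in> univ M (fst x))"

lemma assignment_upd: "assignment L M v \<Longrightarrow> a \<in> univ M (fst x) \<Longrightarrow> assignment L M (v(x := a))"
  by (auto simp: assignment_def simp del: split_paired_All)

lemma map_in_tuples:
  assumes "map srt ts = ss" and "\<And>t. t \<in> set ts \<Longrightarrow> h t \<in> univ M (srt t)"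
  shows "map h ts \<in> tuples M ss"
  using assms by (auto simp: tuples_def list.rel_map intro!: list.rel_refl_strong)

lemma trm_val_cong: "(\<And>x. x \<in> trm_vars t \<Longrightarrow> v x = v' x) \<Longrightarrow> trm_val M v t = trm_val M v' t"
proof (induction t)
  case (App F ts)
  then have "map (trm_val M v) ts = map (trm_val M v') ts" by (intro map_cong) auto
  then show ?case by (simp only: trm_val.simps)
qed simp

lemma val_cong: "(\<And>x. x \<in> free_vars \<phi> \<Longrightarrow> v x = v' x) \<Longrightarrow> val M \<phi> v = val M \<phi> v'"
proof (induction \<phi> arbitrary: v v')
  case (Dist s t u)
  have "trm_val M v t = trm_val M v' t" "trm_val M v u = trm_val M v' u"
    by (rule trm_val_cong, use Dist in simp)+
  then show ?case by simp
next
  case (Pred P ts)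
  then have "map (trm_val M v) ts = map (trm_val M v') ts"
    by (intro map_cong trm_val_cong) auto
  then show ?case by (simp only: val.simps)
next
  case (Plus \<phi> \<psi>)
  have "val M \<phi> v = val M \<phi> v'" "val M \<psi> v = val M \<psi> v'"
    using Plus.prems by (auto intro: Plus.IH)
  then show ?case by simp
next
  case (QSup x \<phi>)
  then have "val M \<phi> (v(x := a)) = val M \<phi> (v'(x := a))" for a by (intro QSup.IH) auto
  then show ?case by simp
next
  case (QInf x \<phi>)
  then have "val M \<phi> (v(x := a)) = val M \<phi> (v'(x := a))" for a by (intro QInf.IH) auto
  then show ?case by simp
next
  case (Scale r \<phi>)
  have "val M \<phi> v = val M \<phi> v'" by (rule Scale.IH) (use Scale.prems in simp)
  then show ?case by simp
qed simp

text \<open>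
  Infima are negated suprema of negated formulas. The inductions establishing bounds, continuity,
  measurability and the integral formula therefore treat suprema in a lemma of its own, which is applied to \<open>\<phi>\<close> in one case and to \<open>-\<phi>\<close> in the other.
\<close>

lemma val_QInf: "val M (QInf x \<phi>) v = - val M (QSup x (Scale (-1) \<phi>)) v"
  by (simp add: Inf_real_def image_image)

lemma finite_trm_vars: "finite (trm_vars t)"
  by (induction t) auto

lemma finite_free_vars: "finite (free_vars \<phi>)"
  by (induction \<phi>) (auto simp: finite_trm_vars)

lemma trm_vars_sorts: "wf_trm L t \<Longrightarrow> x \<in> trm_vars t \<Longrightarrow> fst x \<in> sorts L"
  by (induction t) (auto simp: list_all_iff)

lemma free_vars_sorts: "affine_formula L \<phi> \<Longrightarrow> x \<in> free_vars \<phi> \<Longrightarrow> fst x \<in> sorts L"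
  by (induction \<phi>) (auto dest: trm_vars_sorts)

lemma structureD:
  assumes "is_structure L M"
  shows structure_univ: "s \<in> sorts L \<Longrightarrow> univ M s \<noteq> {}"
    and structure_metric: "s \<in> sorts L \<Longrightarrow> Metric_space (univ M s) (dst M s)"
    and structure_dst_le: "s \<in> sorts L \<Longrightarrow> a \<in> univ M s \<Longrightarrow> b \<in> univ M s \<Longrightarrow> dst M s a b \<le> sbound L s"
    and structure_prd_le: "P \<in> preds L \<Longrightarrow> as \<in> tuples M (pdom L P) \<Longrightarrow> \<bar>prd M P as\<bar> \<le> pbound L P"
    and structure_prd_mod: "P \<in> preds L \<Longrightarrow> as \<in> tuples M (pdom L P) \<Longrightarrow> bs \<in> tuples M (pdom L P) \<Longrightarrow>
      \<bar>prd M P as - prd M P bs\<bar> \<le> pmod L P (tdist M (pdom L P) as bs)"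
    and structure_fn: "F \<in> funs L \<Longrightarrow> as \<in> tuples M (fdom L F) \<Longrightarrow> fn M F as \<in> univ M (fcod L F)"
    and structure_fn_mod: "F \<in> funs L \<Longrightarrow> as \<in> tuples M (fdom L F) \<Longrightarrow> bs \<in> tuples M (fdom L F) \<Longrightarrow>
      dst M (fcod L F) (fn M F as) (fn M F bs) \<le> fmod L F (tdist M (fdom L F) as bs)"
  using assms unfolding is_structure_def by blast+

lemma dst_nonneg: "is_structure L M \<Longrightarrow> s \<in> sorts L \<Longrightarrow> 0 \<le> dst M s a b"
  by (rule Metric_space.nonneg[OF structure_metric])

lemma dst_self: "is_structure L M \<Longrightarrow> s \<in> sorts L \<Longrightarrow> a \<in> univ M s \<Longrightarrow> dst M s a a = 0"
  by (rule Metric_space.mdist_zero[OF structure_metric])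

lemma dst_commute: "is_structure L M \<Longrightarrow> s \<in> sorts L \<Longrightarrow> dst M s a b = dst M s b a"
  by (rule Metric_space.commute[OF structure_metric])

lemma dst_triangle:
  "is_structure L M \<Longrightarrow> s \<in> sorts L \<Longrightarrow> a \<in> univ M s \<Longrightarrow> b \<in> univ M s \<Longrightarrow> c \<in> univ M s \<Longrightarrow>
    dst M s a c \<le> dst M s a b + dst M s b c"
  by (rule Metric_space.triangle[OF structure_metric])

lemma tdist_nonneg: "is_structure L M \<Longrightarrow> set ss \<subseteq> sorts L \<Longrightarrow> 0 \<le> tdist M ss as bs"
  unfolding tdist_def by (intro sum_nonneg dst_nonneg) auto

lemma trm_val_in_univ:
  assumes "is_structure L M" and "assignment L M v"
  shows "wf_trm L t \<Longrightarrow> trm_val M v t \<in> univ M (trm_sort L t)"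
proof (induction t)
  case (Var x)
  then show ?case using assms by (simp add: assignment_def)
next
  case (App F ts)
  then have "map (trm_val M v) ts \<in> tuples M (fdom L F)"
    by (intro map_in_tuples[where srt = "trm_sort L"]) (auto simp: list_all_iff)
  then show ?case using App.prems structure_fn[OF assms(1)] by auto
qed

lemma modulus_tendsto:
  assumes "modulus \<Delta>" and "(g \<longlongrightarrow> 0) F" and "\<forall>\<^sub>F x in F. 0 \<le> g x"
  shows "((\<lambda>x. \<Delta> (g x)) \<longlongrightarrow> 0) F"
  using continuous_on_tendsto_compose[of "{0..}" \<Delta> g 0 F] assms by (auto simp: modulus_def)

lemma tendsto_zero_le:
  fixes g :: "'a \<Rightarrow> real"
  assumes "(h \<longlongrightarrow> 0) F" and "\<forall>\<^sub>F x in F. \<bar>g x\<bar> \<le> h x"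
  shows "(g \<longlongrightarrow> 0) F"
  by (rule Lim_null_comparison[OF _ assms(1)]) (use assms(2) in simp)

lemma fn_tendsto:
  assumes "language L" and M: "is_structure L M" and F: "f \<in> funs L"
    and "\<forall>\<^sub>F x in F. as x \<in> tuples M (fdom L f) \<and> bs x \<in> tuples M (fdom L f)"
    and "((\<lambda>x. tdist M (fdom L f) (as x) (bs x)) \<longlongrightarrow> 0) F"
  shows "((\<lambda>x. dst M (fcod L f) (fn M f (as x)) (fn M f (bs x))) \<longlongrightarrow> 0) F"
proof (rule tendsto_zero_le)
  have lang: "set (fdom L f) \<subseteq> sorts L" "fcod L f \<in> sorts L" "modulus (fmod L f)"
    using assms(1) F by (auto simp: language_def)
  show "((\<lambda>x. fmod L f (tdist M (fdom L f) (as x) (bs x))) \<longlongrightarrow> 0) F"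
    by (rule modulus_tendsto[OF lang(3) assms(5)]) (simp add: tdist_nonneg[OF M lang(1)])
  show "\<forall>\<^sub>F x in F. \<bar>dst M (fcod L f) (fn M f (as x)) (fn M f (bs x))\<bar>
      \<le> fmod L f (tdist M (fdom L f) (as x) (bs x))"
    using assms(4)
  proof eventually_elim
    case (elim x)
    then show ?case using structure_fn_mod[OF M F, of "as x" "bs x"] dst_nonneg[OF M lang(2)] by simp
  qed
qed

lemma prd_tendsto:
  assumes "language L" and M: "is_structure L M" and P: "P \<in> preds L"
    and "\<forall>\<^sub>F x in F. as x \<in> tuples M (pdom L P) \<and> bs x \<in> tuples M (pdom L P)"
    and "((\<lambda>x. tdist M (pdom L P) (as x) (bs x)) \<longlongrightarrow> 0) F"
  shows "((\<lambda>x. prd M P (as x) - prd M P (bs x)) \<longlongrightarrow> 0) F"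
proof (rule tendsto_zero_le)
  have lang: "set (pdom L P) \<subseteq> sorts L" "modulus (pmod L P)"
    using assms(1) P by (auto simp: language_def)
  show "((\<lambda>x. pmod L P (tdist M (pdom L P) (as x) (bs x))) \<longlongrightarrow> 0) F"
    by (rule modulus_tendsto[OF lang(2) assms(5)]) (simp add: tdist_nonneg[OF M lang(1)])
  show "\<forall>\<^sub>F x in F. \<bar>prd M P (as x) - prd M P (bs x)\<bar>
      \<le> pmod L P (tdist M (pdom L P) (as x) (bs x))"
    using assms(4)
  proof eventually_elim
    case (elim x)
    then show ?case using structure_prd_mod[OF M P, of "as x" "bs x"] by simp
  qed
qed

lemma dst_diff_le:
  assumes "is_structure L M" "s \<in> sorts L" "{a, a', b, b'} \<subseteq> univ M s"
  shows "\<bar>dst M s a b - dst M s a' b'\<bar> \<le> dst M s a a' + dst M s b b'"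
proof -
  note tri = dst_triangle[OF assms(1,2)] and com = dst_commute[OF assms(1,2)]
  have "dst M s a b \<le> dst M s a a' + (dst M s a' b' + dst M s b' b)"
    using tri[of a a' b] tri[of a' b' b] assms(3) by simp
  moreover have "dst M s a' b' \<le> dst M s a' a + (dst M s a b + dst M s b b')"
    using tri[of a' a b'] tri[of a b b'] assms(3) by simp
  ultimately show ?thesis using com[of a a'] com[of b b'] by simp
qed

text \<open>
  Convergence along this filter of pairs of assignments expresses uniform continuity in the variable \<open>x\<close>,
  uniformly in the values of the other variables. The uniformity is what survives a quantifier.
\<close>

definition close :: "('s, 'p, 'f) lang \<Rightarrow> ('s, 'p, 'f, 'a) aff_struct \<Rightarrow> 's var \<Rightarrow>
    (('s var \<Rightarrow> 'a) \<times> ('s var \<Rightarrow> 'a)) filter" where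
  "close L M x = (INF \<delta>\<in>{0<..}. principal {(v(x := a), v(x := b)) | v a b. assignment L M v \<and>
     a \<in> univ M (fst x) \<and> b \<in> univ M (fst x) \<and> dst M (fst x) a b < \<delta>})"

lemma eventually_close:
  "eventually R (close L M x) \<longleftrightarrow> (\<exists>\<delta>>0. \<forall>v a b. assignment L M v \<longrightarrow> a \<in> univ M (fst x) \<longrightarrow>
     b \<in> univ M (fst x) \<longrightarrow> dst M (fst x) a b < \<delta> \<longrightarrow> R (v(x := a), v(x := b)))"
proof -
  let ?S = "\<lambda>\<delta>::real. {(v(x := a), v(x := b)) | v a b. assignment L M v \<and>
     a \<in> univ M (fst x) \<and> b \<in> univ M (fst x) \<and> dst M (fst x) a b < \<delta>}"
  have "\<exists>\<eta>\<in>{0<..}. principal (?S \<eta>) \<le> inf (principal (?S \<delta>)) (principal (?S \<epsilon>))"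
    if "\<delta> \<in> {0<..}" "\<epsilon> \<in> {0<..}" for \<delta> \<epsilon> :: real
  proof (rule bexI)
    have "?S (min \<delta> \<epsilon>) \<subseteq> ?S \<delta> \<inter> ?S \<epsilon>" by fastforce
    then show "principal (?S (min \<delta> \<epsilon>)) \<le> inf (principal (?S \<delta>)) (principal (?S \<epsilon>))"
      by (simp only: inf_principal principal_le_iff)
  qed (use that in auto)
  then have "eventually R (close L M x) \<longleftrightarrow> (\<exists>\<delta>\<in>{0<..}. eventually R (principal (?S \<delta>)))"
    unfolding close_def by (intro eventually_INF_base) auto
  also have "\<dots> \<longleftrightarrow> (\<exists>\<delta>>0. \<forall>z\<in>?S \<delta>. R z)" by (simp only: eventually_principal Bex_def greaterThan_iff)
  also have "\<dots> \<longleftrightarrow> (\<exists>\<delta>>0. \<forall>v a b. assignment L M v \<longrightarrow> a \<in> univ M (fst x) \<longrightarrow>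
     b \<in> univ M (fst x) \<longrightarrow> dst M (fst x) a b < \<delta> \<longrightarrow> R (v(x := a), v(x := b)))"
    by blast
  finally show ?thesis .
qed

lemma eventually_close_assignments:
  "\<forall>\<^sub>F z in close L M x. assignment L M (fst z) \<and> assignment L M (snd z)"
  unfolding eventually_close by (intro exI[of _ 1]) (auto intro: assignment_upd)

lemma tdist_map_tendsto:
  assumes "map srt ts = ss"
    and "\<And>t. t \<in> set ts \<Longrightarrow> ((\<lambda>z. dst M (srt t) (g z t) (h z t)) \<longlongrightarrow> 0) F"
  shows "((\<lambda>z. tdist M ss (map (g z) ts) (map (h z) ts)) \<longlongrightarrow> 0) F"
proof -
  have "((\<lambda>z. \<Sum>k<length ts. dst M (srt (ts ! k)) (g z (ts ! k)) (h z (ts ! k))) \<longlongrightarrow> (\<Sum>k<length ts. 0)) F"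
    using assms(2) by (intro tendsto_sum) auto
  then show ?thesis unfolding assms(1)[symmetric] tdist_def by simp
qed

lemma trm_val_uniform:
  assumes "language L" and M: "is_structure L M" and x: "fst x \<in> sorts L"
  shows "wf_trm L t \<Longrightarrow>
    ((\<lambda>z. dst M (trm_sort L t) (trm_val M (fst z) t) (trm_val M (snd z) t)) \<longlongrightarrow> 0) (close L M x)"
proof (induction t)
  case (Var y)
  show ?case
  proof (cases "y = x")
    case True
    have "\<forall>\<^sub>F z in close L M x. \<bar>dst M (fst x) (fst z x) (snd z x)\<bar> < e" if "e > 0" for e
      unfolding eventually_close using that dst_nonneg[OF M x] by (intro exI[of _ e]) simp
    then show ?thesis using True by (simp add: tendsto_iff dist_real_def)
  next
    case False
    have "\<forall>\<^sub>F z in close L M x. dst M (fst y) (fst z y) (snd z y) = 0"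
      unfolding eventually_close using Var dst_self[OF M] False
      by (intro exI[of _ 1]) (auto simp: assignment_def)
    then show ?thesis by (intro tendsto_eventually) simp
  qed
next
  case (App f ts)
  have f: "f \<in> funs L" and ts: "map (trm_sort L) ts = fdom L f" and wf: "\<And>t. t \<in> set ts \<Longrightarrow> wf_trm L t"
    using App.prems by (auto simp: list_all_iff)
  have "((\<lambda>z. dst M (fcod L f) (fn M f (map (trm_val M (fst z)) ts)) (fn M f (map (trm_val M (snd z)) ts))) \<longlongrightarrow> 0)
    (close L M x)"
  proof (rule fn_tendsto[OF assms(1) M f])
    show "\<forall>\<^sub>F z in close L M x. map (trm_val M (fst z)) ts \<in> tuples M (fdom L f) \<and>
        map (trm_val M (snd z)) ts \<in> tuples M (fdom L f)"
      using eventually_close_assignments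
      by eventually_elim (use wf in \<open>auto intro!: map_in_tuples[OF ts] trm_val_in_univ[OF M]\<close>)
    show "((\<lambda>z. tdist M (fdom L f) (map (trm_val M (fst z)) ts) (map (trm_val M (snd z)) ts)) \<longlongrightarrow> 0) (close L M x)"
      by (rule tdist_map_tendsto[OF ts App.IH[OF _ wf]])
  qed
  then show ?case by simp
qed

lemma cSUP_diff_le:
  fixes f g :: "'a \<Rightarrow> real"
  assumes "A \<noteq> {}" "\<And>a. a \<in> A \<Longrightarrow> \<bar>f a\<bar> \<le> B" "\<And>a. a \<in> A \<Longrightarrow> \<bar>g a\<bar> \<le> B"
    "\<And>a. a \<in> A \<Longrightarrow> \<bar>f a - g a\<bar> \<le> \<epsilon>"
  shows "\<bar>(SUP a\<in>A. f a) - (SUP a\<in>A. g a)\<bar> \<le> \<epsilon>"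
proof -
  have bdd: "bdd_above (f ` A)" "bdd_above (g ` A)"
    using assms(2,3) by (auto intro!: bdd_aboveI[of _ B] simp: abs_le_iff)
  have "(SUP a\<in>A. f a) \<le> (SUP a\<in>A. g a) + \<epsilon>"
  proof (rule cSUP_least[OF assms(1)])
    fix a assume "a \<in> A"
    then show "f a \<le> (SUP a\<in>A. g a) + \<epsilon>" using cSUP_upper[OF _ bdd(2), of a] assms(4)[of a] by linarith
  qed
  moreover have "(SUP a\<in>A. g a) \<le> (SUP a\<in>A. f a) + \<epsilon>"
  proof (rule cSUP_least[OF assms(1)])
    fix a assume "a \<in> A"
    then show "g a \<le> (SUP a\<in>A. f a) + \<epsilon>" using cSUP_upper[OF _ bdd(1), of a] assms(4)[of a] by linarith
  qed
  ultimately show ?thesis by linarith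
qed

lemma val_bounded_QSup:
  assumes "is_structure L M" "fst x \<in> sorts L" and B: "\<And>v. assignment L M v \<Longrightarrow> \<bar>val M \<phi> v\<bar> \<le> B" and v: "assignment L M v"
  shows "\<bar>val M (QSup x \<phi>) v\<bar> \<le> B"
proof -
  have "\<bar>SUP a\<in>univ M (fst x). val M \<phi> (v(x := a))\<bar> \<le> B"
    using B[OF assignment_upd[OF v, where x = x]] structure_univ[OF assms(1,2)] by (intro cSup_abs_le) auto
  then show ?thesis by simp
qed

lemma val_bounded:
  assumes "affine_formula L \<phi>"
  shows "\<exists>B. \<forall>(M :: ('s, 'p, 'f, 'a) aff_struct) v. is_structure L M \<longrightarrow> assignment L M v \<longrightarrow> \<bar>val M \<phi> v\<bar> \<le> B"
  using assms
proof (induction \<phi>)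
  case (Dist s t u)
  have "\<bar>val M (Dist s t u) v\<bar> \<le> sbound L s" if M: "is_structure L M" and v: "assignment L M v"
    for M :: "('s, 'p, 'f, 'a) aff_struct" and v
    using Dist structure_dst_le[OF M, of s "trm_val M v t" "trm_val M v u"]
      trm_val_in_univ[OF M v, of t] trm_val_in_univ[OF M v, of u] dst_nonneg[OF M, of s]
    by simp
  then show ?case by blast
next
  case (Pred P ts)
  have "\<bar>val M (Pred P ts) v\<bar> \<le> pbound L P" if M: "is_structure L M" and v: "assignment L M v"
    for M :: "('s, 'p, 'f, 'a) aff_struct" and v
    using Pred structure_prd_le[OF M _ map_in_tuples[of "trm_sort L" ts]] trm_val_in_univ[OF M v]
    by simp
  then show ?case by blast
next
  case (Const r)
  then show ?case by auto
next
  case (Plus \<phi> \<psi>)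
  then obtain B B' where "\<forall>(M :: ('s, 'p, 'f, 'a) aff_struct) v. is_structure L M \<longrightarrow> assignment L M v \<longrightarrow> \<bar>val M \<phi> v\<bar> \<le> B"
    "\<forall>(M :: ('s, 'p, 'f, 'a) aff_struct) v. is_structure L M \<longrightarrow> assignment L M v \<longrightarrow> \<bar>val M \<psi> v\<bar> \<le> B'" by auto
  then have "\<bar>val M (Plus \<phi> \<psi>) v\<bar> \<le> B + B'" if "is_structure L M" "assignment L M v"
    for M :: "('s, 'p, 'f, 'a) aff_struct" and v
    unfolding val.simps using that by (intro order.trans[OF abs_triangle_ineq add_mono]) blast+
  then show ?case by blast
next
  case (Scale r \<phi>)
  then obtain B where "\<forall>(M :: ('s, 'p, 'f, 'a) aff_struct) v. is_structure L M \<longrightarrow> assignment L M v \<longrightarrow> \<bar>val M \<phi> v\<bar> \<le> B" by auto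
  then have "\<bar>val M (Scale r \<phi>) v\<bar> \<le> \<bar>r\<bar> * B" if "is_structure L M" "assignment L M v"
    for M :: "('s, 'p, 'f, 'a) aff_struct" and v
    using that by (simp add: abs_mult mult_left_mono)
  then show ?case by blast
next
  case (QSup x \<phi>)
  then obtain B where B: "\<forall>(M :: ('s, 'p, 'f, 'a) aff_struct) v. is_structure L M \<longrightarrow> assignment L M v \<longrightarrow> \<bar>val M \<phi> v\<bar> \<le> B" by auto
  have "\<bar>val M (QSup x \<phi>) v\<bar> \<le> B" if "is_structure L M" "assignment L M v"
    for M :: "('s, 'p, 'f, 'a) aff_struct" and v
    by (rule val_bounded_QSup[OF that(1) _ _ that(2)]) (use QSup.prems B that in auto)
  then show ?case by blast
next
  case (QInf x \<phi>)
  then obtain B where B: "\<forall>(M :: ('s, 'p, 'f, 'a) aff_struct) v. is_structure L M \<longrightarrow> assignment L M v \<longrightarrow> \<bar>val M \<phi> v\<bar> \<le> B" by auto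
  have "\<bar>val M (QInf x \<phi>) v\<bar> \<le> B" if "is_structure L M" "assignment L M v"
    for M :: "('s, 'p, 'f, 'a) aff_struct" and v
    unfolding val_QInf abs_minus_cancel
    by (rule val_bounded_QSup[OF that(1) _ _ that(2)]) (use QInf.prems B that in auto)
  then show ?case by blast
qed

lemma val_uniform_QSup:
  assumes M: "is_structure L M" and x: "fst x \<in> sorts L" and y: "fst y \<in> sorts L"
    and B: "\<And>v. assignment L M v \<Longrightarrow> \<bar>val M \<phi> v\<bar> \<le> B"
    and lim: "((\<lambda>z. val M \<phi> (fst z) - val M \<phi> (snd z)) \<longlongrightarrow> 0) (close L M x)"
  shows "((\<lambda>z. val M (QSup y \<phi>) (fst z) - val M (QSup y \<phi>) (snd z)) \<longlongrightarrow> 0) (close L M x)"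
proof (cases "y = x")
  case True
  have "\<forall>\<^sub>F z in close L M x. val M (QSup y \<phi>) (fst z) - val M (QSup y \<phi>) (snd z) = 0"
    unfolding eventually_close using True by (intro exI[of _ 1]) simp
  then show ?thesis by (rule tendsto_eventually)
next
  case False
  show ?thesis unfolding tendsto_iff
  proof (intro allI impI)
    fix e :: real assume e: "e > 0"
    have "\<forall>\<^sub>F z in close L M x. dist (val M \<phi> (fst z) - val M \<phi> (snd z)) 0 < e / 2"
      using tendstoD[OF lim half_gt_zero[OF e]] by simp
    then obtain \<delta> where \<delta>: "\<delta> > 0" "\<And>v a b. assignment L M v \<Longrightarrow> a \<in> univ M (fst x) \<Longrightarrow>
        b \<in> univ M (fst x) \<Longrightarrow> dst M (fst x) a b < \<delta> \<Longrightarrow> \<bar>val M \<phi> (v(x := a)) - val M \<phi> (v(x := b))\<bar> < e / 2"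
      unfolding eventually_close by (auto simp: dist_real_def)
    show "\<forall>\<^sub>F z in close L M x. dist (val M (QSup y \<phi>) (fst z) - val M (QSup y \<phi>) (snd z)) 0 < e"
      unfolding eventually_close
    proof (intro exI[of _ \<delta>] conjI allI impI \<delta>(1))
      fix v a b
      assume v: "assignment L M v" and ab: "a \<in> univ M (fst x)" "b \<in> univ M (fst x)" "dst M (fst x) a b < \<delta>"
      have "\<bar>(SUP c\<in>univ M (fst y). val M \<phi> (v(x := a, y := c))) - (SUP c\<in>univ M (fst y). val M \<phi> (v(x := b, y := c)))\<bar> \<le> e / 2"
      proof (rule cSUP_diff_le[where B = B])
        fix c assume c: "c \<in> univ M (fst y)"
        show "\<bar>val M \<phi> (v(x := a, y := c))\<bar> \<le> B" by (intro B assignment_upd v ab c)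
        show "\<bar>val M \<phi> (v(x := b, y := c))\<bar> \<le> B" by (intro B assignment_upd v ab c)
        show "\<bar>val M \<phi> (v(x := a, y := c)) - val M \<phi> (v(x := b, y := c))\<bar> \<le> e / 2"
          using \<delta>(2)[OF assignment_upd[OF v c] ab] False by (simp add: fun_upd_twist)
      qed (rule structure_univ[OF M y])
      then show "dist (val M (QSup y \<phi>) (fst (v(x := a), v(x := b))) - val M (QSup y \<phi>) (snd (v(x := a), v(x := b)))) 0 < e"
        using e by (simp add: dist_real_def)
    qed
  qed
qed

lemma val_uniform:
  assumes L: "language L" and M: "is_structure L M" and x: "fst x \<in> sorts L" and "affine_formula L \<phi>"
  shows "((\<lambda>z. val M \<phi> (fst z) - val M \<phi> (snd z)) \<longlongrightarrow> 0) (close L M x)"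
  using assms(4)
proof (induction \<phi>)
  case (Dist s t u)
  then have s: "s \<in> sorts L" "trm_sort L t = s" "trm_sort L u = s" "wf_trm L t" "wf_trm L u" by auto
  show ?case
  proof (rule tendsto_zero_le)
    show "((\<lambda>z. dst M s (trm_val M (fst z) t) (trm_val M (snd z) t) +
        dst M s (trm_val M (fst z) u) (trm_val M (snd z) u)) \<longlongrightarrow> 0) (close L M x)"
      using trm_val_uniform[OF L M x s(4)] trm_val_uniform[OF L M x s(5)]
      unfolding s by (rule tendsto_add_zero)
    show "\<forall>\<^sub>F z in close L M x. \<bar>val M (Dist s t u) (fst z) - val M (Dist s t u) (snd z)\<bar>
      \<le> dst M s (trm_val M (fst z) t) (trm_val M (snd z) t) + dst M s (trm_val M (fst z) u) (trm_val M (snd z) u)"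
      using eventually_close_assignments
    proof eventually_elim
      case (elim z)
      then have "{trm_val M (fst z) t, trm_val M (snd z) t, trm_val M (fst z) u, trm_val M (snd z) u} \<subseteq> univ M s"
        using trm_val_in_univ[OF M _ s(4)] trm_val_in_univ[OF M _ s(5)] s(2,3) by auto
      then show ?case unfolding val.simps by (rule dst_diff_le[OF M s(1)])
    qed
  qed
next
  case (Pred P ts)
  then have P: "P \<in> preds L" and ts: "map (trm_sort L) ts = pdom L P" and wf: "\<And>t. t \<in> set ts \<Longrightarrow> wf_trm L t" by auto
  have "((\<lambda>z. prd M P (map (trm_val M (fst z)) ts) - prd M P (map (trm_val M (snd z)) ts)) \<longlongrightarrow> 0) (close L M x)"
  proof (rule prd_tendsto[OF L M P])
    show "\<forall>\<^sub>F z in close L M x. map (trm_val M (fst z)) ts \<in> tuples M (pdom L P) \<and>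
        map (trm_val M (snd z)) ts \<in> tuples M (pdom L P)"
      using eventually_close_assignments
      by eventually_elim (use wf in \<open>auto intro!: map_in_tuples[OF ts] trm_val_in_univ[OF M]\<close>)
    show "((\<lambda>z. tdist M (pdom L P) (map (trm_val M (fst z)) ts) (map (trm_val M (snd z)) ts)) \<longlongrightarrow> 0) (close L M x)"
      by (rule tdist_map_tendsto[OF ts trm_val_uniform[OF L M x wf]])
  qed
  then show ?case by simp
next
  case (Const r)
  then show ?case by simp
next
  case (Plus \<phi> \<psi>)
  then have "((\<lambda>z. (val M \<phi> (fst z) - val M \<phi> (snd z)) + (val M \<psi> (fst z) - val M \<psi> (snd z))) \<longlongrightarrow> 0) (close L M x)"
    by (intro tendsto_add_zero) simp_all
  then show ?case by (simp add: algebra_simps)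
next
  case (Scale r \<phi>)
  then have "((\<lambda>z. r * (val M \<phi> (fst z) - val M \<phi> (snd z))) \<longlongrightarrow> 0) (close L M x)"
    by (intro tendsto_mult_right_zero) simp
  then show ?case by (simp add: algebra_simps)
next
  case (QSup y \<phi>)
  then have "affine_formula L \<phi>" by simp
  then obtain B where B: "\<And>v. assignment L M v \<Longrightarrow> \<bar>val M \<phi> v\<bar> \<le> B"
    using val_bounded[of L \<phi>] M by blast
  show ?case by (rule val_uniform_QSup[where B = B, OF M x]) (use QSup B in simp_all)
next
  case (QInf y \<phi>)
  then have "affine_formula L \<phi>" by simp
  then obtain B where B: "\<And>v. assignment L M v \<Longrightarrow> \<bar>val M \<phi> v\<bar> \<le> B"
    using val_bounded[of L \<phi>] M by blast
  have "((\<lambda>z. (-1) * (val M \<phi> (fst z) - val M \<phi> (snd z))) \<longlongrightarrow> 0) (close L M x)"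
    using QInf by (intro tendsto_mult_right_zero) simp
  then have neg: "((\<lambda>z. val M (Scale (-1) \<phi>) (fst z) - val M (Scale (-1) \<phi>) (snd z)) \<longlongrightarrow> 0) (close L M x)"
    by (simp add: algebra_simps)
  have "((\<lambda>z. val M (QSup y (Scale (-1) \<phi>)) (fst z) - val M (QSup y (Scale (-1) \<phi>)) (snd z)) \<longlongrightarrow> 0) (close L M x)"
    by (rule val_uniform_QSup[where B = B, OF M x _ _ neg]) (use QInf B in simp_all)
  from tendsto_minus[OF this] show ?case unfolding val_QInf by (simp del: val.simps)
qed

section \<open>Finite sublanguages\<close>

abbreviation restrict_lang :: "('s, 'p, 'f) lang \<Rightarrow> 's set \<Rightarrow> 'p set \<Rightarrow> 'f set \<Rightarrow> ('s, 'p, 'f) lang" where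
  "restrict_lang L S Ps Fs \<equiv> L\<lparr>sorts := S, preds := Ps, funs := Fs\<rparr>"

primrec trm_funs :: "('s, 'f) trm \<Rightarrow> 'f set" where
  "trm_funs (Var x) = {}"
| "trm_funs (App F ts) = insert F (\<Union> (set (map trm_funs ts)))"

primrec fml_sorts :: "('s, 'p, 'f) fml \<Rightarrow> 's set" where
  "fml_sorts (Dist s t u) = insert s (fst ` (trm_vars t \<union> trm_vars u))"
| "fml_sorts (Pred P ts) = fst ` (\<Union>t\<in>set ts. trm_vars t)"
| "fml_sorts (Const r) = {}"
| "fml_sorts (Plus \<phi> \<psi>) = fml_sorts \<phi> \<union> fml_sorts \<psi>"
| "fml_sorts (Scale r \<phi>) = fml_sorts \<phi>"
| "fml_sorts (QSup x \<phi>) = insert (fst x) (fml_sorts \<phi>)"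
| "fml_sorts (QInf x \<phi>) = insert (fst x) (fml_sorts \<phi>)"

primrec fml_preds :: "('s, 'p, 'f) fml \<Rightarrow> 'p set" where
  "fml_preds (Dist s t u) = {}"
| "fml_preds (Pred P ts) = {P}"
| "fml_preds (Const r) = {}"
| "fml_preds (Plus \<phi> \<psi>) = fml_preds \<phi> \<union> fml_preds \<psi>"
| "fml_preds (Scale r \<phi>) = fml_preds \<phi>"
| "fml_preds (QSup x \<phi>) = fml_preds \<phi>"
| "fml_preds (QInf x \<phi>) = fml_preds \<phi>"

primrec fml_funs :: "('s, 'p, 'f) fml \<Rightarrow> 'f set" where
  "fml_funs (Dist s t u) = trm_funs t \<union> trm_funs u"
| "fml_funs (Pred P ts) = (\<Union>t\<in>set ts. trm_funs t)"
| "fml_funs (Const r) = {}"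
| "fml_funs (Plus \<phi> \<psi>) = fml_funs \<phi> \<union> fml_funs \<psi>"
| "fml_funs (Scale r \<phi>) = fml_funs \<phi>"
| "fml_funs (QSup x \<phi>) = fml_funs \<phi>"
| "fml_funs (QInf x \<phi>) = fml_funs \<phi>"

lemma trm_sort_restrict [simp]: "trm_sort (restrict_lang L S Ps Fs) = trm_sort L"
proof
  show "trm_sort (restrict_lang L S Ps Fs) t = trm_sort L t" for t by (cases t) auto
qed

lemma wf_trm_restrict:
  "wf_trm L t \<Longrightarrow> fst ` trm_vars t \<subseteq> S \<Longrightarrow> trm_funs t \<subseteq> Fs \<Longrightarrow> wf_trm (restrict_lang L S Ps Fs) t"
proof (induction t)
  case (App F ts)
  have "wf_trm (restrict_lang L S Ps Fs) t" if "t \<in> set ts" for t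
  proof (rule App.IH[OF that])
    show "wf_trm L t" using App.prems that by (simp add: list_all_iff)
    have sub: "trm_vars t \<subseteq> trm_vars (App F ts)" "trm_funs t \<subseteq> trm_funs (App F ts)" using that by auto
    show "fst ` trm_vars t \<subseteq> S" by (rule order.trans[OF image_mono[OF sub(1)] App.prems(2)])
    show "trm_funs t \<subseteq> Fs" by (rule order.trans[OF sub(2) App.prems(3)])
  qed
  then show ?case using App.prems by (simp add: list_all_iff)
qed auto

lemma affine_formula_restrict:
  "affine_formula L \<phi> \<Longrightarrow> fml_sorts \<phi> \<subseteq> S \<Longrightarrow> fml_preds \<phi> \<subseteq> Ps \<Longrightarrow> fml_funs \<phi> \<subseteq> Fs \<Longrightarrow>
    affine_formula (restrict_lang L S Ps Fs) \<phi>"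
proof (induction \<phi>)
  case (Dist s t u)
  then show ?case by (simp add: wf_trm_restrict image_Un)
next
  case (Pred P ts)
  have "wf_trm (restrict_lang L S Ps Fs) t" if "t \<in> set ts" for t
    using Pred that by (intro wf_trm_restrict) (auto 0 3)
  then show ?case using Pred by simp
qed auto

lemma finite_trm_funs: "finite (trm_funs t)"
  by (induction t) auto

lemma finite_fml_symbols: "finite (fml_sorts \<phi>)" "finite (fml_preds \<phi>)" "finite (fml_funs \<phi>)"
  by (induction \<phi>) (auto simp: finite_trm_vars finite_trm_funs)

lemma trm_funs_subset: "wf_trm L t \<Longrightarrow> trm_funs t \<subseteq> funs L"
  by (induction t) (auto simp: list_all_iff)

lemma fml_symbols_subset:
  assumes "affine_formula L \<phi>"
  shows "fml_sorts \<phi> \<subseteq> sorts L \<and> fml_preds \<phi> \<subseteq> preds L \<and> fml_funs \<phi> \<subseteq> funs L"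
  using assms
proof (induction \<phi>)
  case (Dist s t u)
  then show ?case using trm_funs_subset[of L t] trm_funs_subset[of L u] trm_vars_sorts[of L t] trm_vars_sorts[of L u]
    by auto
next
  case (Pred P ts)
  then show ?case using trm_funs_subset[of L] trm_vars_sorts[of L] by fastforce
qed auto

text \<open>
  A sublanguage must contain the sorts of the arguments and values of its symbols; adding these to \<open>S\<close>
  keeps it finite.
\<close>

lemma finite_sublanguage:
  assumes L: "language L" and S: "finite S" "S \<subseteq> sorts L" and Ps: "finite Ps" "Ps \<subseteq> preds L" and Fs: "finite Fs" "Fs \<subseteq> funs L"
  shows "\<exists>S'. S \<subseteq> S' \<and> S' \<subseteq> sorts L \<and> sublanguage (restrict_lang L S' Ps Fs) L \<and>
    finite_language (restrict_lang L S' Ps Fs)"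
proof -
  define S' where "S' = S \<union> (\<Union>P\<in>Ps. set (pdom L P)) \<union> (\<Union>F\<in>Fs. insert (fcod L F) (set (fdom L F)))"
  have S'_sub: "S' \<subseteq> sorts L" using L S Ps Fs unfolding S'_def language_def by blast
  have "language (restrict_lang L S' Ps Fs)"
    using L Ps Fs unfolding language_def S'_def by auto
  then have "sublanguage (restrict_lang L S' Ps Fs) L" using S'_sub Ps Fs unfolding sublanguage_def by blast
  moreover have "finite_language (restrict_lang L S' Ps Fs)"
    using S Ps Fs unfolding finite_language_def S'_def by simp
  ultimately show ?thesis using S'_sub by (intro exI[of _ S']) (auto simp: S'_def)
qed

section \<open>Measurability up to null sets, and measurable selection\<close>

lemma borel_measurable_completion_AE:
  fixes f g :: "'a \<Rightarrow> real"
  assumes f: "f \<in> borel_measurable (completion \<mu>)" and eq: "AE x in \<mu>. f x = g x"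
  shows "g \<in> borel_measurable (completion \<mu>)"
proof (rule measurableI)
  fix A :: "real set" assume A: "A \<in> sets borel"
  have 1: "Measurable.pred (completion \<mu>) (\<lambda>x. f x \<noteq> g x)"
    using eq by (intro sets_completion_AE) auto
  have 2: "Measurable.pred (completion \<mu>) (\<lambda>x. f x \<noteq> g x \<and> g x \<in> A)"
    using eq by (intro sets_completion_AE) (auto elim: AE_mp)
  have 3: "Measurable.pred (completion \<mu>) (\<lambda>x. f x \<in> A)" using f A by measurable
  have "Measurable.pred (completion \<mu>) (\<lambda>x. (f x \<noteq> g x \<and> g x \<in> A) \<or> (\<not> (f x \<noteq> g x) \<and> f x \<in> A))"
    by (intro pred_intros_logic(3,5) pred_intros_logic(2)[OF 1] 2 3)
  moreover have "((f x \<noteq> g x \<and> g x \<in> A) \<or> (\<not> (f x \<noteq> g x) \<and> f x \<in> A)) = (g x \<in> A)" for x by auto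
  ultimately have "Measurable.pred (completion \<mu>) (\<lambda>x. g x \<in> A)" by (simp only:)
  then show "g -` A \<inter> space (completion \<mu>) \<in> sets (completion \<mu>)"
    by (simp add: pred_def vimage_def Int_def conj_commute)
qed simp

lemma borel_measurable_completion_AE_limit:
  fixes h :: "nat \<Rightarrow> 'a \<Rightarrow> real"
  assumes "\<And>n. h n \<in> borel_measurable (completion \<mu>)" and "AE x in \<mu>. (\<lambda>n. h n x) \<longlonglongrightarrow> g x"
  shows "g \<in> borel_measurable (completion \<mu>)"
proof (rule borel_measurable_completion_AE)
  show "(\<lambda>x. lim (\<lambda>n. h n x)) \<in> borel_measurable (completion \<mu>)"
    using assms(1) by measurable
  show "AE x in \<mu>. lim (\<lambda>n. h n x) = g x" using assms(2) by (auto simp: limI)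
qed

text \<open>
  A tuple of simple index functions takes finitely many values, so a function depending on the tuple is
  pieced together from finitely many measurable ones.
\<close>

lemma measurable_simple_tuple:
  fixes \<Phi> :: "'i list \<Rightarrow> 'w \<Rightarrow> real"
  assumes \<kappa>: "\<And>k. k < N \<Longrightarrow> simple_function \<mu> (\<kappa> k)"
    and \<Phi>: "\<And>js. length js = N \<Longrightarrow> (\<And>k. k < N \<Longrightarrow> js ! k \<in> \<kappa> k ` space \<mu>) \<Longrightarrow> \<Phi> js \<in> borel_measurable \<mu>"
  shows "(\<lambda>\<omega>. \<Phi> (map (\<lambda>k. \<kappa> k \<omega>) [0..<N]) \<omega>) \<in> borel_measurable \<mu>"
proof -
  define K where "K \<omega> = map (\<lambda>k. \<kappa> k \<omega>) [0..<N]" for \<omega>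
  define T where "T = {js. length js = N \<and> (\<forall>k<N. js ! k \<in> \<kappa> k ` space \<mu>)}"
  have "T \<subseteq> {js. set js \<subseteq> (\<Union>k<N. \<kappa> k ` space \<mu>) \<and> length js = N}"
  proof
    fix js assume "js \<in> T"
    then have js: "length js = N" "\<And>k. k < N \<Longrightarrow> js ! k \<in> \<kappa> k ` space \<mu>" by (auto simp: T_def)
    have "j \<in> (\<Union>k<N. \<kappa> k ` space \<mu>)" if "j \<in> set js" for j
      using that js unfolding in_set_conv_nth by blast
    then show "js \<in> {js. set js \<subseteq> (\<Union>k<N. \<kappa> k ` space \<mu>) \<and> length js = N}" using js(1) by blast
  qed
  moreover have "finite {js. set js \<subseteq> (\<Union>k<N. \<kappa> k ` space \<mu>) \<and> length js = N}"
    using \<kappa> by (intro finite_lists_length_eq finite_UN_I) (auto simp: simple_function_def)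
  ultimately have "finite T" by (rule finite_subset)
  have "K \<in> measurable \<mu> (count_space T)"
  proof (rule measurable_count_space_eq_countable[THEN iffD2, OF countable_finite[OF \<open>finite T\<close>]], intro conjI ballI)
    show "K \<in> space \<mu> \<rightarrow> T" by (auto simp: K_def T_def)
    fix js assume "js \<in> T"
    then have js: "length js = N" "\<And>k. k < N \<Longrightarrow> js ! k \<in> \<kappa> k ` space \<mu>" by (auto simp: T_def)
    have "K \<omega> = js \<longleftrightarrow> (\<forall>k\<in>{..<N}. \<kappa> k \<omega> = js ! k)" for \<omega>
      unfolding K_def list_eq_iff_nth_eq js(1) by (simp add: Ball_def)
    then have "K -` {js} \<inter> space \<mu> = {\<omega>\<in>space \<mu>. \<forall>k\<in>{..<N}. \<kappa> k \<omega> = js ! k}"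
      by (simp add: vimage_def Int_def conj_commute)
    also have "\<dots> \<in> sets \<mu>"
    proof (rule sets.sets_Collect_finite_All)
      fix k assume "k \<in> {..<N}"
      then have "\<kappa> k \<in> measurable \<mu> (count_space UNIV)" using \<kappa> by (intro measurable_simple_function) simp
      from measurable_sets[OF this, of "{js ! k}"]
      show "{\<omega>\<in>space \<mu>. \<kappa> k \<omega> = js ! k} \<in> sets \<mu>" by (simp add: vimage_def Int_def conj_commute)
    qed simp
    finally show "K -` {js} \<inter> space \<mu> \<in> sets \<mu>" .
  qed
  then have "(\<lambda>\<omega>. \<Phi> (K \<omega>) \<omega>) \<in> borel_measurable \<mu>"
  proof (rule measurable_compose_countable'[where f = \<Phi>, rotated])
    show "countable T" using \<open>finite T\<close> by (rule countable_finite)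
    show "\<Phi> js \<in> borel_measurable \<mu>" if "js \<in> T" for js using that \<Phi> by (auto simp: T_def)
  qed
  then show ?thesis by (simp add: K_def)
qed

text \<open>
  Enumerate the index set and take the first index that works. Countably many indices may occur, but
  finitely many of them suffice outside a set of measure less than \<open>\<delta>\<close>; there the value is irrelevant.
\<close>

lemma (in prob_space) simple_selection:
  fixes P :: "'i \<Rightarrow> 'a set"
  assumes "countable I0" "I0 \<noteq> {}" and P: "\<And>i. i \<in> I0 \<Longrightarrow> P i \<in> events"
    and cover: "AE \<omega> in M. \<exists>i\<in>I0. \<omega> \<in> P i" and "\<delta> > 0"
  shows "\<exists>k B. simple_function M k \<and> k ` space M \<subseteq> I0 \<and> B \<in> events \<and> prob B < \<delta> \<and>
    (\<forall>\<omega>\<in>space M - B. \<omega> \<in> P (k \<omega>))"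
proof -
  define \<iota> where "\<iota> = from_nat_into I0"
  have \<iota>: "\<iota> n \<in> I0" for n unfolding \<iota>_def using assms(2) by (rule from_nat_into)
  have \<iota>_surj: "\<exists>n. i = \<iota> n" if "i \<in> I0" for i
    using from_nat_into_surj[OF assms(1) that] by (auto simp: \<iota>_def)
  define A where "A n = (\<Union>m\<le>n. P (\<iota> m))" for n
  have A: "A n \<in> events" for n using P \<iota> by (auto simp: A_def)
  have "incseq A" by (auto simp: A_def incseq_def intro: order.trans)
  then have "(\<lambda>n. prob (A n)) \<longlonglongrightarrow> prob (\<Union>n. A n)" using A by (intro finite_Lim_measure_incseq) auto
  moreover have "prob (\<Union>n. A n) = 1"
  proof (rule prob_eq_1[THEN iffD2])
    show "AE \<omega> in M. \<omega> \<in> (\<Union>n. A n)"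
      using cover by eventually_elim (auto simp: A_def dest!: \<iota>_surj)
  qed (use A in auto)
  ultimately have "\<forall>\<^sub>F n in sequentially. prob (A n) > 1 - \<delta>"
    using order_tendstoD(1)[of _ 1 sequentially "1 - \<delta>"] \<open>\<delta> > 0\<close> by simp
  then obtain n where n: "prob (A n) > 1 - \<delta>" by (auto simp: eventually_sequentially)
  define q where "q \<omega> = (if \<omega> \<in> A n then LEAST m. \<omega> \<in> P (\<iota> m) else 0)" for \<omega>
  have q_le: "q \<omega> \<le> n" for \<omega>
    unfolding q_def A_def by (auto intro: order.trans[OF Least_le])
  have "Measurable.pred M (\<lambda>\<omega>. \<omega> \<in> P (\<iota> m))" for m
    unfolding pred_def using P[OF \<iota>, of m] sets.sets_into_space[OF P[OF \<iota>, of m]]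
    by (simp add: Collect_conj_eq Int_absorb1 Int_commute)
  then have least: "(\<lambda>\<omega>. LEAST m. \<omega> \<in> P (\<iota> m)) \<in> measurable M (count_space UNIV)"
    by (rule measurable_Least)
  have q_eq: "q = (\<lambda>\<omega>. if \<omega> \<in> A n then LEAST m. \<omega> \<in> P (\<iota> m) else 0)" by (simp add: fun_eq_iff q_def)
  have q_meas: "q \<in> measurable M (count_space UNIV)"
    unfolding q_eq by (rule measurable_If_set[OF least]) (use A[of n] in auto)
  have "simple_function M q" unfolding simple_function_def
  proof (intro conjI ballI)
    show "finite (q ` space M)" by (rule finite_subset[of _ "{..n}"]) (use q_le in auto)
    show "q -` {x} \<inter> space M \<in> sets M" for x by (rule measurable_sets[OF q_meas]) simp
  qed
  then have "simple_function M (\<lambda>\<omega>. \<iota> (q \<omega>))" by (rule simple_function_compose1)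
  moreover have "\<omega> \<in> P (\<iota> (q \<omega>))" if "\<omega> \<in> A n" for \<omega>
    using that LeastI[of "\<lambda>m. \<omega> \<in> P (\<iota> m)"] by (auto simp: q_def A_def)
  moreover have "prob (space M - A n) < \<delta>" using n A by (simp add: prob_compl)
  moreover have "space M - A n \<in> events" using A by auto
  ultimately show ?thesis using \<iota>
    by (intro exI[of _ "\<lambda>\<omega>. \<iota> (q \<omega>)"] exI[of _ "space M - A n"]) auto
qed

text \<open>
  Sets defined by means of measurable sections are only measurable for the completion, whereas a
  simple section requires an index function that is measurable for the measure itself.
  The index function is therefore changed on a null set, and there sent to a default index so as to keep its
  range.
\<close>

lemma (in prob_space) simple_selection_completion:
  fixes P :: "'i \<Rightarrow> 'a set"
  assumes "countable I0" "I0 \<noteq> {}" and P: "\<And>i. i \<in> I0 \<Longrightarrow> P i \<in> sets (completion M)"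
    and cover: "AE \<omega> in M. \<exists>i\<in>I0. \<omega> \<in> P i" and "\<delta> > 0"
  shows "\<exists>k B. simple_function M k \<and> k ` space M \<subseteq> I0 \<and> B \<in> sets (completion M) \<and>
    measure (completion M) B < \<delta> \<and> (AE \<omega> in M. \<omega> \<notin> B \<longrightarrow> \<omega> \<in> P (k \<omega>))"
proof -
  interpret C: prob_space "completion M" by (rule prob_space_completion)
  obtain k B where k: "simple_function (completion M) k" "k ` space M \<subseteq> I0" and B: "B \<in> sets (completion M)"
    "measure (completion M) B < \<delta>" and kP: "\<forall>\<omega>\<in>space M - B. \<omega> \<in> P (k \<omega>)"
    using C.simple_selection[OF assms(1,2) P AE_completion[OF cover] \<open>\<delta> > 0\<close>] by auto
  obtain k' where k': "simple_function M k'" and eq: "AE \<omega> in M. k \<omega> = k' \<omega>"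
    using completion_ex_simple_function[OF k(1)] by blast
  obtain i0 where i0: "i0 \<in> I0" using assms(2) by blast
  define q where "q \<omega> = (if k' \<omega> \<in> I0 then k' \<omega> else i0)" for \<omega>
  have "simple_function M q" unfolding q_def by (rule simple_function_compose1[OF k'])
  moreover have "q ` space M \<subseteq> I0" using i0 by (auto simp: q_def)
  moreover have "AE \<omega> in M. \<omega> \<notin> B \<longrightarrow> \<omega> \<in> P (q \<omega>)" using eq AE_space
  proof eventually_elim
    case (elim \<omega>)
    then have "q \<omega> = k \<omega>" using k(2) by (auto simp: q_def)
    then show ?case using kP elim(2) by simp
  qed
  ultimately show ?thesis using B by blast
qed

section \<open>Measurable sections\<close>

locale measurable_structure_field = prob_space \<mu> for \<mu> :: "'w measure" +
  fixes L :: "('s, 'p, 'f) lang" and M :: "'w \<Rightarrow> ('s, 'p, 'f, 'a) aff_struct"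
    and I :: "'i set" and \<sigma> :: "'i \<Rightarrow> 's" and e :: "'i \<Rightarrow> 'w \<Rightarrow> 'a"
  assumes lang: "language L" and field: "measurable_field L \<mu> M I \<sigma> e"
begin

lemma struct: "\<omega> \<in> space \<mu> \<Longrightarrow> is_structure L (M \<omega>)"
  using field[unfolded measurable_field_def, THEN conjunct1] by blast

lemma \<sigma>_sorts: "i \<in> I \<Longrightarrow> \<sigma> i \<in> sorts L"
  and e_univ: "i \<in> I \<Longrightarrow> \<omega> \<in> space \<mu> \<Longrightarrow> e i \<omega> \<in> univ (M \<omega>) (\<sigma> i)"
  using field[unfolded measurable_field_def, THEN conjunct2, THEN conjunct1] by blast+

lemma e_dense: "\<omega> \<in> space \<mu> \<Longrightarrow> s \<in> sorts L \<Longrightarrow>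
    Metric_space.mtopology (univ (M \<omega>) s) (dst (M \<omega>) s) closure_of {e i \<omega> | i. i \<in> I \<and> \<sigma> i = s} = univ (M \<omega>) s"
  using field[unfolded measurable_field_def, THEN conjunct2, THEN conjunct2, THEN conjunct1] by blast

lemma dst_measurable_e: "i \<in> I \<Longrightarrow> j \<in> I \<Longrightarrow> \<sigma> i = \<sigma> j \<Longrightarrow>
    (\<lambda>\<omega>. dst (M \<omega>) (\<sigma> i) (e i \<omega>) (e j \<omega>)) \<in> borel_measurable \<mu>"
  using field[unfolded measurable_field_def, THEN conjunct2, THEN conjunct2, THEN conjunct2, THEN conjunct1] by blast

lemma prd_measurable_e: "P \<in> preds L \<Longrightarrow> set js \<subseteq> I \<Longrightarrow> map \<sigma> js = pdom L P \<Longrightarrow>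
    (\<lambda>\<omega>. prd (M \<omega>) P (map (\<lambda>j. e j \<omega>) js)) \<in> borel_measurable \<mu>"
  using field[unfolded measurable_field_def, THEN conjunct2, THEN conjunct2, THEN conjunct2, THEN conjunct2, THEN conjunct1] by blast

lemma fn_measurable_e: "F \<in> funs L \<Longrightarrow> i \<in> I \<Longrightarrow> set js \<subseteq> I \<Longrightarrow> map \<sigma> js = fdom L F \<Longrightarrow> \<sigma> i = fcod L F \<Longrightarrow>
    (\<lambda>\<omega>. dst (M \<omega>) (fcod L F) (fn (M \<omega>) F (map (\<lambda>j. e j \<omega>) js)) (e i \<omega>)) \<in> borel_measurable \<mu>"
  using field[unfolded measurable_field_def, THEN conjunct2, THEN conjunct2, THEN conjunct2, THEN conjunct2, THEN conjunct2, THEN conjunct1] by blast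

lemma elementary: "sublanguage L0 L \<Longrightarrow> finite_language L0 \<Longrightarrow> countable J \<Longrightarrow> J \<subseteq> I \<Longrightarrow>
    \<exists>I0. countable I0 \<and> J \<subseteq> I0 \<and> I0 \<subseteq> I \<and>
      (AE \<omega> in \<mu>. affine_substructure L0 (generated_sub M \<sigma> e I0 \<omega>) (M \<omega>))"
  using field[unfolded measurable_field_def, THEN conjunct2, THEN conjunct2, THEN conjunct2, THEN conjunct2, THEN conjunct2, THEN conjunct2] by blast

lemma ex_AE: "AE \<omega> in \<mu>. Q \<omega> \<Longrightarrow> \<exists>\<omega>\<in>space \<mu>. Q \<omega>"
proof (rule ccontr)
  assume "AE \<omega> in \<mu>. Q \<omega>" and "\<not> (\<exists>\<omega>\<in>space \<mu>. Q \<omega>)"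
  then have "AE \<omega> in \<mu>. False" using AE_space[of \<mu>] by (auto elim: AE_mp)
  then show False by simp
qed

text \<open>
  Membership in the closure of \<open>{e\<^sub>j(\<omega>) : j \<in> J}\<close>, spelled out with distances.
\<close>

definition adherent :: "'i set \<Rightarrow> 's \<Rightarrow> 'w \<Rightarrow> 'a \<Rightarrow> bool" where
  "adherent J s \<omega> a \<longleftrightarrow> a \<in> univ (M \<omega>) s \<and> (\<forall>r>0. \<exists>j\<in>J. \<sigma> j = s \<and> dst (M \<omega>) s a (e j \<omega>) < r)"

lemma adherent_mono: "adherent J s \<omega> a \<Longrightarrow> J \<subseteq> J' \<Longrightarrow> adherent J' s \<omega> a"
  unfolding adherent_def by blast

lemma closure_of_sections:
  assumes "\<omega> \<in> space \<mu>" "s \<in> sorts L" "J \<subseteq> I"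
  shows "a \<in> Metric_space.mtopology (univ (M \<omega>) s) (dst (M \<omega>) s) closure_of {e i \<omega> | i. i \<in> J \<and> \<sigma> i = s}
    \<longleftrightarrow> adherent J s \<omega> a"
proof -
  interpret Metric_space "univ (M \<omega>) s" "dst (M \<omega>) s"
    using structure_metric[OF struct] assms by blast
  have "e i \<omega> \<in> univ (M \<omega>) (\<sigma> i)" if "i \<in> J" for i using e_univ assms that by blast
  then show ?thesis unfolding metric_closure_of adherent_def in_mball by blast
qed

lemma adherent_I: "\<omega> \<in> space \<mu> \<Longrightarrow> s \<in> sorts L \<Longrightarrow> a \<in> univ (M \<omega>) s \<Longrightarrow> adherent I s \<omega> a"
  using closure_of_sections[of \<omega> s I a] e_dense[of \<omega> s] by auto

lemma univ_generated_sub: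
  "\<omega> \<in> space \<mu> \<Longrightarrow> s \<in> sorts L \<Longrightarrow> J \<subseteq> I \<Longrightarrow> a \<in> univ (generated_sub M \<sigma> e J \<omega>) s \<longleftrightarrow> adherent J s \<omega> a"
  using closure_of_sections[of \<omega> s J a] by (simp add: generated_sub_def)

lemma sort_inhabited: "s \<in> sorts L \<Longrightarrow> \<exists>i\<in>I. \<sigma> i = s"
proof -
  assume s: "s \<in> sorts L"
  obtain \<omega> where \<omega>: "\<omega> \<in> space \<mu>" using not_empty by blast
  obtain a where "a \<in> univ (M \<omega>) s" using structure_univ[OF struct[OF \<omega>] s] by blast
  then have "adherent I s \<omega> a" by (rule adherent_I[OF \<omega> s])
  then show ?thesis unfolding adherent_def using zero_less_one by blast
qed

abbreviation sec :: "'s \<Rightarrow> ('w \<Rightarrow> 'a) \<Rightarrow> bool" where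
  "sec \<equiv> measurable_section \<mu> M I \<sigma> e"

lemma sec_univ: "sec s f \<Longrightarrow> \<omega> \<in> space \<mu> \<Longrightarrow> f \<omega> \<in> univ (M \<omega>) s"
  by (simp add: measurable_section_def)

lemma sec_simple:
  assumes "simple_function \<mu> k" and "k ` space \<mu> \<subseteq> {i\<in>I. \<sigma> i = s}"
  shows "sec s (\<lambda>\<omega>. e (k \<omega>) \<omega>)"
proof -
  have k: "k \<omega> \<in> I" "\<sigma> (k \<omega>) = s" if "\<omega> \<in> space \<mu>" for \<omega> using assms(2) that by auto
  have "dst (M \<omega>) s (e (k \<omega>) \<omega>) (e (k \<omega>) \<omega>) = 0" if "\<omega> \<in> space \<mu>" for \<omega>
    using dst_self[OF struct[OF that] \<sigma>_sorts[OF k(1)[OF that]] e_univ[OF k(1)[OF that] that]] k[OF that] by simp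
  moreover have "e (k \<omega>) \<omega> \<in> univ (M \<omega>) s" if "\<omega> \<in> space \<mu>" for \<omega>
    using e_univ[OF k(1)[OF that] that] k[OF that] by simp
  moreover have "simple_section \<mu> I \<sigma> e s (\<lambda>\<omega>. e (k \<omega>) \<omega>)"
    unfolding simple_section_def using assms by blast
  ultimately show ?thesis unfolding measurable_section_def
    by (intro conjI ballI exI[of _ "\<lambda>_ \<omega>. e (k \<omega>) \<omega>"] allI) auto
qed

lemma sec_e: "i \<in> I \<Longrightarrow> sec (\<sigma> i) (e i)"
  using sec_simple[of "\<lambda>_. i" "\<sigma> i"] by auto

lemma sec_approximations:
  assumes "sec s f"
  shows "\<exists>k :: nat \<Rightarrow> 'w \<Rightarrow> 'i. (\<forall>n. simple_function \<mu> (k n) \<and> k n ` space \<mu> \<subseteq> {i\<in>I. \<sigma> i = s}) \<and>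
    (AE \<omega> in \<mu>. (\<lambda>n. dst (M \<omega>) s (e (k n \<omega>) \<omega>) (f \<omega>)) \<longlonglongrightarrow> 0)"
proof -
  obtain g :: "nat \<Rightarrow> 'w \<Rightarrow> 'a" where g: "\<And>n. simple_section \<mu> I \<sigma> e s (g n)"
    and lim: "AE \<omega> in \<mu>. (\<lambda>n. dst (M \<omega>) s (g n \<omega>) (f \<omega>)) \<longlonglongrightarrow> 0"
    using assms unfolding measurable_section_def by blast
  have "\<exists>k. \<forall>n. simple_function \<mu> (k n) \<and> k n ` space \<mu> \<subseteq> {i\<in>I. \<sigma> i = s} \<and> (\<forall>\<omega>\<in>space \<mu>. g n \<omega> = e (k n \<omega>) \<omega>)"
    using g unfolding simple_section_def by (intro choice) blast
  then obtain k where k: "\<And>n. simple_function \<mu> (k n)" "\<And>n. k n ` space \<mu> \<subseteq> {i\<in>I. \<sigma> i = s}"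
    "\<And>n \<omega>. \<omega> \<in> space \<mu> \<Longrightarrow> g n \<omega> = e (k n \<omega>) \<omega>" by blast
  have "AE \<omega> in \<mu>. (\<lambda>n. dst (M \<omega>) s (e (k n \<omega>) \<omega>) (f \<omega>)) \<longlonglongrightarrow> 0"
    using lim AE_space by eventually_elim (simp add: k(3))
  then show ?thesis using k(1,2) by blast
qed

text \<open>
  Almost everywhere, a measurable section takes its values in the closure of countably many distinguished
  sections. The elementarity condition is applied to countable sets obtained in this way.
\<close>

lemma sec_support:
  assumes f: "sec s f" and s: "s \<in> sorts L"
  shows "\<exists>J. countable J \<and> J \<subseteq> I \<and> (AE \<omega> in \<mu>. adherent J s \<omega> (f \<omega>))"
proof -
  obtain k :: "nat \<Rightarrow> 'w \<Rightarrow> 'i" where k: "\<And>n. simple_function \<mu> (k n)" "\<And>n. k n ` space \<mu> \<subseteq> {i\<in>I. \<sigma> i = s}"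
    and lim: "AE \<omega> in \<mu>. (\<lambda>n. dst (M \<omega>) s (e (k n \<omega>) \<omega>) (f \<omega>)) \<longlonglongrightarrow> 0"
    using sec_approximations[OF f] by blast
  define J where "J = (\<Union>n. k n ` space \<mu>)"
  have "countable J" unfolding J_def using k(1) by (auto simp: simple_function_def intro: countable_finite)
  moreover have "J \<subseteq> I" using k(2) by (auto simp: J_def)
  moreover have "AE \<omega> in \<mu>. adherent J s \<omega> (f \<omega>)" using lim AE_space
  proof eventually_elim
    case (elim \<omega>)
    have "\<exists>j\<in>J. \<sigma> j = s \<and> dst (M \<omega>) s (f \<omega>) (e j \<omega>) < r" if r: "r > 0" for r
    proof -
      obtain n where "dst (M \<omega>) s (e (k n \<omega>) \<omega>) (f \<omega>) < r"
        using order_tendstoD(2)[OF elim(1) r] by (auto simp: eventually_sequentially)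
      then have "dst (M \<omega>) s (f \<omega>) (e (k n \<omega>) \<omega>) < r" by (simp add: dst_commute[OF struct[OF elim(2)] s])
      moreover have "k n \<omega> \<in> J" "\<sigma> (k n \<omega>) = s" using elim(2) k(2)[of n] by (auto simp: J_def)
      ultimately show ?thesis by blast
    qed
    then show ?case unfolding adherent_def by (intro conjI allI impI sec_univ[OF f elim(2)])
  qed
  ultimately show ?thesis by blast
qed

lemma sec_support_finite:
  assumes "finite X" and f: "\<And>x. x \<in> X \<Longrightarrow> sec (srt x) (f x)" "\<And>x. x \<in> X \<Longrightarrow> srt x \<in> sorts L"
  shows "\<exists>J. countable J \<and> J \<subseteq> I \<and> (AE \<omega> in \<mu>. \<forall>x\<in>X. adherent J (srt x) \<omega> (f x \<omega>))"
proof -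
  have "\<exists>J. \<forall>x\<in>X. countable (J x) \<and> J x \<subseteq> I \<and> (AE \<omega> in \<mu>. adherent (J x) (srt x) \<omega> (f x \<omega>))"
  proof (intro bchoice ballI)
    fix x assume x: "x \<in> X"
    show "\<exists>J. countable J \<and> J \<subseteq> I \<and> (AE \<omega> in \<mu>. adherent J (srt x) \<omega> (f x \<omega>))"
      by (rule sec_support[OF f(1)[OF x] f(2)[OF x]])
  qed
  then obtain J where J: "\<forall>x\<in>X. countable (J x) \<and> J x \<subseteq> I \<and> (AE \<omega> in \<mu>. adherent (J x) (srt x) \<omega> (f x \<omega>))"
    by (rule exE)
  have "AE \<omega> in \<mu>. \<forall>x\<in>X. adherent (J x) (srt x) \<omega> (f x \<omega>)"
    by (rule AE_finite_allI[OF assms(1)]) (use J in simp)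
  then have "AE \<omega> in \<mu>. \<forall>x\<in>X. adherent (\<Union>x\<in>X. J x) (srt x) \<omega> (f x \<omega>)"
  proof eventually_elim
    case (elim \<omega>)
    show ?case
    proof
      fix x assume x: "x \<in> X"
      show "adherent (\<Union>x\<in>X. J x) (srt x) \<omega> (f x \<omega>)"
        by (rule adherent_mono[OF bspec[OF elim x]]) (use x in blast)
    qed
  qed
  moreover have "countable (\<Union>x\<in>X. J x)" using assms(1) J by (simp add: countable_finite)
  moreover have "(\<Union>x\<in>X. J x) \<subseteq> I" using J by blast
  ultimately show ?thesis by (intro exI[of _ "\<Union>x\<in>X. J x"] conjI)
qed

text \<open>
  The common pattern behind the measurability of distances, predicates and function values along sections:
  a function that is measurable along tuples of distinguished sections is measurable along tuples
  of simple sections, and continuity passes this on to limits of the latter.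
\<close>

lemma tuple_measurable:
  assumes ss: "set ss \<subseteq> sorts L" and fs: "list_all2 (\<lambda>f s. sec s f) fs ss"
    and \<Phi>: "\<And>js. set js \<subseteq> I \<Longrightarrow> map \<sigma> js = ss \<Longrightarrow> (\<lambda>\<omega>. \<Phi> (map (\<lambda>j. e j \<omega>) js) \<omega>) \<in> borel_measurable \<mu>"
    and cont: "\<And>\<omega> as bs. \<omega> \<in> space \<mu> \<Longrightarrow> (\<And>n. as n \<in> tuples (M \<omega>) ss) \<Longrightarrow> bs \<in> tuples (M \<omega>) ss \<Longrightarrow>
      (\<lambda>n. tdist (M \<omega>) ss (as n) bs) \<longlonglongrightarrow> 0 \<Longrightarrow> (\<lambda>n. \<Phi> (as n) \<omega>) \<longlonglongrightarrow> (\<Phi> bs \<omega> :: real)"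
  shows "(\<lambda>\<omega>. \<Phi> (map (\<lambda>f. f \<omega>) fs) \<omega>) \<in> borel_measurable (completion \<mu>)"
proof -
  define N where "N = length ss"
  have len: "length fs = N" and fs': "\<And>k. k < N \<Longrightarrow> sec (ss ! k) (fs ! k)"
    using fs by (auto simp: N_def list_all2_conv_all_nth)
  have "\<exists>\<kappa>. \<forall>k\<in>{..<N}. (\<forall>n. simple_function \<mu> (\<kappa> k n) \<and> \<kappa> k n ` space \<mu> \<subseteq> {i\<in>I. \<sigma> i = ss ! k}) \<and>
    (AE \<omega> in \<mu>. (\<lambda>n. dst (M \<omega>) (ss ! k) (e (\<kappa> k n \<omega>) \<omega>) ((fs ! k) \<omega>)) \<longlonglongrightarrow> 0)"
  proof (intro bchoice ballI)
    fix k assume "k \<in> {..<N}"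
    then have "k < N" by simp
    from sec_approximations[OF fs'[OF this]]
    show "\<exists>\<kappa>. (\<forall>n. simple_function \<mu> (\<kappa> n) \<and> \<kappa> n ` space \<mu> \<subseteq> {i\<in>I. \<sigma> i = ss ! k}) \<and>
      (AE \<omega> in \<mu>. (\<lambda>n. dst (M \<omega>) (ss ! k) (e (\<kappa> n \<omega>) \<omega>) ((fs ! k) \<omega>)) \<longlonglongrightarrow> 0)" .
  qed
  then obtain \<kappa> :: "nat \<Rightarrow> nat \<Rightarrow> 'w \<Rightarrow> 'i" where
    K: "\<forall>k\<in>{..<N}. (\<forall>n. simple_function \<mu> (\<kappa> k n) \<and> \<kappa> k n ` space \<mu> \<subseteq> {i\<in>I. \<sigma> i = ss ! k}) \<and>
      (AE \<omega> in \<mu>. (\<lambda>n. dst (M \<omega>) (ss ! k) (e (\<kappa> k n \<omega>) \<omega>) ((fs ! k) \<omega>)) \<longlonglongrightarrow> 0)"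
    by (rule exE)
  have \<kappa>: "simple_function \<mu> (\<kappa> k n)" "\<kappa> k n ` space \<mu> \<subseteq> {i\<in>I. \<sigma> i = ss ! k}" if "k < N" for k n
    using bspec[OF K, of k] that by auto
  have lim: "AE \<omega> in \<mu>. (\<lambda>n. dst (M \<omega>) (ss ! k) (e (\<kappa> k n \<omega>) \<omega>) ((fs ! k) \<omega>)) \<longlonglongrightarrow> 0" if "k \<in> {..<N}" for k
    using bspec[OF K that] by blast
  have lim_all: "AE \<omega> in \<mu>. \<forall>k\<in>{..<N}. (\<lambda>n. dst (M \<omega>) (ss ! k) (e (\<kappa> k n \<omega>) \<omega>) ((fs ! k) \<omega>)) \<longlonglongrightarrow> 0"
    by (rule AE_finite_allI[OF finite_lessThan lim])
  define as where "as n \<omega> = map (\<lambda>j. e j \<omega>) (map (\<lambda>k. \<kappa> k n \<omega>) [0..<N])" for n \<omega>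
  have "(\<lambda>\<omega>. \<Phi> (as n \<omega>) \<omega>) \<in> borel_measurable \<mu>" for n
    unfolding as_def
  proof (rule measurable_simple_tuple[where \<Phi> = "\<lambda>js \<omega>. \<Phi> (map (\<lambda>j. e j \<omega>) js) \<omega>"])
    fix js assume js: "length js = N" "\<And>k. k < N \<Longrightarrow> js ! k \<in> \<kappa> k n ` space \<mu>"
    have "js ! k \<in> I \<and> \<sigma> (js ! k) = ss ! k" if "k < N" for k
      using js(2)[OF that] \<kappa>(2)[OF that, of n] by auto
    then show "(\<lambda>\<omega>. \<Phi> (map (\<lambda>j. e j \<omega>) js) \<omega>) \<in> borel_measurable \<mu>"
      using js(1) by (intro \<Phi>) (auto simp: in_set_conv_nth N_def intro!: nth_equalityI)
  qed (rule \<kappa>(1))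
  then have "(\<lambda>\<omega>. \<Phi> (as n \<omega>) \<omega>) \<in> borel_measurable (completion \<mu>)" for n by (rule measurable_completion)
  moreover have "AE \<omega> in \<mu>. (\<lambda>n. \<Phi> (as n \<omega>) \<omega>) \<longlonglongrightarrow> \<Phi> (map (\<lambda>f. f \<omega>) fs) \<omega>"
    using lim_all AE_space
  proof eventually_elim
    case (elim \<omega>)
    show ?case
    proof (rule cont[OF elim(2)])
      show "as n \<omega> \<in> tuples (M \<omega>) ss" for n
        unfolding as_def tuples_def list_all2_conv_all_nth
      proof (simp add: N_def[symmetric], intro allI impI)
        fix k assume k: "k < N"
        then have "\<kappa> k n \<omega> \<in> I" "\<sigma> (\<kappa> k n \<omega>) = ss ! k" using \<kappa>(2)[OF k, of n] elim(2) by auto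
        then show "e (\<kappa> k n \<omega>) \<omega> \<in> univ (M \<omega>) (ss ! k)" using e_univ[of "\<kappa> k n \<omega>" \<omega>] elim(2) by simp
      qed
      show "map (\<lambda>f. f \<omega>) fs \<in> tuples (M \<omega>) ss"
        using fs' len sec_univ[OF _ elim(2)] by (simp add: tuples_def list_all2_conv_all_nth N_def)
      have "(\<lambda>n. \<Sum>k<N. dst (M \<omega>) (ss ! k) (e (\<kappa> k n \<omega>) \<omega>) ((fs ! k) \<omega>)) \<longlonglongrightarrow> (\<Sum>k<N. 0)"
        using elim(1) by (intro tendsto_sum) auto
      then show "(\<lambda>n. tdist (M \<omega>) ss (as n \<omega>) (map (\<lambda>f. f \<omega>) fs)) \<longlonglongrightarrow> 0"
        by (simp add: tdist_def as_def len N_def[symmetric])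
    qed
  qed
  ultimately show ?thesis by (rule borel_measurable_completion_AE_limit)
qed

lemma dst_measurable:
  assumes s: "s \<in> sorts L" and f: "sec s f" and g: "sec s g"
  shows "(\<lambda>\<omega>. dst (M \<omega>) s (f \<omega>) (g \<omega>)) \<in> borel_measurable (completion \<mu>)"
proof -
  have "(\<lambda>\<omega>. (\<lambda>as \<omega>. dst (M \<omega>) s (as ! 0) (as ! 1)) (map (\<lambda>f. f \<omega>) [f, g]) \<omega>) \<in> borel_measurable (completion \<mu>)"
  proof (rule tuple_measurable[where ss = "[s, s]"])
    show "set [s, s] \<subseteq> sorts L" using s by simp
    show "list_all2 (\<lambda>f s. sec s f) [f, g] [s, s]" using f g by simp
  next
    fix js assume js: "set js \<subseteq> I" "map \<sigma> js = [s, s]"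
    then obtain i j where ij: "js = [i, j]" by (auto simp: map_eq_Cons_conv)
    then show "(\<lambda>\<omega>. dst (M \<omega>) s (map (\<lambda>j. e j \<omega>) js ! 0) (map (\<lambda>j. e j \<omega>) js ! 1)) \<in> borel_measurable \<mu>"
      using js dst_measurable_e[of i j] by simp
  next
    fix \<omega> as bs
    assume \<omega>: "\<omega> \<in> space \<mu>" and as: "\<And>n. as n \<in> tuples (M \<omega>) [s, s]" and bs: "bs \<in> tuples (M \<omega>) [s, s]"
      and lim: "(\<lambda>n. tdist (M \<omega>) [s, s] (as n) bs) \<longlonglongrightarrow> 0"
    have in_univ: "{as n ! 0, bs ! 0, as n ! 1, bs ! 1} \<subseteq> univ (M \<omega>) s" for n
      using as[of n] bs by (auto simp: tuples_def list_all2_conv_all_nth dest: spec[of _ 0] spec[of _ 1])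
    have "(\<lambda>n. dst (M \<omega>) s (as n ! 0) (as n ! 1) - dst (M \<omega>) s (bs ! 0) (bs ! 1)) \<longlonglongrightarrow> 0"
      using lim
    proof (rule tendsto_zero_le)
      show "\<forall>\<^sub>F n in sequentially. \<bar>dst (M \<omega>) s (as n ! 0) (as n ! 1) - dst (M \<omega>) s (bs ! 0) (bs ! 1)\<bar>
          \<le> tdist (M \<omega>) [s, s] (as n) bs"
        using dst_diff_le[OF struct[OF \<omega>] s in_univ]
        by (intro always_eventually allI) (simp add: tdist_def numeral_2_eq_2)
    qed
    then show "(\<lambda>n. dst (M \<omega>) s (as n ! 0) (as n ! 1)) \<longlonglongrightarrow> dst (M \<omega>) s (bs ! 0) (bs ! 1)"
      by (rule LIM_zero_cancel)
  qed
  then show ?thesis by simp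
qed

lemma prd_measurable:
  assumes P: "P \<in> preds L" and fs: "list_all2 (\<lambda>f s. sec s f) fs (pdom L P)"
  shows "(\<lambda>\<omega>. prd (M \<omega>) P (map (\<lambda>f. f \<omega>) fs)) \<in> borel_measurable (completion \<mu>)"
proof (rule tuple_measurable[where \<Phi> = "\<lambda>as \<omega>. prd (M \<omega>) P as", OF _ fs])
  show "set (pdom L P) \<subseteq> sorts L" using lang P by (simp add: language_def)
  show "(\<lambda>\<omega>. prd (M \<omega>) P (map (\<lambda>j. e j \<omega>) js)) \<in> borel_measurable \<mu>"
    if "set js \<subseteq> I" "map \<sigma> js = pdom L P" for js using prd_measurable_e[OF P that] .
  fix \<omega> as bs
  assume \<omega>: "\<omega> \<in> space \<mu>" and as: "\<And>n. as n \<in> tuples (M \<omega>) (pdom L P)" and bs: "bs \<in> tuples (M \<omega>) (pdom L P)"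
    and lim: "(\<lambda>n. tdist (M \<omega>) (pdom L P) (as n) bs) \<longlonglongrightarrow> 0"
  have "(\<lambda>n. prd (M \<omega>) P (as n) - prd (M \<omega>) P bs) \<longlonglongrightarrow> 0"
    by (rule prd_tendsto[OF lang struct[OF \<omega>] P _ lim]) (simp add: as bs)
  then show "(\<lambda>n. prd (M \<omega>) P (as n)) \<longlonglongrightarrow> prd (M \<omega>) P bs" by (rule LIM_zero_cancel)
qed

lemma fn_dst_measurable:
  assumes F: "F \<in> funs L" and fs: "list_all2 (\<lambda>f s. sec s f) fs (fdom L F)" and i: "i \<in> I" "\<sigma> i = fcod L F"
  shows "(\<lambda>\<omega>. dst (M \<omega>) (fcod L F) (fn (M \<omega>) F (map (\<lambda>f. f \<omega>) fs)) (e i \<omega>)) \<in> borel_measurable (completion \<mu>)"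
proof (rule tuple_measurable[where \<Phi> = "\<lambda>as \<omega>. dst (M \<omega>) (fcod L F) (fn (M \<omega>) F as) (e i \<omega>)", OF _ fs])
  have s: "fcod L F \<in> sorts L" using lang F by (simp add: language_def)
  show "set (fdom L F) \<subseteq> sorts L" using lang F by (simp add: language_def)
  show "(\<lambda>\<omega>. dst (M \<omega>) (fcod L F) (fn (M \<omega>) F (map (\<lambda>j. e j \<omega>) js)) (e i \<omega>)) \<in> borel_measurable \<mu>"
    if "set js \<subseteq> I" "map \<sigma> js = fdom L F" for js using fn_measurable_e[OF F i(1) that i(2)] .
  fix \<omega> as bs
  assume \<omega>: "\<omega> \<in> space \<mu>" and as: "\<And>n. as n \<in> tuples (M \<omega>) (fdom L F)" and bs: "bs \<in> tuples (M \<omega>) (fdom L F)"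
    and lim: "(\<lambda>n. tdist (M \<omega>) (fdom L F) (as n) bs) \<longlonglongrightarrow> 0"
  let ?s = "fcod L F"
  have e: "e i \<omega> \<in> univ (M \<omega>) ?s" using e_univ[OF i(1) \<omega>] i(2) by simp
  have "(\<lambda>n. dst (M \<omega>) ?s (fn (M \<omega>) F (as n)) (fn (M \<omega>) F bs)) \<longlonglongrightarrow> 0"
    by (rule fn_tendsto[OF lang struct[OF \<omega>] F _ lim]) (simp add: as bs)
  then have "(\<lambda>n. dst (M \<omega>) ?s (fn (M \<omega>) F (as n)) (e i \<omega>) - dst (M \<omega>) ?s (fn (M \<omega>) F bs) (e i \<omega>)) \<longlonglongrightarrow> 0"
  proof (rule tendsto_zero_le)
    have "{fn (M \<omega>) F (as n), fn (M \<omega>) F bs, e i \<omega>, e i \<omega>} \<subseteq> univ (M \<omega>) ?s" for n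
      using structure_fn[OF struct[OF \<omega>] F] as bs e by auto
    from dst_diff_le[OF struct[OF \<omega>] s this]
    show "\<forall>\<^sub>F n in sequentially. \<bar>dst (M \<omega>) ?s (fn (M \<omega>) F (as n)) (e i \<omega>) - dst (M \<omega>) ?s (fn (M \<omega>) F bs) (e i \<omega>)\<bar>
        \<le> dst (M \<omega>) ?s (fn (M \<omega>) F (as n)) (fn (M \<omega>) F bs)"
      by (intro always_eventually allI) (simp add: dst_self[OF struct[OF \<omega>] s e])
  qed
  then show "(\<lambda>n. dst (M \<omega>) ?s (fn (M \<omega>) F (as n)) (e i \<omega>)) \<longlonglongrightarrow> dst (M \<omega>) ?s (fn (M \<omega>) F bs) (e i \<omega>)"
    by (rule LIM_zero_cancel)
qed

text \<open>
  A converse of the approximation by simple sections. For each \<open>n\<close> a simple section is chosen that is within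
  \<open>1/(n+1)\<close> of \<open>g\<close> outside a set of measure less than \<open>2\<^sup>-\<^sup>n\<close>; by the Borel--Cantelli lemma these
  sections converge to \<open>g\<close> almost everywhere.
\<close>

lemma sectionI:
  assumes s: "s \<in> sorts L" and g: "\<And>\<omega>. \<omega> \<in> space \<mu> \<Longrightarrow> g \<omega> \<in> univ (M \<omega>) s"
    and J: "countable J" "J \<subseteq> I" and adh: "AE \<omega> in \<mu>. adherent J s \<omega> (g \<omega>)"
    and meas: "\<And>j. j \<in> J \<Longrightarrow> \<sigma> j = s \<Longrightarrow> (\<lambda>\<omega>. dst (M \<omega>) s (g \<omega>) (e j \<omega>)) \<in> borel_measurable (completion \<mu>)"
  shows "sec s g"
proof -
  interpret C: prob_space "completion \<mu>" by (rule prob_space_completion)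
  define J' where "J' = {j\<in>J. \<sigma> j = s}"
  have J': "countable J'" "J' \<subseteq> I" using J by (auto simp: J'_def intro: countable_subset)
  obtain \<omega>0 where "adherent J s \<omega>0 (g \<omega>0)" using ex_AE[OF adh] by blast
  then have "\<exists>j\<in>J. \<sigma> j = s \<and> dst (M \<omega>0) s (g \<omega>0) (e j \<omega>0) < 1" unfolding adherent_def by simp
  then have "J' \<noteq> {}" by (auto simp: J'_def)
  define P where "P n j = {\<omega>\<in>space \<mu>. dst (M \<omega>) s (g \<omega>) (e j \<omega>) < 1 / real (Suc n)}" for n :: nat and j
  have "\<exists>k B. simple_function \<mu> k \<and> k ` space \<mu> \<subseteq> J' \<and> B \<in> sets (completion \<mu>) \<and>
    measure (completion \<mu>) B < (1/2)^n \<and> (AE \<omega> in \<mu>. \<omega> \<notin> B \<longrightarrow> \<omega> \<in> P n (k \<omega>))" for n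
  proof (rule simple_selection_completion[OF J'(1) \<open>J' \<noteq> {}\<close>])
    fix j assume "j \<in> J'"
    then have [measurable]: "(\<lambda>\<omega>. dst (M \<omega>) s (g \<omega>) (e j \<omega>)) \<in> borel_measurable (completion \<mu>)"
      using meas by (simp add: J'_def)
    have "{\<omega>\<in>space (completion \<mu>). dst (M \<omega>) s (g \<omega>) (e j \<omega>) < 1 / real (Suc n)} \<in> sets (completion \<mu>)"
      by measurable
    then show "P n j \<in> sets (completion \<mu>)" by (simp add: P_def)
  next
    show "AE \<omega> in \<mu>. \<exists>j\<in>J'. \<omega> \<in> P n j" using adh AE_space
    proof eventually_elim
      case (elim \<omega>)
      have "\<exists>j\<in>J. \<sigma> j = s \<and> dst (M \<omega>) s (g \<omega>) (e j \<omega>) < 1 / real (Suc n)"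
        using elim(1) unfolding adherent_def by simp
      then show ?case using elim(2) by (auto simp: J'_def P_def)
    qed
  qed simp
  then have "\<exists>k. \<forall>n. \<exists>B. simple_function \<mu> (k n) \<and> k n ` space \<mu> \<subseteq> J' \<and> B \<in> sets (completion \<mu>) \<and>
    measure (completion \<mu>) B < (1/2)^n \<and> (AE \<omega> in \<mu>. \<omega> \<notin> B \<longrightarrow> \<omega> \<in> P n (k n \<omega>))" by (intro choice allI)
  then obtain k where "\<forall>n. \<exists>B. simple_function \<mu> (k n) \<and> k n ` space \<mu> \<subseteq> J' \<and> B \<in> sets (completion \<mu>) \<and>
    measure (completion \<mu>) B < (1/2)^n \<and> (AE \<omega> in \<mu>. \<omega> \<notin> B \<longrightarrow> \<omega> \<in> P n (k n \<omega>))" by (rule exE)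
  then have "\<exists>B. \<forall>n. simple_function \<mu> (k n) \<and> k n ` space \<mu> \<subseteq> J' \<and> B n \<in> sets (completion \<mu>) \<and>
    measure (completion \<mu>) (B n) < (1/2)^n \<and> (AE \<omega> in \<mu>. \<omega> \<notin> B n \<longrightarrow> \<omega> \<in> P n (k n \<omega>))" by (rule choice)
  then obtain B where kB: "\<forall>n. simple_function \<mu> (k n) \<and> k n ` space \<mu> \<subseteq> J' \<and> B n \<in> sets (completion \<mu>) \<and>
    measure (completion \<mu>) (B n) < (1/2)^n \<and> (AE \<omega> in \<mu>. \<omega> \<notin> B n \<longrightarrow> \<omega> \<in> P n (k n \<omega>))" by (rule exE)
  have "AE \<omega> in completion \<mu>. eventually (\<lambda>n. \<omega> \<in> space (completion \<mu>) - B n) sequentially"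
  proof (rule borel_cantelli_AE1)
    show "B n \<in> sets (completion \<mu>)" for n using kB by blast
    show "emeasure (completion \<mu>) (B n) < \<infinity>" for n
      by (simp add: C.emeasure_eq_measure del: emeasure_completion)
    show "summable (\<lambda>n. measure (completion \<mu>) (B n))"
    proof (rule summable_comparison_test)
      show "\<exists>N. \<forall>n\<ge>N. norm (measure (completion \<mu>) (B n)) \<le> (1/2)^n" using kB by (auto intro: less_imp_le)
      show "summable (\<lambda>n. (1/2::real)^n)" by (rule summable_geometric) simp
    qed
  qed
  then have ev: "AE \<omega> in \<mu>. eventually (\<lambda>n. \<omega> \<notin> B n) sequentially"
    unfolding AE_completion_iff by eventually_elim (auto elim: eventually_mono)
  have good: "AE \<omega> in \<mu>. \<forall>n. \<omega> \<notin> B n \<longrightarrow> \<omega> \<in> P n (k n \<omega>)"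
    unfolding AE_all_countable using kB by blast
  have "AE \<omega> in \<mu>. (\<lambda>n. dst (M \<omega>) s (e (k n \<omega>) \<omega>) (g \<omega>)) \<longlonglongrightarrow> 0" using ev good AE_space
  proof eventually_elim
    case (elim \<omega>)
    note \<omega> = elim(3)
    show ?case
    proof (rule tendsto_zero_le)
      show "(\<lambda>n. 1 / real (Suc n)) \<longlonglongrightarrow> 0" by (rule LIMSEQ_Suc[OF lim_1_over_n])
      show "\<forall>\<^sub>F n in sequentially. \<bar>dst (M \<omega>) s (e (k n \<omega>) \<omega>) (g \<omega>)\<bar> \<le> 1 / real (Suc n)"
        using elim(1)
      proof eventually_elim
        case (elim n)
        then have "\<omega> \<in> P n (k n \<omega>)" using \<open>\<forall>n. \<omega> \<notin> B n \<longrightarrow> \<omega> \<in> P n (k n \<omega>)\<close> by blast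
        then show ?case
          using dst_nonneg[OF struct[OF \<omega>] s] dst_commute[OF struct[OF \<omega>] s] by (simp add: P_def)
      qed
    qed
  qed
  moreover have "simple_section \<mu> I \<sigma> e s (\<lambda>\<omega>. e (k n \<omega>) \<omega>)" for n
  proof -
    have "k n ` space \<mu> \<subseteq> {i\<in>I. \<sigma> i = s}" using kB J'(2) by (fastforce simp: J'_def)
    then show ?thesis unfolding simple_section_def using kB by blast
  qed
  ultimately show ?thesis unfolding measurable_section_def using g
    by (intro conjI ballI exI[of _ "\<lambda>n \<omega>. e (k n \<omega>) \<omega>"] allI)
qed

lemma sections_in_tuples:
  "list_all2 (\<lambda>f s. sec s f) fs ss \<Longrightarrow> \<omega> \<in> space \<mu> \<Longrightarrow> map (\<lambda>f. f \<omega>) fs \<in> tuples (M \<omega>) ss"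
  unfolding tuples_def by (auto simp: list_all2_map1 sec_univ elim: list_all2_mono)

text \<open>
  Measurable sections are closed under function symbols. A countable set of distinguished sections supports
  the arguments; enlarging it so as to generate substructures for the language with the single function symbol \<open>F\<close>
  makes it support the value as well.
\<close>

lemma fn_section:
  assumes F: "F \<in> funs L" and fs: "list_all2 (\<lambda>f s. sec s f) fs (fdom L F)"
  shows "sec (fcod L F) (\<lambda>\<omega>. fn (M \<omega>) F (map (\<lambda>f. f \<omega>) fs))"
proof -
  have sorts: "fcod L F \<in> sorts L" "set (fdom L F) \<subseteq> sorts L" using lang F by (auto simp: language_def)
  have len: "length fs = length (fdom L F)" using fs by (rule list_all2_lengthD)
  obtain J where J: "countable J" "J \<subseteq> I"
    and adh: "AE \<omega> in \<mu>. \<forall>k\<in>{..<length fs}. adherent J (fdom L F ! k) \<omega> ((fs ! k) \<omega>)"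
  proof -
    have "\<exists>J. countable J \<and> J \<subseteq> I \<and> (AE \<omega> in \<mu>. \<forall>k\<in>{..<length fs}. adherent J (fdom L F ! k) \<omega> ((fs ! k) \<omega>))"
    proof (rule sec_support_finite)
      show "sec (fdom L F ! k) (fs ! k)" "fdom L F ! k \<in> sorts L" if "k \<in> {..<length fs}" for k
        using that fs sorts len by (auto simp: list_all2_conv_all_nth)
    qed simp
    then show thesis using that by blast
  qed
  obtain S where S: "fcod L F \<in> S" "S \<subseteq> sorts L" "sublanguage (restrict_lang L S {} {F}) L"
      "finite_language (restrict_lang L S {} {F})"
    using finite_sublanguage[OF lang, of "{fcod L F}" "{}" "{F}"] sorts F by auto
  let ?L0 = "restrict_lang L S {} {F}"
  obtain I0 where I0: "countable I0" "J \<subseteq> I0" "I0 \<subseteq> I"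
    and sub: "AE \<omega> in \<mu>. affine_substructure ?L0 (generated_sub M \<sigma> e I0 \<omega>) (M \<omega>)"
    using elementary[OF S(3,4) J] by blast
  have fn_univ: "fn (M \<omega>) F (map (\<lambda>f. f \<omega>) fs) \<in> univ (M \<omega>) (fcod L F)" if "\<omega> \<in> space \<mu>" for \<omega>
    by (rule structure_fn[OF struct[OF that] F sections_in_tuples[OF fs that]])
  show ?thesis
  proof (rule sectionI[OF sorts(1) fn_univ I0(1,3)])
    show "AE \<omega> in \<mu>. adherent I0 (fcod L F) \<omega> (fn (M \<omega>) F (map (\<lambda>f. f \<omega>) fs))"
      using sub adh AE_space
    proof eventually_elim
      case (elim \<omega>)
      let ?G = "generated_sub M \<sigma> e I0 \<omega>"
      have G: "is_structure ?L0 ?G" using elim(1) by (simp add: affine_substructure_def substructure_def)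
      have "(fs ! k) \<omega> \<in> univ ?G (fdom L F ! k)" if "k < length fs" for k
        using elim(2) that adherent_mono[OF _ I0(2)] univ_generated_sub[OF elim(3) _ I0(3)] sorts(2) len
        by (simp add: subset_iff)
      then have "map (\<lambda>f. f \<omega>) fs \<in> tuples ?G (fdom ?L0 F)"
        using len by (simp add: tuples_def list_all2_conv_all_nth)
      then have "fn ?G F (map (\<lambda>f. f \<omega>) fs) \<in> univ ?G (fcod ?L0 F)"
        by (intro structure_fn[OF G]) simp_all
      then have "fn (M \<omega>) F (map (\<lambda>f. f \<omega>) fs) \<in> univ ?G (fcod L F)" by (simp add: generated_sub_def)
      then show ?case using univ_generated_sub[OF elim(3) sorts(1) I0(3)] by blast
    qed
    show "(\<lambda>\<omega>. dst (M \<omega>) (fcod L F) (fn (M \<omega>) F (map (\<lambda>f. f \<omega>) fs)) (e j \<omega>)) \<in> borel_measurable (completion \<mu>)"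
      if "j \<in> I0" "\<sigma> j = fcod L F" for j
      using fn_dst_measurable[OF F fs _ that(2)] that(1) I0(3) by blast
  qed
qed

lemma map_sections: "(\<And>t. t \<in> set ts \<Longrightarrow> sec (srt t) (h t)) \<Longrightarrow> list_all2 (\<lambda>f s. sec s f) (map h ts) (map srt ts)"
  by (induction ts) auto

section \<open>Formulas along measurable sections\<close>

definition section_assignment :: "('s var \<Rightarrow> 'w \<Rightarrow> 'a) \<Rightarrow> bool" where
  "section_assignment V \<longleftrightarrow> (\<forall>x. fst x \<in> sorts L \<longrightarrow> sec (fst x) (V x))"

lemma section_assignment_upd: "section_assignment V \<Longrightarrow> sec (fst x) f \<Longrightarrow> section_assignment (V(x := f))"
  by (auto simp: section_assignment_def)

lemma section_assignment_pointwise: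
  "section_assignment V \<Longrightarrow> \<omega> \<in> space \<mu> \<Longrightarrow> assignment L (M \<omega>) (\<lambda>x. V x \<omega>)"
  by (simp add: section_assignment_def assignment_def sec_univ)

lemma trm_section:
  assumes "section_assignment V"
  shows "wf_trm L t \<Longrightarrow> sec (trm_sort L t) (\<lambda>\<omega>. trm_val (M \<omega>) (\<lambda>x. V x \<omega>) t)"
proof (induction t)
  case (Var x)
  then show ?case using assms by (simp add: section_assignment_def)
next
  case (App F ts)
  let ?fs = "map (\<lambda>t \<omega>. trm_val (M \<omega>) (\<lambda>x. V x \<omega>) t) ts"
  have F: "F \<in> funs L" and ts: "map (trm_sort L) ts = fdom L F" using App.prems by auto
  have "list_all2 (\<lambda>f s. sec s f) ?fs (map (trm_sort L) ts)"
    by (rule map_sections) (use App in \<open>simp add: list_all_iff\<close>)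
  then have "sec (fcod L F) (\<lambda>\<omega>. fn (M \<omega>) F (map (\<lambda>f. f \<omega>) ?fs))"
    unfolding ts by (rule fn_section[OF F])
  then show ?case by (simp add: comp_def)
qed

text \<open>
  The supremum over the whole sort may be computed over countably many distinguished sections, the same
  for almost every \<open>\<omega>\<close>. Choose \<open>I\<^sub>0\<close> such that the generated substructure contains
  the values of the parameters and is elementary for the finite language of the formula: the supremum in \<open>M\<^sub>\<omega>\<close>
  then equals the one over the substructure, and by uniform continuity the one over its dense subset
  \<open>{e\<^sub>i(\<omega>) : i \<in> I\<^sub>0}\<close>.
\<close>

lemma QSup_countable:
  assumes \<phi>: "affine_formula L \<phi>" and x: "fst x \<in> sorts L" and V: "section_assignment V"
  shows "\<exists>J. countable J \<and> J \<noteq> {} \<and> J \<subseteq> {i\<in>I. \<sigma> i = fst x} \<and> (AE \<omega> in \<mu>. val (M \<omega>) (QSup x \<phi>) (\<lambda>y. V y \<omega>) =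
    (SUP i\<in>J. val (M \<omega>) \<phi> (\<lambda>y. (V(x := e i)) y \<omega>)))"
proof -
  let ?\<psi> = "QSup x \<phi>"
  have \<psi>: "affine_formula L ?\<psi>" using \<phi> x by simp
  obtain i0 where i0: "i0 \<in> I" "\<sigma> i0 = fst x" using sort_inhabited[OF x] by blast
  obtain J where J: "countable J" "J \<subseteq> I"
    and adh: "AE \<omega> in \<mu>. \<forall>y\<in>free_vars \<phi>. adherent J (fst y) \<omega> (V y \<omega>)"
  proof -
    have "\<exists>J. countable J \<and> J \<subseteq> I \<and> (AE \<omega> in \<mu>. \<forall>y\<in>free_vars \<phi>. adherent J (fst y) \<omega> (V y \<omega>))"
      using V free_vars_sorts[OF \<phi>]
      by (intro sec_support_finite finite_free_vars) (auto simp: section_assignment_def)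
    then show thesis using that by blast
  qed
  obtain S where S: "fml_sorts ?\<psi> \<subseteq> S" "S \<subseteq> sorts L" "sublanguage (restrict_lang L S (fml_preds ?\<psi>) (fml_funs ?\<psi>)) L"
      "finite_language (restrict_lang L S (fml_preds ?\<psi>) (fml_funs ?\<psi>))"
    using finite_sublanguage[OF lang, of "fml_sorts ?\<psi>" "fml_preds ?\<psi>" "fml_funs ?\<psi>"]
      fml_symbols_subset[OF \<psi>] finite_fml_symbols[of ?\<psi>] by blast
  define L0 where "L0 = restrict_lang L S (fml_preds ?\<psi>) (fml_funs ?\<psi>)"
  have \<psi>0: "affine_formula L0 ?\<psi>"
    unfolding L0_def using \<psi> S(1) by (intro affine_formula_restrict) auto
  then have \<phi>0: "affine_formula L0 \<phi>" by simp
  have sorts0: "s \<in> sorts L" if "s \<in> sorts L0" for s using that S(2) by (auto simp: L0_def)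
  obtain I0 where I0: "countable I0" "insert i0 J \<subseteq> I0" "I0 \<subseteq> I"
    and sub: "AE \<omega> in \<mu>. affine_substructure L0 (generated_sub M \<sigma> e I0 \<omega>) (M \<omega>)"
    using elementary[OF S(3,4), of "insert i0 J"] J i0(1) unfolding L0_def by blast
  define J' where "J' = {i\<in>I0. \<sigma> i = fst x}"
  have J': "countable J'" "J' \<noteq> {}" "J' \<subseteq> {i\<in>I. \<sigma> i = fst x}"
    using I0 i0 by (auto simp: J'_def intro: countable_subset)
  obtain B where B: "\<And>N v. is_structure L N \<Longrightarrow> assignment L N v \<Longrightarrow> \<bar>val (N :: ('s, 'p, 'f, 'a) aff_struct) \<phi> v\<bar> \<le> B"
    using val_bounded[OF \<phi>] by blast
  have "AE \<omega> in \<mu>. val (M \<omega>) ?\<psi> (\<lambda>y. V y \<omega>) = (SUP i\<in>J'. val (M \<omega>) \<phi> (\<lambda>y. (V(x := e i)) y \<omega>))"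
    using sub adh AE_space
  proof eventually_elim
    case (elim \<omega>)
    note str = struct[OF elim(3)]
    let ?G = "generated_sub M \<sigma> e I0 \<omega>" and ?v = "\<lambda>y. V y \<omega>"
    have v: "assignment L (M \<omega>) ?v" by (rule section_assignment_pointwise[OF V elim(3)])
    have G_iff: "a \<in> univ ?G s \<longleftrightarrow> adherent I0 s \<omega> a" if "s \<in> sorts L" for a s
      by (rule univ_generated_sub[OF elim(3) that I0(3)])
    have vG: "?v y \<in> univ ?G (fst y)" if "y \<in> free_vars \<phi>" for y
    proof -
      have "adherent I0 (fst y) \<omega> (V y \<omega>)" using elim(2) that I0(2) by (auto intro: adherent_mono)
      then show ?thesis using G_iff free_vars_sorts[OF \<phi> that] by blast
    qed
    \<comment> \<open>Elementarity is stated for tuples indexed by the free variables, and assignments are restricted to these.\<close>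
    have transfer: "val ?G \<theta> u = val (M \<omega>) \<theta> u"
      if "affine_formula L0 \<theta>" "\<And>y. y \<in> free_vars \<theta> \<Longrightarrow> u y \<in> univ ?G (fst y)" for \<theta> u
    proof -
      have "restrict u (free_vars \<theta>) \<in> tuples_on ?G (free_vars \<theta>)" using that(2) by (auto simp: tuples_on_def)
      then have "val ?G \<theta> (restrict u (free_vars \<theta>)) = val (M \<omega>) \<theta> (restrict u (free_vars \<theta>))"
        using elim(1) that(1) unfolding affine_substructure_def by blast
      moreover have "val N \<theta> (restrict u (free_vars \<theta>)) = val N \<theta> u" for N :: "('s, 'p, 'f, 'a) aff_struct"
        by (rule val_cong) simp
      ultimately show ?thesis by simp
    qed
    have "val (M \<omega>) ?\<psi> ?v = val ?G ?\<psi> ?v"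
      by (rule transfer[symmetric, OF \<psi>0]) (use vG in simp)
    also have "\<dots> = (SUP a\<in>univ ?G (fst x). val ?G \<phi> (?v(x := a)))" by simp
    also have "\<dots> = (SUP a\<in>univ ?G (fst x). val (M \<omega>) \<phi> (?v(x := a)))"
      by (intro SUP_cong refl transfer[OF \<phi>0]) (use vG in auto)
    also have "\<dots> = (SUP i\<in>J'. val (M \<omega>) \<phi> (?v(x := e i \<omega>)))"
    proof (rule antisym)
      have in_univ: "a \<in> univ (M \<omega>) (fst x)" if "a \<in> univ ?G (fst x)" for a
        using that G_iff[OF x] by (simp add: adherent_def)
      have eG: "e i \<omega> \<in> univ ?G (fst x)" if "i \<in> J'" for i
      proof -
        have i: "i \<in> I" "i \<in> I0" "\<sigma> i = fst x" using that I0(3) by (auto simp: J'_def)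
        have eu: "e i \<omega> \<in> univ (M \<omega>) (fst x)" using e_univ[OF i(1) elim(3)] i(3) by simp
        then have "adherent I0 (fst x) \<omega> (e i \<omega>)"
          unfolding adherent_def using i dst_self[OF str x eu] by auto
        then show ?thesis using G_iff[OF x] by blast
      qed
      have bd: "\<bar>val (M \<omega>) \<phi> (?v(x := a))\<bar> \<le> B" if "a \<in> univ (M \<omega>) (fst x)" for a
        by (rule B[OF str assignment_upd[OF v that]])
      have bdd1: "bdd_above ((\<lambda>a. val (M \<omega>) \<phi> (?v(x := a))) ` univ ?G (fst x))"
        using bd in_univ by (intro bdd_aboveI[of _ B]) (auto simp: abs_le_iff)
      have bdd2: "bdd_above ((\<lambda>i. val (M \<omega>) \<phi> (?v(x := e i \<omega>))) ` J')"
        using bd in_univ eG by (intro bdd_aboveI[of _ B]) (auto simp: abs_le_iff)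
      show "(SUP i\<in>J'. val (M \<omega>) \<phi> (?v(x := e i \<omega>))) \<le> (SUP a\<in>univ ?G (fst x). val (M \<omega>) \<phi> (?v(x := a)))"
        by (rule cSUP_least[OF J'(2)]) (rule cSUP_upper[OF eG bdd1])
      have ne: "univ ?G (fst x) \<noteq> {}" using eG J'(2) by blast
      show "(SUP a\<in>univ ?G (fst x). val (M \<omega>) \<phi> (?v(x := a))) \<le> (SUP i\<in>J'. val (M \<omega>) \<phi> (?v(x := e i \<omega>)))"
      proof (rule cSUP_least[OF ne])
        fix a assume a: "a \<in> univ ?G (fst x)"
        show "val (M \<omega>) \<phi> (?v(x := a)) \<le> (SUP i\<in>J'. val (M \<omega>) \<phi> (?v(x := e i \<omega>)))"
        proof (rule field_le_epsilon)
          fix \<epsilon> :: real assume "\<epsilon> > 0"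
          from tendstoD[OF val_uniform[OF lang str x \<phi>] this]
          obtain \<delta> where \<delta>: "\<delta> > 0" "\<And>u a b. assignment L (M \<omega>) u \<Longrightarrow> a \<in> univ (M \<omega>) (fst x) \<Longrightarrow>
            b \<in> univ (M \<omega>) (fst x) \<Longrightarrow> dst (M \<omega>) (fst x) a b < \<delta> \<Longrightarrow>
            \<bar>val (M \<omega>) \<phi> (u(x := a)) - val (M \<omega>) \<phi> (u(x := b))\<bar> < \<epsilon>"
            unfolding eventually_close dist_real_def by auto
          obtain i where i: "i \<in> J'" "dst (M \<omega>) (fst x) a (e i \<omega>) < \<delta>"
            using a \<delta>(1) unfolding G_iff[OF x] adherent_def J'_def by blast
          have "\<bar>val (M \<omega>) \<phi> (?v(x := a)) - val (M \<omega>) \<phi> (?v(x := e i \<omega>))\<bar> < \<epsilon>"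
            by (rule \<delta>(2)[OF v in_univ[OF a] in_univ[OF eG[OF i(1)]] i(2)])
          then show "val (M \<omega>) \<phi> (?v(x := a)) \<le> (SUP i\<in>J'. val (M \<omega>) \<phi> (?v(x := e i \<omega>))) + \<epsilon>"
            using cSUP_upper[OF i(1) bdd2] by linarith
        qed
      qed
    qed
    also have "\<dots> = (SUP i\<in>J'. val (M \<omega>) \<phi> (\<lambda>y. (V(x := e i)) y \<omega>))"
      by (intro SUP_cong refl arg_cong[where f = "val (M \<omega>) \<phi>"]) (simp add: fun_eq_iff)
    finally show ?case .
  qed
  with J' show ?thesis by blast
qed

lemma QSup_measurable:
  assumes \<phi>: "affine_formula L \<phi>" and x: "fst x \<in> sorts L" and V: "section_assignment V"
    and meas: "\<And>V. section_assignment V \<Longrightarrow> (\<lambda>\<omega>. val (M \<omega>) \<phi> (\<lambda>y. V y \<omega>)) \<in> borel_measurable (completion \<mu>)"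
  shows "(\<lambda>\<omega>. val (M \<omega>) (QSup x \<phi>) (\<lambda>y. V y \<omega>)) \<in> borel_measurable (completion \<mu>)"
proof -
  obtain J where J: "countable J" "J \<subseteq> {i\<in>I. \<sigma> i = fst x}"
    and eq: "AE \<omega> in \<mu>. val (M \<omega>) (QSup x \<phi>) (\<lambda>y. V y \<omega>) = (SUP i\<in>J. val (M \<omega>) \<phi> (\<lambda>y. (V(x := e i)) y \<omega>))"
    using QSup_countable[OF \<phi> x V] by blast
  obtain B where B: "\<And>N v. is_structure L N \<Longrightarrow> assignment L N v \<Longrightarrow> \<bar>val (N :: ('s, 'p, 'f, 'a) aff_struct) \<phi> v\<bar> \<le> B"
    using val_bounded[OF \<phi>] by blast
  have upd: "section_assignment (V(x := e i))" if "i \<in> J" for i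
    using section_assignment_upd[OF V, of x "e i"] sec_e[of i] J(2) that by auto
  have "(\<lambda>\<omega>. SUP i\<in>J. val (M \<omega>) \<phi> (\<lambda>y. (V(x := e i)) y \<omega>)) \<in> borel_measurable (completion \<mu>)"
  proof (rule borel_measurable_cSUP[OF J(1)])
    show "(\<lambda>\<omega>. val (M \<omega>) \<phi> (\<lambda>y. (V(x := e i)) y \<omega>)) \<in> borel_measurable (completion \<mu>)" if "i \<in> J" for i
      by (rule meas[OF upd[OF that]])
    fix \<omega> assume "\<omega> \<in> space (completion \<mu>)"
    then have \<omega>: "\<omega> \<in> space \<mu>" by simp
    have "\<bar>val (M \<omega>) \<phi> (\<lambda>y. (V(x := e i)) y \<omega>)\<bar> \<le> B" if "i \<in> J" for i
      by (rule B[OF struct[OF \<omega>] section_assignment_pointwise[OF upd[OF that] \<omega>]])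
    then show "bdd_above ((\<lambda>i. val (M \<omega>) \<phi> (\<lambda>y. (V(x := e i)) y \<omega>)) ` J)"
      by (intro bdd_aboveI[of _ B]) (auto simp: abs_le_iff)
  qed
  then show ?thesis by (rule borel_measurable_completion_AE) (use eq in \<open>auto elim: AE_mp\<close>)
qed

lemma val_measurable:
  assumes "affine_formula L \<phi>" and "section_assignment V"
  shows "(\<lambda>\<omega>. val (M \<omega>) \<phi> (\<lambda>y. V y \<omega>)) \<in> borel_measurable (completion \<mu>)"
  using assms
proof (induction \<phi> arbitrary: V)
  case (Dist s t u)
  then have s: "s \<in> sorts L" "wf_trm L t" "wf_trm L u" "trm_sort L t = s" "trm_sort L u = s" by auto
  show ?case unfolding val.simps
    by (rule dst_measurable[OF s(1) trm_section[OF Dist.prems(2) s(2), unfolded s]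
      trm_section[OF Dist.prems(2) s(3), unfolded s]])
next
  case (Pred P ts)
  let ?fs = "map (\<lambda>t \<omega>. trm_val (M \<omega>) (\<lambda>x. V x \<omega>) t) ts"
  have P: "P \<in> preds L" and ts: "map (trm_sort L) ts = pdom L P" using Pred.prems by auto
  have "list_all2 (\<lambda>f s. sec s f) ?fs (map (trm_sort L) ts)"
    by (rule map_sections, rule trm_section[OF Pred.prems(2)]) (use Pred.prems(1) in simp)
  then have "(\<lambda>\<omega>. prd (M \<omega>) P (map (\<lambda>f. f \<omega>) ?fs)) \<in> borel_measurable (completion \<mu>)"
    unfolding ts by (rule prd_measurable[OF P])
  then show ?case by (simp add: comp_def)
next
  case (QSup x \<phi>)
  then show ?case by (intro QSup_measurable) auto
next
  case (QInf x \<phi>)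
  have "(\<lambda>\<omega>. val (M \<omega>) (QSup x (Scale (-1) \<phi>)) (\<lambda>y. V y \<omega>)) \<in> borel_measurable (completion \<mu>)"
  proof (rule QSup_measurable[OF _ _ QInf.prems(2)])
    fix V assume "section_assignment V"
    then have [measurable]: "(\<lambda>\<omega>. val (M \<omega>) \<phi> (\<lambda>y. V y \<omega>)) \<in> borel_measurable (completion \<mu>)"
      using QInf by simp
    show "(\<lambda>\<omega>. val (M \<omega>) (Scale (-1) \<phi>) (\<lambda>y. V y \<omega>)) \<in> borel_measurable (completion \<mu>)" by simp
  qed (use QInf.prems in auto)
  then show ?case unfolding val_QInf by (rule borel_measurable_uminus)
qed auto

section \<open>Affine formulas in the direct integral\<close>

abbreviation DI :: "('s, 'p, 'f, ('w \<Rightarrow> 'a) set) aff_struct" where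
  "DI \<equiv> direct_integral L \<mu> M I \<sigma> e"

abbreviation section_class :: "'s \<Rightarrow> ('w \<Rightarrow> 'a) \<Rightarrow> ('w \<Rightarrow> 'a) set" where
  "section_class s f \<equiv> ae_eq \<mu> M I \<sigma> e s `` {f}"

lemma section_class_iff: "g \<in> section_class s f \<longleftrightarrow> sec s f \<and> sec s g \<and> (AE \<omega> in \<mu>. f \<omega> = g \<omega>)"
  by (simp add: ae_eq_def)

lemma univ_DI: "univ DI s = {section_class s f | f. sec s f}"
  by (auto simp: direct_integral_def quotient_def)

lemma section_class_in_DI: "sec s f \<Longrightarrow> section_class s f \<in> univ DI s"
  unfolding univ_DI by blast

lemma section_in_class: "sec s f \<Longrightarrow> f \<in> section_class s f"
  unfolding section_class_iff by simp

lemma DI_sec: "a \<in> univ DI s \<Longrightarrow> f \<in> a \<Longrightarrow> sec s f"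
  unfolding univ_DI using section_class_iff by blast

lemma DI_AE_eq: "a \<in> univ DI s \<Longrightarrow> f \<in> a \<Longrightarrow> g \<in> a \<Longrightarrow> AE \<omega> in \<mu>. f \<omega> = g \<omega>"
proof -
  assume a: "a \<in> univ DI s" "f \<in> a" "g \<in> a"
  then obtain h where "a = section_class s h" unfolding univ_DI by blast
  then have "AE \<omega> in \<mu>. h \<omega> = f \<omega>" "AE \<omega> in \<mu>. h \<omega> = g \<omega>" using a(2,3) by (simp_all only: section_class_iff)
  then show ?thesis by eventually_elim simp
qed

lemma rep_in: "a \<in> univ DI s \<Longrightarrow> rep a \<in> a"
proof -
  assume "a \<in> univ DI s"
  then obtain f where "sec s f" "a = section_class s f" unfolding univ_DI by blast
  then have "f \<in> a" by (simp only: section_in_class)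
  then show ?thesis unfolding rep_def by (rule someI[where P = "\<lambda>h. h \<in> a"])
qed

text \<open>
  Elements of the direct integral are classes of sections. All representatives are admitted, and not only those
  picked by \<open>rep\<close>, because the choice in the quantifier step produces sections of its own.
\<close>

definition represents :: "('s var \<Rightarrow> ('w \<Rightarrow> 'a) set) \<Rightarrow> ('s var \<Rightarrow> 'w \<Rightarrow> 'a) \<Rightarrow> bool" where
  "represents v V \<longleftrightarrow> (\<forall>x. fst x \<in> sorts L \<longrightarrow> v x \<in> univ DI (fst x) \<and> V x \<in> v x)"

lemma represents_section_assignment: "represents v V \<Longrightarrow> section_assignment V"
  unfolding represents_def section_assignment_def using DI_sec by blast

lemma represents_upd:
  "represents v V \<Longrightarrow> a \<in> univ DI (fst x) \<Longrightarrow> f \<in> a \<Longrightarrow> represents (v(x := a)) (V(x := f))"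
  by (auto simp: represents_def)

lemma trm_val_DI:
  assumes vV: "represents v V"
  shows "wf_trm L t \<Longrightarrow> trm_val DI v t \<in> univ DI (trm_sort L t) \<and>
    (\<lambda>\<omega>. trm_val (M \<omega>) (\<lambda>x. V x \<omega>) t) \<in> trm_val DI v t"
proof (induction t)
  case (Var x)
  then show ?case using vV by (simp add: represents_def)
next
  case (App F ts)
  let ?f = "\<lambda>t \<omega>. trm_val (M \<omega>) (\<lambda>x. V x \<omega>) t" and ?r = "\<lambda>t. rep (trm_val DI v t)"
  have F: "F \<in> funs L" and ts: "map (trm_sort L) ts = fdom L F" and wf: "\<And>t. t \<in> set ts \<Longrightarrow> wf_trm L t"
    using App.prems by (auto simp: list_all_iff)
  have IH: "trm_val DI v t \<in> univ DI (trm_sort L t)" "?f t \<in> trm_val DI v t" if "t \<in> set ts" for t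
    using App.IH[OF that wf[OF that]] by auto
  have "list_all2 (\<lambda>f s. sec s f) (map ?r ts) (map (trm_sort L) ts)"
    by (rule map_sections) (rule DI_sec[OF IH(1) rep_in[OF IH(1)]])
  then have "sec (fcod L F) (\<lambda>\<omega>. fn (M \<omega>) F (map (\<lambda>f. f \<omega>) (map ?r ts)))"
    unfolding ts by (rule fn_section[OF F])
  then have r_sec: "sec (fcod L F) (\<lambda>\<omega>. fn (M \<omega>) F (map (\<lambda>t. ?r t \<omega>) ts))" by (simp add: comp_def)
  have f_sec: "sec (fcod L F) (?f (App F ts))"
    using trm_section[OF represents_section_assignment[OF vV] App.prems] by simp
  have "AE \<omega> in \<mu>. \<forall>t\<in>set ts. ?r t \<omega> = ?f t \<omega>"
    by (rule AE_finite_allI[OF finite_set]) (rule DI_AE_eq[OF IH(1) rep_in[OF IH(1)] IH(2)])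
  then have "AE \<omega> in \<mu>. fn (M \<omega>) F (map (\<lambda>t. ?r t \<omega>) ts) = ?f (App F ts) \<omega>"
  proof eventually_elim
    case (elim \<omega>)
    then have "map (\<lambda>t. ?r t \<omega>) ts = map (trm_val (M \<omega>) (\<lambda>x. V x \<omega>)) ts" by (intro map_cong) auto
    then show ?case by (simp only: trm_val.simps)
  qed
  moreover have "trm_val DI v (App F ts) = section_class (fcod L F) (\<lambda>\<omega>. fn (M \<omega>) F (map (\<lambda>t. ?r t \<omega>) ts))"
    by (simp add: direct_integral_def comp_def)
  ultimately show ?case
    using section_class_in_DI[OF r_sec] r_sec f_sec by (simp only: section_class_iff trm_sort.simps simp_thms)
qed

lemma rep_trm_val_DI:
  assumes "represents v V" and "wf_trm L t"
  shows "AE \<omega> in \<mu>. rep (trm_val DI v t) \<omega> = trm_val (M \<omega>) (\<lambda>x. V x \<omega>) t"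
proof -
  note t = conjunct1[OF trm_val_DI[OF assms]] and f = conjunct2[OF trm_val_DI[OF assms]]
  show ?thesis by (rule DI_AE_eq[OF t rep_in[OF t] f])
qed

lemma val_integrable:
  assumes "affine_formula L \<phi>" and "section_assignment V"
  shows "integrable (completion \<mu>) (\<lambda>\<omega>. val (M \<omega>) \<phi> (\<lambda>y. V y \<omega>))"
proof -
  interpret C: prob_space "completion \<mu>" by (rule prob_space_completion)
  obtain B where B: "\<And>N v. is_structure L N \<Longrightarrow> assignment L N v \<Longrightarrow> \<bar>val (N :: ('s, 'p, 'f, 'a) aff_struct) \<phi> v\<bar> \<le> B"
    using val_bounded[OF assms(1)] by blast
  show ?thesis
  proof (rule C.integrable_const_bound[where B = B])
    show "AE \<omega> in completion \<mu>. norm (val (M \<omega>) \<phi> (\<lambda>y. V y \<omega>)) \<le> B"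
      using B[OF struct section_assignment_pointwise[OF assms(2)]] by (intro AE_I2) simp
  qed (rule val_measurable[OF assms])
qed

text \<open>
  One inequality is monotonicity of the integral. For the other, a simple section realises the
  pointwise supremum up to \<open>\<epsilon>/2\<close> outside a set \<open>E\<close>; on \<open>E\<close> the error is at most \<open>2 B\<close>, and \<open>E\<close> is
  small enough for this to contribute at most \<open>\<epsilon>/2\<close> to the integral.
\<close>

lemma val_DI_QSup:
  assumes \<phi>: "affine_formula L \<phi>" and x: "fst x \<in> sorts L" and vV: "represents v V"
    and IH: "\<And>v V. represents v V \<Longrightarrow> val DI \<phi> v = (\<integral>\<omega>. val (M \<omega>) \<phi> (\<lambda>y. V y \<omega>) \<partial>completion \<mu>)"
  shows "val DI (QSup x \<phi>) v = (\<integral>\<omega>. val (M \<omega>) (QSup x \<phi>) (\<lambda>y. V y \<omega>) \<partial>completion \<mu>)"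
proof -
  interpret C: prob_space "completion \<mu>" by (rule prob_space_completion)
  have V: "section_assignment V" by (rule represents_section_assignment[OF vV])
  define h where "h \<omega> = val (M \<omega>) (QSup x \<phi>) (\<lambda>y. V y \<omega>)" for \<omega>
  define g where "g f \<omega> = val (M \<omega>) \<phi> (\<lambda>y. (V(x := f)) y \<omega>)" for f \<omega>
  have h_int: "integrable (completion \<mu>) h" unfolding h_def by (rule val_integrable[OF _ V]) (use \<phi> x in simp)
  have h_meas: "h \<in> borel_measurable (completion \<mu>)" using h_int by (rule borel_measurable_integrable)
  have g_int: "integrable (completion \<mu>) (g f)" if "sec (fst x) f" for f
    unfolding g_def by (rule val_integrable[OF \<phi> section_assignment_upd[OF V that]])
  obtain B0 where B0: "\<And>N v. is_structure L N \<Longrightarrow> assignment L N v \<Longrightarrow> \<bar>val (N :: ('s, 'p, 'f, 'a) aff_struct) \<phi> v\<bar> \<le> B0"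
    using val_bounded[OF \<phi>] by blast
  \<comment> \<open>The maximum with 1 makes \<open>B\<close> positive, as it occurs in a denominator.\<close>
  define B where "B = max 1 B0"
  have g_bd: "\<bar>g f \<omega>\<bar> \<le> B" if "sec (fst x) f" "\<omega> \<in> space \<mu>" for f \<omega>
    using B0[OF struct[OF that(2)] section_assignment_pointwise[OF section_assignment_upd[OF V that(1)] that(2)]]
    by (simp add: g_def B_def)
  have h_bd: "\<bar>h \<omega>\<bar> \<le> B" if "\<omega> \<in> space \<mu>" for \<omega>
    using val_bounded_QSup[OF struct[OF that] x B0[OF struct[OF that]] section_assignment_pointwise[OF V that]]
    by (simp add: h_def B_def)
  have g_le_h: "g f \<omega> \<le> h \<omega>" if f: "sec (fst x) f" and \<omega>: "\<omega> \<in> space \<mu>" for f \<omega>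
  proof -
    have v: "assignment L (M \<omega>) (\<lambda>y. V y \<omega>)" by (rule section_assignment_pointwise[OF V \<omega>])
    have "bdd_above ((\<lambda>a. val (M \<omega>) \<phi> ((\<lambda>y. V y \<omega>)(x := a))) ` univ (M \<omega>) (fst x))"
      using B0[OF struct[OF \<omega>] assignment_upd[OF v, where x = x]] by (intro bdd_aboveI[of _ B0]) (auto simp: abs_le_iff)
    then have "val (M \<omega>) \<phi> ((\<lambda>y. V y \<omega>)(x := f \<omega>)) \<le> h \<omega>"
      unfolding h_def val.simps by (intro cSUP_upper sec_univ[OF f \<omega>])
    moreover have "(\<lambda>y. V y \<omega>)(x := f \<omega>) = (\<lambda>y. (V(x := f)) y \<omega>)" by (simp add: fun_eq_iff)
    ultimately show ?thesis by (simp only: g_def)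
  qed
  have val_g: "val DI \<phi> (v(x := a)) = (\<integral>\<omega>. g f \<omega> \<partial>completion \<mu>)" if "a \<in> univ DI (fst x)" "f \<in> a" for a f
    unfolding g_def by (rule IH[OF represents_upd[OF vV that]])
  have le: "val DI \<phi> (v(x := a)) \<le> (\<integral>\<omega>. h \<omega> \<partial>completion \<mu>)" if a: "a \<in> univ DI (fst x)" for a
  proof -
    have f: "sec (fst x) (rep a)" by (rule DI_sec[OF a rep_in[OF a]])
    show ?thesis unfolding val_g[OF a rep_in[OF a]]
      by (rule integral_mono[OF g_int[OF f] h_int]) (use g_le_h[OF f] in simp)
  qed
  obtain i0 where i0: "i0 \<in> I" "\<sigma> i0 = fst x" using sort_inhabited[OF x] by blast
  have ne: "univ DI (fst x) \<noteq> {}" using section_class_in_DI[OF sec_e[OF i0(1)]] i0(2) by auto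
  have bdd: "bdd_above ((\<lambda>a. val DI \<phi> (v(x := a))) ` univ DI (fst x))"
    using le by (intro bdd_aboveI2)
  obtain J where J: "countable J" "J \<noteq> {}" "J \<subseteq> {i\<in>I. \<sigma> i = fst x}"
    and h_eq: "AE \<omega> in \<mu>. h \<omega> = (SUP i\<in>J. g (e i) \<omega>)"
    using QSup_countable[OF \<phi> x V] unfolding h_def g_def by blast
  have eJ: "sec (fst x) (e i)" if "i \<in> J" for i using sec_e[of i] J(3) that by auto
  have "val DI (QSup x \<phi>) v = (\<integral>\<omega>. h \<omega> \<partial>completion \<mu>)"
    unfolding val.simps
  proof (rule antisym)
    show "(SUP a\<in>univ DI (fst x). val DI \<phi> (v(x := a))) \<le> (\<integral>\<omega>. h \<omega> \<partial>completion \<mu>)"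
      by (rule cSUP_least[OF ne le])
    show "(\<integral>\<omega>. h \<omega> \<partial>completion \<mu>) \<le> (SUP a\<in>univ DI (fst x). val DI \<phi> (v(x := a)))"
    proof (rule field_le_epsilon)
      fix \<epsilon> :: real assume \<epsilon>: "\<epsilon> > 0"
      define P where "P i = {\<omega>\<in>space \<mu>. h \<omega> - \<epsilon> / 2 < g (e i) \<omega>}" for i
      have "\<exists>k E. simple_function \<mu> k \<and> k ` space \<mu> \<subseteq> J \<and> E \<in> sets (completion \<mu>) \<and>
          measure (completion \<mu>) E < \<epsilon> / (4 * B) \<and> (AE \<omega> in \<mu>. \<omega> \<notin> E \<longrightarrow> \<omega> \<in> P (k \<omega>))"
      proof (rule simple_selection_completion[OF J(1,2)])
        fix i assume i: "i \<in> J"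
        have [measurable]: "g (e i) \<in> borel_measurable (completion \<mu>)" "h \<in> borel_measurable (completion \<mu>)"
          using borel_measurable_integrable[OF g_int[OF eJ[OF i]]] h_meas by auto
        have "{\<omega>\<in>space (completion \<mu>). h \<omega> - \<epsilon> / 2 < g (e i) \<omega>} \<in> sets (completion \<mu>)" by measurable
        then show "P i \<in> sets (completion \<mu>)" by (simp add: P_def)
      next
        show "AE \<omega> in \<mu>. \<exists>i\<in>J. \<omega> \<in> P i" using h_eq AE_space
        proof eventually_elim
          case (elim \<omega>)
          have "h \<omega> - \<epsilon> / 2 < (SUP i\<in>J. g (e i) \<omega>)" using elim(1) \<epsilon> by simp
          then have "\<exists>y\<in>(\<lambda>i. g (e i) \<omega>) ` J. h \<omega> - \<epsilon> / 2 < y" using J(2) by (intro less_cSupD) auto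
          then show ?case using elim(2) by (auto simp: P_def)
        qed
      qed (use \<epsilon> in \<open>simp add: B_def\<close>)
      then obtain k E where k: "simple_function \<mu> k" "k ` space \<mu> \<subseteq> J" and E: "E \<in> sets (completion \<mu>)"
        "measure (completion \<mu>) E < \<epsilon> / (4 * B)" and kP: "AE \<omega> in \<mu>. \<omega> \<notin> E \<longrightarrow> \<omega> \<in> P (k \<omega>)" by blast
      define f where "f \<omega> = e (k \<omega>) \<omega>" for \<omega>
      have f: "sec (fst x) f" unfolding f_def using k J(3) by (intro sec_simple) auto
      have gf: "g f \<omega> = g (e (k \<omega>)) \<omega>" for \<omega>
        unfolding g_def by (rule arg_cong[where f = "val (M \<omega>) \<phi>"]) (simp add: fun_eq_iff f_def)
      have E_space: "E \<inter> space \<mu> = E" using sets.sets_into_space[OF E(1)] by auto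
      have ind: "integrable (completion \<mu>) (\<lambda>\<omega>. 2 * B * indicator E \<omega> :: real)"
        by (intro integrable_mult_right integrable_real_indicator E(1))
           (simp add: C.emeasure_eq_measure del: emeasure_completion)
      have "(\<integral>\<omega>. h \<omega> - 2 * B * indicator E \<omega> \<partial>completion \<mu>) \<le> (\<integral>\<omega>. g f \<omega> + \<epsilon> / 2 \<partial>completion \<mu>)"
      proof (rule integral_mono_AE)
        show "AE \<omega> in completion \<mu>. h \<omega> - 2 * B * indicator E \<omega> \<le> g f \<omega> + \<epsilon> / 2"
        proof (rule AE_completion)
          show "AE \<omega> in \<mu>. h \<omega> - 2 * B * indicator E \<omega> \<le> g f \<omega> + \<epsilon> / 2" using kP AE_space
          proof eventually_elim
            case (elim \<omega>)
            show ?case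
            proof (cases "\<omega> \<in> E")
              case True
              then show ?thesis using h_bd[OF elim(2)] g_bd[OF f elim(2)] \<epsilon> by (simp add: abs_le_iff)
            next
              case False
              then show ?thesis using elim(1) by (simp add: P_def gf)
            qed
          qed
        qed
      qed (use h_int ind g_int[OF f] in auto)
      then have "(\<integral>\<omega>. h \<omega> \<partial>completion \<mu>) \<le> (\<integral>\<omega>. g f \<omega> \<partial>completion \<mu>) + \<epsilon> / 2 + 2 * B * measure (completion \<mu>) E"
        using h_int ind g_int[OF f] E(1) C.prob_space E_space by simp
      moreover have "2 * B * measure (completion \<mu>) E \<le> \<epsilon> / 2"
      proof -
        have "B > 0" by (simp add: B_def)
        then have "2 * B * measure (completion \<mu>) E \<le> 2 * B * (\<epsilon> / (4 * B))" using E(2) by (intro mult_left_mono) auto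
        then show ?thesis using \<open>B > 0\<close> by simp
      qed
      moreover have "(\<integral>\<omega>. g f \<omega> \<partial>completion \<mu>) \<le> (SUP a\<in>univ DI (fst x). val DI \<phi> (v(x := a)))"
        using cSUP_upper[OF section_class_in_DI[OF f] bdd] val_g[OF section_class_in_DI[OF f] section_in_class[OF f]] by simp
      ultimately show "(\<integral>\<omega>. h \<omega> \<partial>completion \<mu>) \<le> (SUP a\<in>univ DI (fst x). val DI \<phi> (v(x := a))) + \<epsilon>" by linarith
    qed
  qed
  then show ?thesis by (simp only: h_def)
qed

text \<open>
  The analogue of Los's theorem for affine formulas: affine connectives and quantifiers
  commute with integration.
\<close>

theorem val_direct_integral:
  assumes "affine_formula L \<phi>" and "represents v V"
  shows "val DI \<phi> v = (\<integral>\<omega>. val (M \<omega>) \<phi> (\<lambda>y. V y \<omega>) \<partial>completion \<mu>)"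
  using assms
proof (induction \<phi> arbitrary: v V)
  case (Dist s t u)
  then have wf: "wf_trm L t" "wf_trm L u" by auto
  have eq: "AE \<omega> in \<mu>. rep (trm_val DI v t) \<omega> = trm_val (M \<omega>) (\<lambda>x. V x \<omega>) t" if "wf_trm L t" for t
    by (rule rep_trm_val_DI[OF Dist.prems(2) that])
  have eq': "AE \<omega> in \<mu>. val (M \<omega>) (Dist s t u) (\<lambda>x. V x \<omega>) = dst (M \<omega>) s (rep (trm_val DI v t) \<omega>) (rep (trm_val DI v u) \<omega>)"
    using eq[OF wf(1)] eq[OF wf(2)] by eventually_elim simp
  have meas: "(\<lambda>\<omega>. val (M \<omega>) (Dist s t u) (\<lambda>x. V x \<omega>)) \<in> borel_measurable (completion \<mu>)"
    by (rule val_measurable[OF Dist.prems(1) represents_section_assignment[OF Dist.prems(2)]])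
  have "(\<integral>\<omega>. val (M \<omega>) (Dist s t u) (\<lambda>x. V x \<omega>) \<partial>completion \<mu>) =
      (\<integral>\<omega>. dst (M \<omega>) s (rep (trm_val DI v t) \<omega>) (rep (trm_val DI v u) \<omega>) \<partial>completion \<mu>)"
    by (rule integral_cong_AE[OF meas borel_measurable_completion_AE[OF meas eq'] AE_completion[OF eq']])
  then show ?case by (simp add: direct_integral_def)
next
  case (Pred P ts)
  then have wf: "\<And>t. t \<in> set ts \<Longrightarrow> wf_trm L t" by auto
  have "AE \<omega> in \<mu>. \<forall>t\<in>set ts. rep (trm_val DI v t) \<omega> = trm_val (M \<omega>) (\<lambda>x. V x \<omega>) t"
    by (rule AE_finite_allI[OF finite_set rep_trm_val_DI[OF Pred.prems(2) wf]])
  then have eq: "AE \<omega> in \<mu>. val (M \<omega>) (Pred P ts) (\<lambda>x. V x \<omega>) = prd (M \<omega>) P (map (\<lambda>t. rep (trm_val DI v t) \<omega>) ts)"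
  proof eventually_elim
    case (elim \<omega>)
    then have "map (\<lambda>t. rep (trm_val DI v t) \<omega>) ts = map (trm_val (M \<omega>) (\<lambda>x. V x \<omega>)) ts" by (intro map_cong) auto
    then show ?case by (simp only: val.simps)
  qed
  have meas: "(\<lambda>\<omega>. val (M \<omega>) (Pred P ts) (\<lambda>x. V x \<omega>)) \<in> borel_measurable (completion \<mu>)"
    by (rule val_measurable[OF Pred.prems(1) represents_section_assignment[OF Pred.prems(2)]])
  have "(\<integral>\<omega>. val (M \<omega>) (Pred P ts) (\<lambda>x. V x \<omega>) \<partial>completion \<mu>) =
      (\<integral>\<omega>. prd (M \<omega>) P (map (\<lambda>t. rep (trm_val DI v t) \<omega>) ts) \<partial>completion \<mu>)"
    by (rule integral_cong_AE[OF meas borel_measurable_completion_AE[OF meas eq] AE_completion[OF eq]])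
  then show ?case by (simp add: direct_integral_def comp_def)
next
  case (Const r)
  interpret C: prob_space "completion \<mu>" by (rule prob_space_completion)
  show ?case using C.prob_space by simp
next
  case (Plus \<phi> \<psi>)
  then show ?case using val_integrable[OF _ represents_section_assignment[OF Plus.prems(2)]] by simp
next
  case (Scale r \<phi>)
  then show ?case by simp
next
  case (QSup x \<phi>)
  show ?case 
    by (rule val_DI_QSup[where V = V]) (use QSup in auto)
next
  case (QInf x \<phi>)
  have "val DI (QSup x (Scale (-1) \<phi>)) v = (\<integral>\<omega>. val (M \<omega>) (QSup x (Scale (-1) \<phi>)) (\<lambda>y. V y \<omega>) \<partial>completion \<mu>)"
    by (rule val_DI_QSup[OF _ _ QInf.prems(2)]) (use QInf in auto)
  then show ?case unfolding val_QInf by (simp del: val.simps)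
qed

end

section \<open>Stability of the direct integral\<close>

lemma stable_formulaD:
  assumes st: "stable_formula M X Y \<phi>" and a: "\<And>n. a n \<in> tuples_on M X" and b: "\<And>m. b m \<in> tuples_on M Y"
    and c: "\<And>n. (\<lambda>m. val2 M X \<phi> (a n) (b m)) \<longlonglongrightarrow> c n" and g: "\<And>m. (\<lambda>n. val2 M X \<phi> (a n) (b m)) \<longlonglongrightarrow> g m"
    and \<alpha>: "c \<longlonglongrightarrow> \<alpha>" and \<beta>: "g \<longlonglongrightarrow> \<beta>"
  shows "\<alpha> = \<beta>"
proof -
  have lims: "lim (\<lambda>m. val2 M X \<phi> (a n) (b m)) = c n" "lim (\<lambda>k. val2 M X \<phi> (a k) (b n)) = g n" for n
    using c g by (simp_all add: limI)
  have "lim (\<lambda>n. lim (\<lambda>m. val2 M X \<phi> (a n) (b m))) = lim (\<lambda>m. lim (\<lambda>n. val2 M X \<phi> (a n) (b m)))"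
  proof (rule st[unfolded stable_formula_def, rule_format])
    show "range a \<subseteq> tuples_on M X" "range b \<subseteq> tuples_on M Y" using a b by auto
    show "convergent (\<lambda>m. val2 M X \<phi> (a n) (b m))" for n using c by (auto simp: convergent_def)
    show "convergent (\<lambda>n. val2 M X \<phi> (a n) (b m))" for m using g by (auto simp: convergent_def)
    show "convergent (\<lambda>n. lim (\<lambda>m. val2 M X \<phi> (a n) (b m)))" unfolding lims using \<alpha> by (auto simp: convergent_def)
    show "convergent (\<lambda>m. lim (\<lambda>n. val2 M X \<phi> (a n) (b m)))" unfolding lims using \<beta> by (auto simp: convergent_def)
  qed
  then show ?thesis unfolding lims using \<alpha> \<beta> by (simp add: limI)
qed

theorem (in measurable_structure_field) stable_direct_integral:
  assumes \<phi>: "affine_formula L \<phi>" and XY: "fst ` (X \<union> Y) \<subseteq> sorts L" "X \<inter> Y = {}" "free_vars \<phi> \<subseteq> X \<union> Y"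
    and stable: "AE \<omega> in \<mu>. stable_formula (M \<omega>) X Y \<phi>"
  shows "stable_formula DI X Y \<phi>"
  unfolding stable_formula_def
proof (intro allI impI)
  fix a b :: "nat \<Rightarrow> 's var \<Rightarrow> ('w \<Rightarrow> 'a) set"
  let ?val = "\<lambda>n m. val2 DI X \<phi> (a n) (b m)"
  assume a: "range a \<subseteq> tuples_on DI X" and b: "range b \<subseteq> tuples_on DI Y"
    and rows: "\<forall>n. convergent (?val n)" and cols: "\<forall>m. convergent (\<lambda>n. ?val n m)"
    and row_lims: "convergent (\<lambda>n. lim (?val n))" and col_lims: "convergent (\<lambda>m. lim (\<lambda>n. ?val n m))"
  have "\<exists>d. \<forall>s\<in>sorts L. d s \<in> univ DI s"
  proof (intro bchoice ballI)
    fix s assume "s \<in> sorts L"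
    then obtain i where "i \<in> I" "\<sigma> i = s" using sort_inhabited by blast
    then show "\<exists>c. c \<in> univ DI s" using section_class_in_DI[OF sec_e] by blast
  qed
  then obtain d where d: "\<forall>s\<in>sorts L. d s \<in> univ DI s" by (rule exE)
  \<comment> \<open>The classes \<open>d s\<close> only fill in values for variables outside \<open>X \<union> Y\<close>.\<close>
  define v where "v n m x = (if x \<in> X then a n x else if x \<in> Y then b m x else d (fst x))" for n m x
  define V where "V n m x = rep (v n m x)" for n m x
  have a_in: "a n x \<in> univ DI (fst x)" if "x \<in> X" for n x
    using a that by (auto simp: tuples_on_def PiE_iff image_subset_iff)
  have b_in: "b m x \<in> univ DI (fst x)" if "x \<in> Y" for m x
    using b that by (auto simp: tuples_on_def PiE_iff image_subset_iff)
  have v_in: "v n m x \<in> univ DI (fst x)" if "fst x \<in> sorts L" for n m x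
    using a_in b_in d that by (simp add: v_def)
  then have vV: "represents (v n m) (V n m)" for n m
    unfolding represents_def V_def using rep_in by blast
  define F where "F n m \<omega> = val (M \<omega>) \<phi> (\<lambda>x. V n m x \<omega>)" for n m \<omega>
  have val_F: "?val n m = (\<integral>\<omega>. F n m \<omega> \<partial>completion \<mu>)" for n m
  proof -
    have "?val n m = val DI \<phi> (v n m)"
      unfolding val2_def by (rule val_cong) (use XY(3) in \<open>auto simp: v_def\<close>)
    then show ?thesis unfolding F_def by (simp only: val_direct_integral[OF \<phi> vV])
  qed
  obtain B where B: "\<And>N v. is_structure L N \<Longrightarrow> assignment L N v \<Longrightarrow> \<bar>val (N :: ('s, 'p, 'f, 'a) aff_struct) \<phi> v\<bar> \<le> B"
    using val_bounded[OF \<phi>] by blast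
  have V: "section_assignment (V n m)" for n m by (rule represents_section_assignment[OF vV])
  have V_univ: "V n m x \<omega> \<in> univ (M \<omega>) (fst x)" if "fst x \<in> sorts L" "\<omega> \<in> space \<mu>" for n m x \<omega>
    using V[of n m] sec_univ that unfolding section_assignment_def by blast
  have F_stable: "AE \<omega> in \<mu>. stable_array (\<lambda>n m. F n m \<omega>)" using stable AE_space
  proof eventually_elim
    case (elim \<omega>)
    show ?case unfolding stable_array_def
    proof (intro allI impI)
      fix r s :: "nat \<Rightarrow> nat" and c g \<alpha> \<beta>
      assume c: "\<forall>n. (\<lambda>m. F (r n) (s m) \<omega>) \<longlonglongrightarrow> c n" and g: "\<forall>m. (\<lambda>n. F (r n) (s m) \<omega>) \<longlonglongrightarrow> g m"
        and \<alpha>: "c \<longlonglongrightarrow> \<alpha>" and \<beta>: "g \<longlonglongrightarrow> \<beta>"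
      define a' where "a' n = restrict (\<lambda>x. V n 0 x \<omega>) X" for n
      define b' where "b' m = restrict (\<lambda>x. V 0 m x \<omega>) Y" for m
      have a': "a' n \<in> tuples_on (M \<omega>) X" for n
        unfolding a'_def tuples_on_def using XY(1) V_univ[OF _ elim(2)] by (intro restrict_PiE[THEN iffD2] Pi_I) auto
      have b': "b' m \<in> tuples_on (M \<omega>) Y" for m
        unfolding b'_def tuples_on_def using XY(1) V_univ[OF _ elim(2)] by (intro restrict_PiE[THEN iffD2] Pi_I) auto
      have "val2 (M \<omega>) X \<phi> (a' n) (b' m) = F n m \<omega>" for n m
        unfolding val2_def F_def
        by (rule val_cong) (use XY(2,3) in \<open>auto simp: a'_def b'_def V_def v_def\<close>)
      then show "\<alpha> = \<beta>" using c g
        by (intro stable_formulaD[OF elim(1), of "\<lambda>n. a' (r n)" "\<lambda>m. b' (s m)" c g \<alpha> \<beta>] a' b' \<alpha> \<beta>) simp_all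
    qed
  qed
  show "lim (\<lambda>n. lim (?val n)) = lim (\<lambda>m. lim (\<lambda>n. ?val n m))"
  proof (rule integral_of_stable_arrays[where P = "completion \<mu>" and F = F and C = B])
    show "prob_space (completion \<mu>)" by (rule prob_space_completion)
    show "F n m \<in> borel_measurable (completion \<mu>)" for n m
      unfolding F_def by (rule val_measurable[OF \<phi> V])
    show "\<bar>F n m \<omega>\<bar> \<le> B" if "\<omega> \<in> space (completion \<mu>)" for n m \<omega>
      unfolding F_def using that by (intro B struct section_assignment_pointwise[OF V]) simp_all
    show "AE \<omega> in completion \<mu>. stable_array (\<lambda>n m. F n m \<omega>)" by (rule AE_completion[OF F_stable])
    show "(\<lambda>m. \<integral>\<omega>. F n m \<omega> \<partial>completion \<mu>) \<longlonglongrightarrow> lim (?val n)" for n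
      using rows unfolding val_F convergent_LIMSEQ_iff by blast
    show "(\<lambda>n. \<integral>\<omega>. F n m \<omega> \<partial>completion \<mu>) \<longlonglongrightarrow> lim (\<lambda>n. ?val n m)" for m
      using cols unfolding val_F convergent_LIMSEQ_iff by blast
    show "(\<lambda>n. lim (?val n)) \<longlonglongrightarrow> lim (\<lambda>n. lim (?val n))"
      using row_lims unfolding convergent_LIMSEQ_iff .
    show "(\<lambda>m. lim (\<lambda>n. ?val n m)) \<longlonglongrightarrow> lim (\<lambda>m. lim (\<lambda>n. ?val n m))"
      using col_lims unfolding convergent_LIMSEQ_iff .
  qed
qed

theorem theorem3p4:
  fixes L :: "('s, 'p, 'f) lang"
    and \<phi> :: "('s, 'p, 'f) fml"
    and X Y :: "'s var set"
    and \<mu> :: "'w measure"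
    and M :: "'w \<Rightarrow> ('s, 'p, 'f, 'a) aff_struct"
    and I :: "'i set" and \<sigma> :: "'i \<Rightarrow> 's" and e :: "'i \<Rightarrow> 'w \<Rightarrow> 'a"
  assumes "language L"
    and "affine_formula L \<phi>"
    and "fst ` (X \<union> Y) \<subseteq> sorts L" and "X \<inter> Y = {}" and "free_vars \<phi> \<subseteq> X \<union> Y"
    and "prob_space \<mu>"
    and "measurable_field L \<mu> M I \<sigma> e"
    and "AE \<omega> in \<mu>. stable_formula (M \<omega>) X Y \<phi>"
  shows "stable_formula (direct_integral L \<mu> M I \<sigma> e) X Y \<phi>"
proof -
  interpret measurable_structure_field \<mu> L M I \<sigma> e
    using assms(1,6,7) by (simp add: measurable_structure_field_def measurable_structure_field_axioms_def)
  show ?thesis using assms(2-5,8) by (rule stable_direct_integral)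
qed

end
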